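(* Let $\lambda,\mu\in M$ and let $\{\lambda_k\},\{\mu_j\}\subset M$ be sequences with $\lambda_k\to\lambda$ and $\mu_j\to\mu$ in the complete metric space $(M,d)$. Assume there are positive constants $\bar C,L_F$ with $L_F>\bar C$ and, for each $\lambda'\in M$ and each of $h\in\{b_{\lambda'},\sigma_{\lambda'},f_{\lambda'},G_{\lambda'}\}$, positive constants $K_h,L_h$, such that for all $\lambda'\in M$, $t\in[0,T]$, $y,y_1,y_2\in\mathbb{R}^{m+n}$, $u,u_1,u_2\in E$, $\tilde y,\tilde y_1,\tilde y_2\in\mathcal{L}^2_{ad}([0,T]\times\Omega,\mathbb{R}^{m+n})$, $\tilde u_1,\tilde u_2\in H[0,T]$: (i) for each $h\in\{b_{\lambda'},\sigma_{\lambda'},f_{\lambda'}\}$, $\|h(t,y,u)\|^2\le K_h(1+\|y\|^2+\|u\|^2)$, and $\int_{\|x\|<c}\|G_{\lambda'}(t,y,u,x)\|^2v(dx)\le K_{G_{\lambda'}}(1+\|y\|^2+\|u\|^2)$; (ii) for each $h\in\{b_{\lambda'},\sigma_{\lambda'},f_{\lambda'}\}$, $\|h(t,y_1,u_1)-h(t,y_2,u_2)\|^2\le L_h(\|y_1-y_2\|^2+\|u_1-u_2\|^2)$, and $\int_{\|x\|<c}\|G_{\lambda'}(t,y_1,u_1,x)-G_{\lambda'}(t,y_2,u_2,x)\|^2v(dx)\le L_{G_{\lambda'}}(\|y_1-y_2\|^2+\|u_1-u_2\|^2)$; (iii) $\|\tilde F_{\lambda'}(\tilde y_1,\tilde u_1)-\tilde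 F_{\lambda'}(\tilde y_2,\tilde u_2)\|\le L_F(\|\tilde y_1-\tilde y_2\|+\|\tilde u_1-\tilde u_2\|)$ and $\langle\tilde F_{\lambda'}(\tilde y,\tilde u_1)-\tilde F_{\lambda'}(\tilde y,\tilde u_2),\tilde u_1-\tilde u_2\rangle_{H[0,T]}\ge\bar C\|\tilde u_1-\tilde u_2\|_{H[0,T]}^2$, the norms being those of the respective $\mathcal{L}^2_{ad}$ spaces; (iv) $b_{\lambda'},\sigma_{\lambda'},f_{\lambda'},G_{\lambda'},F_{\lambda'}$ are uniformly continuous with respect to $\lambda'$, uniformly in their remaining arguments ($G_{\lambda'}(t,y,u,\cdot)$ being measured by $\left(\int_{\|x\|<c}\|\cdot\|^2v(dx)\right)^{1/2}$). Suppose also $K_{\mu_j}\overset{M}{\rightarrow}K_\mu$ (Mosco convergence in $E$). Let $(y_{\lambda,\mu},u_{\lambda,\mu})\in\mathcal{L}^2_{ad}([0,T]\times\Omega,\mathbb{R}^{m+n})\times U_\mu[0,T]$ be the unique solution of $\mathbf{SPEP}(b_\lambda,\sigma_\lambda,f_\lambda,G_\lambda,\tilde F_\lambda;K_\mu,y_0)$ and $(y_{\lambda_k,\mu_j},u_{\lambda_k,\mu_j})\in\mathcal{L}^2_{ad}([0,T]\times\Omega,\mathbb{R}^{m+n})\times U_{\mu_j}[0,T]$ the unique solution of $\mathbf{SPEP}(b_{\lambda_k},\sigma_{\lambda_k},f_{\lambda_k},G_{\lambda_k},\tilde F_{\lambda_k};K_{\mu_j},y_0)$. Then, as $\lambda_k\to\lambda$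 and $\mu_j\to\mu$, $y_{\lambda_k,\mu_j}\to y_{\lambda,\mu}$ in $\mathcal{L}^2_{ad}([0,T]\times\Omega,\mathbb{R}^{m+n})$ and $u_{\lambda_k,\mu_j}\to u_{\lambda,\mu}$ in $H[0,T]$.
   Context: Setting (stochastic spatial price equilibrium with $m$ supply markets and $n$ demand markets). $(\Omega,\mathcal{F},\{\mathcal{F}_t\}_{t\ge0},\mathbb{P})$ is a complete filtered probability space, $T>0$, $\alpha\in(\tfrac12,1)$, $c\ge0$. $B_1,B_2$ are $\mathcal{F}_t$-adapted (finite-dimensional) Brownian motions; $N_1,N_2$ are $\mathcal{F}_t$-adapted Poisson random measures on $\mathbb{R}^+\times(\mathbb{R}^m\setminus\{0\})$ and $\mathbb{R}^+\times(\mathbb{R}^n\setminus\{0\})$, with intensity measures $v_1,v_2$ satisfying $\int\frac{\|x\|^2}{1+\|x\|^2}v_i(dx)<\infty$, and $\tilde N_i(dt,dx)=N_i(dt,dx)-v_i(dx)dt$; $B_1,B_2,N_1,N_2$ are mutually independent. $E=\mathbb{R}^m\times\mathbb{R}^n\times\mathbb{R}^{m\times n}$; its elements are written $u=(\bar S,\bar D,a)$ (supplies, demands, shipments), and $y=(p,q)\in\mathbb{R}^m\times\mathbb{R}^n=\mathbb{R}^{m+n}$ (supply and demand prices). $\mathcal{L}^2_{ad}([0,T]\times\Omega,V)$ is the Hilbert space of $V$-valued $\mathcal{F}_t$-adapted processes $g$ with $\mathbb{E}\int_0^T\|g\|^2dt<\infty$; $H[0,T]=\mathcal{L}^2_{ad}([0,T]\times\Omega,E)$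 with $\langle a,b\rangle_{H[0,T]}=\mathbb{E}\int_0^T\langle a,b\rangle dt$. For $\mu$ in the complete metric space $(M,d)$, $K_\mu\subset E$ is a closed convex set with $0\in K_\mu$ and $U_\mu[0,T]=\{u\in H[0,T]:u(t,\omega)\in K_\mu\text{ a.e. }t,\text{ a.s. }\omega\}$. For each $\lambda\in M$ there are measurable adapted coefficients in block form: $b_\lambda(t,y,u)=(b_{1\lambda}(t,p,\bar S),b_{2\lambda}(t,q,\bar D))$, $\sigma_\lambda(t,y,u)=(\sigma_{1\lambda}(t,p,\bar S),\sigma_{2\lambda}(t,q,\bar D))$ (continuous in $t$), $f_\lambda(t,y,u)=\mathrm{diag}(f_{1\lambda}(t,p,\bar S),f_{2\lambda}(t,q,\bar D))$, $G_\lambda(t,y,u,x)=\mathrm{diag}(G_{1\lambda}(t,p,\bar S,x),G_{2\lambda}(t,q,\bar D,x))$, and $F_\lambda:[0,T]\times\Omega\times\mathbb{R}^{m+n}\times E\to E$ with induced operator $\tilde F_\lambda(y,u)(s,\omega)=F_\lambda(s,\omega,y(s,\omega),u(s,\omega))\in H[0,T]$. Integrals $\int_{\|x\|<c}\|G_\lambda\|^2v(dx)$ mean $\sum_{i=1}^2\int_{\|x\|<c}\|G_{i\lambda}\|^2v_i(dx)$, and similarly for differences. The jump integrals are assumed to be square integrable martingales. The initial value $y_0=(p_0,q_0)$ satisfies $\mathbb{E}\|y_0\|^2<\infty$. (In the unperturbed equilibrium model, $F(t,\omega,p,q,u)=(p,-q,c(a))$ with $c(a)=(c_{ij}(a_{ij}))$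 the unit transportation costs, and $K=\{(A,B,C)\in E: C_{ij}\ge0,\ A_i=\sum_jC_{ij},\ B_j=\sum_iC_{ij}\}$; the families indexed by $\lambda$ and $\mu$ are perturbations of these data.) System $\mathbf{SPEP}(b_\lambda,\sigma_\lambda,f_\lambda,G_\lambda,\tilde F_\lambda;K_\mu,y_0)$: find $y=(p,q)\in\mathcal{L}^2_{ad}([0,T]\times\Omega,\mathbb{R}^{m+n})$ and $u=(\bar S,\bar D,a)\in U_\mu[0,T]$ such that $y(0)=y_0$, $$dp(t)=b_{1\lambda}(t,p(t-),\bar S(t-))dt+\sigma_{1\lambda}(t,p(t-),\bar S(t-))(dt)^\alpha+f_{1\lambda}(t,p(t-),\bar S(t-))dB_1(t)+\int_{\|x\|<c}G_{1\lambda}(t,p(t-),\bar S(t-),x)\tilde N_1(dt,dx),$$ $$dq(t)=b_{2\lambda}(t,q(t-),\bar D(t-))dt+\sigma_{2\lambda}(t,q(t-),\bar D(t-))(dt)^\alpha+f_{2\lambda}(t,q(t-),\bar D(t-))dB_2(t)+\int_{\|x\|<c}G_{2\lambda}(t,q(t-),\bar D(t-),x)\tilde N_2(dt,dx),$$ and $\langle F_\lambda(t,\omega,y(t,\omega),u(t,\omega)),w-u(t,\omega)\rangle\ge0$ for all $w\in K_\mu$, a.e. $t\in[0,T]$, a.s. $\omega\in\Omega$. The equations are understood in integral form with $\int_0^t g(s)(ds)^\alpha:=\alpha\int_0^t(t-s)^{\alpha-1}g(s)ds$. Uniqueness is in the almost-everywhere sense. Mosco convergence: for closed convex subsets $C_j,C_0$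 of a Hilbert space, $C_j\overset{M}{\rightarrow}C_0$ means: every $x\in C_0$ is the strong limit of some $x_j\in C_j$, and whenever $x_{j_i}\in C_{j_i}$ along a subsequence with $x_{j_i}\rightharpoonup x$ weakly, then $x\in C_0$. *)

theory Defs
  imports "HOL-Probability.Probability"
begin

section \<open>Complete filtered probability spaces and square integrable adapted processes\<close>

text \<open>A process is a function of a time in \<^typ>\<open>real\<close> and a sample point; only times \<open>t \<ge> 0\<close> matter,
  whence \<open>F (max 0 t)\<close> when the library's notion of filtration is used.\<close>

definition complete_filtered_prob_space :: "'w measure \<Rightarrow> (real \<Rightarrow> 'w measure) \<Rightarrow> bool" where
  "complete_filtered_prob_space P F \<longleftrightarrow>
     prob_space P \<and> complete_measure P \<and>
     filtration (space P) (\<lambda>t. F (max 0 t)) \<and>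
     (\<forall>t\<ge>0. subalgebra P (F t)) \<and>
     null_sets P \<subseteq> sets (F 0)"

definition L2ad :: "'w measure \<Rightarrow> (real \<Rightarrow> 'w measure) \<Rightarrow> real \<Rightarrow>
    (real \<Rightarrow> 'w \<Rightarrow> 'v::euclidean_space) set" where
  "L2ad P F T = {g.
     (\<lambda>(t, \<omega>). g t \<omega>) \<in> borel_measurable (restrict_space borel {0..T} \<Otimes>\<^sub>M P) \<and>
     (\<forall>t\<in>{0..T}. g t \<in> borel_measurable (F t)) \<and>
     (\<integral>\<^sup>+\<omega>. (\<integral>\<^sup>+t\<in>{0..T}. ennreal ((norm (g t \<omega>))\<^sup>2) \<partial>lborel) \<partial>P) < \<infinity>}"

text \<open>Elements of \<open>L2ad\<close> are processes, not equivalence classes; accordingly \<open>L2_norm\<close> is only a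
  seminorm, and equality in the Hilbert space is equality almost everywhere.\<close>

definition L2_inner :: "'w measure \<Rightarrow> real \<Rightarrow> (real \<Rightarrow> 'w \<Rightarrow> 'v::euclidean_space) \<Rightarrow>
    (real \<Rightarrow> 'w \<Rightarrow> 'v) \<Rightarrow> real" where
  "L2_inner P T a b = (\<integral>\<omega>. (LBINT t:{0..T}. a t \<omega> \<bullet> b t \<omega>) \<partial>P)"

definition L2_norm :: "'w measure \<Rightarrow> real \<Rightarrow> (real \<Rightarrow> 'w \<Rightarrow> 'v::euclidean_space) \<Rightarrow> real" where
  "L2_norm P T a = sqrt (L2_inner P T a a)"

definition L2_dist :: "'w measure \<Rightarrow> real \<Rightarrow> (real \<Rightarrow> 'w \<Rightarrow> 'v::euclidean_space) \<Rightarrow>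
    (real \<Rightarrow> 'w \<Rightarrow> 'v) \<Rightarrow> real" where
  "L2_dist P T a b = L2_norm P T (\<lambda>t \<omega>. a t \<omega> - b t \<omega>)"

definition square_integrable_martingale ::
    "'w measure \<Rightarrow> (real \<Rightarrow> 'w measure) \<Rightarrow> real \<Rightarrow> (real \<Rightarrow> 'w \<Rightarrow> 'v::euclidean_space) \<Rightarrow> bool" where
  "square_integrable_martingale P F T X \<longleftrightarrow>
     (\<forall>t\<in>{0..T}. X t \<in> borel_measurable (F t) \<and> integrable P (\<lambda>\<omega>. (norm (X t \<omega>))\<^sup>2)) \<and>
     (\<forall>s t. 0 \<le> s \<and> s \<le> t \<and> t \<le> T \<longrightarrow>
        (\<forall>A\<in>sets (F s). (LINT \<omega>:A|P. X t \<omega>) = (LINT \<omega>:A|P. X s \<omega>)))"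

text \<open>An element of \<open>L2ad\<close> need not have left limits. The value \<open>g(t-)\<close> is the left limit wherever
  it exists and \<open>g(t)\<close> otherwise. For every path, \<open>g(t-)\<close> and \<open>g(t)\<close> then differ for at most
  countably many \<open>t\<close>, so integrals over \<open>t\<close> taken path by path do not distinguish them. For this
  reason mean squares below are iterated integrals and not integrals over the product space.\<close>

definition left_value :: "(real \<Rightarrow> 'w \<Rightarrow> 'v::euclidean_space) \<Rightarrow> real \<Rightarrow> 'w \<Rightarrow> 'v" where
  "left_value g t \<omega> =
     (if t > 0 \<and> (\<exists>l. ((\<lambda>s. g s \<omega>) \<longlongrightarrow> l) (at t within {0..<t}))
      then Lim (at t within {0..<t}) (\<lambda>s. g s \<omega>) else g t \<omega>)"


section \<open>Brownian motion and the Ito integral\<close>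

definition brownian_motion ::
    "'w measure \<Rightarrow> (real \<Rightarrow> 'w measure) \<Rightarrow> (real \<Rightarrow> 'w \<Rightarrow> real^'d) \<Rightarrow> bool" where
  "brownian_motion P F B \<longleftrightarrow>
     (\<forall>t\<ge>0. B t \<in> borel_measurable (F t)) \<and>
     (AE \<omega> in P. B 0 \<omega> = 0) \<and>
     (AE \<omega> in P. continuous_on {0..} (\<lambda>t. B t \<omega>)) \<and>
     (\<forall>s t. 0 \<le> s \<and> s < t \<longrightarrow>
        (\<forall>i. distributed P lborel (\<lambda>\<omega>. (B t \<omega> - B s \<omega>) $ i) (normal_density 0 (sqrt (t - s)))) \<and>
        prob_space.indep_vars P (\<lambda>_. borel) (\<lambda>i \<omega>. (B t \<omega> - B s \<omega>) $ i) UNIV \<and>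
        prob_space.indep_set P (sets (F s))
          {(\<lambda>\<omega>. B t \<omega> - B s \<omega>) -` X \<inter> space P | X. X \<in> sets borel})"

text \<open>A list of triples \<open>(r, s, \<phi>)\<close> represents the simple process that is the sum of the
  \<open>\<phi> 1\<^bsub>(r,s]\<^esub>\<close>; the intervals are allowed to overlap.\<close>

definition simple_process :: "'w measure \<Rightarrow> (real \<Rightarrow> 'w measure) \<Rightarrow> real \<Rightarrow>
    (real \<times> real \<times> ('w \<Rightarrow> 'v::euclidean_space)) list \<Rightarrow> bool" where
  "simple_process P F T L \<longleftrightarrow>
     (\<forall>(r, s, \<phi>)\<in>set L. 0 \<le> r \<and> r \<le> s \<and> s \<le> T \<and>
        \<phi> \<in> borel_measurable (F r) \<and> bounded (\<phi> ` space P))"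

definition simple_process_val ::
    "(real \<times> real \<times> ('w \<Rightarrow> 'v::euclidean_space)) list \<Rightarrow> real \<Rightarrow> 'w \<Rightarrow> 'v" where
  "simple_process_val L t \<omega> = (\<Sum>(r, s, \<phi>)\<leftarrow>L. indicator {r<..s} t *\<^sub>R \<phi> \<omega>)"

definition simple_ito :: "(real \<Rightarrow> 'w \<Rightarrow> real^'d) \<Rightarrow>
    (real \<times> real \<times> ('w \<Rightarrow> real^'d^'m)) list \<Rightarrow> real \<Rightarrow> 'w \<Rightarrow> real^'m" where
  "simple_ito B L t \<omega> = (\<Sum>(r, s, \<phi>)\<leftarrow>L. \<phi> \<omega> *v (B (min s t) \<omega> - B (min r t) \<omega>))"

text \<open>\<open>I\<close> is (a version of) the Ito integral process of \<open>g\<close> with respect to \<open>B\<close> on \<open>[0,T]\<close>: the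
  mean square limit of the integrals of simple processes that approximate \<open>g\<close> in mean square.\<close>

definition is_ito_integral :: "'w measure \<Rightarrow> (real \<Rightarrow> 'w measure) \<Rightarrow> real \<Rightarrow>
    (real \<Rightarrow> 'w \<Rightarrow> real^'d) \<Rightarrow> (real \<Rightarrow> 'w \<Rightarrow> real^'d^'m) \<Rightarrow> (real \<Rightarrow> 'w \<Rightarrow> real^'m) \<Rightarrow> bool" where
  "is_ito_integral P F T B g I \<longleftrightarrow>
     (\<forall>t\<in>{0..T}. I t \<in> borel_measurable (F t)) \<and>
     (\<exists>L. (\<forall>n. simple_process P F T (L n)) \<and>
        (\<lambda>n. \<integral>\<^sup>+\<omega>. (\<integral>\<^sup>+t\<in>{0..T}. ennreal ((norm (simple_process_val (L n) t \<omega> - g t \<omega>))\<^sup>2) \<partial>lborel) \<partial>P)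
          \<longlonglongrightarrow> 0 \<and>
        (\<forall>t\<in>{0..T}. (\<lambda>n. \<integral>\<^sup>+\<omega>. ennreal ((norm (simple_ito B (L n) t \<omega> - I t \<omega>))\<^sup>2) \<partial>P) \<longlonglongrightarrow> 0))"


section \<open>Poisson random measures and compensated jump integrals\<close>

definition levy_intensity :: "'e::euclidean_space measure \<Rightarrow> bool" where
  "levy_intensity v \<longleftrightarrow>
     sets v = sets (restrict_space borel (- {0})) \<and>
     (\<integral>\<^sup>+x. ennreal ((norm x)\<^sup>2 / (1 + (norm x)\<^sup>2)) \<partial>v) < \<infinity>"

definition time_jump_measure :: "'e::euclidean_space measure \<Rightarrow> (real \<times> 'e) measure" where
  "time_jump_measure v = restrict_space lborel {0..} \<Otimes>\<^sub>M v"

definition random_measure_events :: "'w measure \<Rightarrow> 'e::euclidean_space measure \<Rightarrow>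
    ('w \<Rightarrow> (real \<times> 'e) measure) \<Rightarrow> (real \<times> 'e) set \<Rightarrow> 'w set set" where
  "random_measure_events P v N R = sigma_sets (space P)
     {(\<lambda>\<omega>. emeasure (N \<omega>) A) -` X \<inter> space P | A X.
        A \<in> sets (time_jump_measure v) \<and> A \<subseteq> R \<and> X \<in> sets borel}"

definition poisson_random_measure :: "'w measure \<Rightarrow> (real \<Rightarrow> 'w measure) \<Rightarrow>
    'e::euclidean_space measure \<Rightarrow> ('w \<Rightarrow> (real \<times> 'e) measure) \<Rightarrow> bool" where
  "poisson_random_measure P F v N \<longleftrightarrow>
     (\<forall>\<omega>\<in>space P. sets (N \<omega>) = sets (time_jump_measure v)) \<and>
     (\<forall>A\<in>sets (time_jump_measure v). (\<lambda>\<omega>. emeasure (N \<omega>) A) \<in> borel_measurable P) \<and>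
     (\<forall>A\<in>sets (time_jump_measure v).
        if emeasure (time_jump_measure v) A < \<infinity>
        then (\<forall>k::nat. measure P {\<omega>\<in>space P. emeasure (N \<omega>) A = of_nat k} =
                exp (- measure (time_jump_measure v) A) * measure (time_jump_measure v) A ^ k / fact k)
        else (AE \<omega> in P. emeasure (N \<omega>) A = \<infinity>)) \<and>
     (\<forall>A. range A \<subseteq> sets (time_jump_measure v) \<and> disjoint_family A \<longrightarrow>
        prob_space.indep_vars P (\<lambda>_. borel) (\<lambda>i \<omega>. emeasure (N \<omega>) (A i)) (UNIV :: nat set)) \<and>
     (\<forall>t\<ge>0. \<forall>A\<in>sets (time_jump_measure v). A \<subseteq> {0..t} \<times> UNIV \<longrightarrow>
        (\<lambda>\<omega>. emeasure (N \<omega>) A) \<in> borel_measurable (F t)) \<and>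
     (\<forall>s\<ge>0. prob_space.indep_set P (sets (F s)) (random_measure_events P v N ({s<..} \<times> UNIV)))"

definition independent_noises :: "'w measure \<Rightarrow>
    (real \<Rightarrow> 'w \<Rightarrow> real^'d) \<Rightarrow> (real \<Rightarrow> 'w \<Rightarrow> real^'e) \<Rightarrow>
    'm::euclidean_space measure \<Rightarrow> ('w \<Rightarrow> (real \<times> 'm) measure) \<Rightarrow>
    'n::euclidean_space measure \<Rightarrow> ('w \<Rightarrow> (real \<times> 'n) measure) \<Rightarrow> bool" where
  "independent_noises P B1 B2 v1 N1 v2 N2 \<longleftrightarrow>
     prob_space.indep_sets P
       (\<lambda>i. [sigma_sets (space P) {B1 t -` X \<inter> space P | t X. 0 \<le> t \<and> X \<in> sets borel},
             sigma_sets (space P) {B2 t -` X \<inter> space P | t X. 0 \<le> t \<and> X \<in> sets borel},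
             random_measure_events P v1 N1 UNIV,
             random_measure_events P v2 N2 UNIV] ! i) {..<4::nat}"

text \<open>A list of quadruples \<open>(r, s, A, \<phi>)\<close> represents the simple integrand that is the sum of the
  \<open>\<phi> 1\<^bsub>(r,s]\<^esub> 1\<^bsub>A\<^esub>\<close>, where \<open>A\<close> lies in the ball of radius \<open>c\<close> and \<open>v(A) < \<infinity>\<close>.\<close>

definition simple_jump :: "'w measure \<Rightarrow> (real \<Rightarrow> 'w measure) \<Rightarrow> real \<Rightarrow> real \<Rightarrow> 'e::euclidean_space measure \<Rightarrow>
    (real \<times> real \<times> 'e set \<times> ('w \<Rightarrow> 'v::euclidean_space)) list \<Rightarrow> bool" where
  "simple_jump P F T c v L \<longleftrightarrow>
     (\<forall>(r, s, A, \<phi>)\<in>set L. 0 \<le> r \<and> r \<le> s \<and> s \<le> T \<and>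
        A \<in> sets v \<and> A \<subseteq> {x. norm x < c} \<and> emeasure v A < \<infinity> \<and>
        \<phi> \<in> borel_measurable (F r) \<and> bounded (\<phi> ` space P))"

definition simple_jump_val :: "(real \<times> real \<times> 'e set \<times> ('w \<Rightarrow> 'v::euclidean_space)) list \<Rightarrow>
    real \<Rightarrow> 'w \<Rightarrow> 'e \<Rightarrow> 'v" where
  "simple_jump_val L t \<omega> x = (\<Sum>(r, s, A, \<phi>)\<leftarrow>L. (indicator {r<..s} t * indicator A x) *\<^sub>R \<phi> \<omega>)"

definition simple_jump_integral :: "'e::euclidean_space measure \<Rightarrow> ('w \<Rightarrow> (real \<times> 'e) measure) \<Rightarrow>
    (real \<times> real \<times> 'e set \<times> ('w \<Rightarrow> 'v::euclidean_space)) list \<Rightarrow> real \<Rightarrow> 'w \<Rightarrow> 'v" where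
  "simple_jump_integral v N L t \<omega> = (\<Sum>(r, s, A, \<phi>)\<leftarrow>L.
     (measure (N \<omega>) ({min r t<..min s t} \<times> A) - (min s t - min r t) * measure v A) *\<^sub>R \<phi> \<omega>)"

definition is_jump_integral :: "'w measure \<Rightarrow> (real \<Rightarrow> 'w measure) \<Rightarrow> real \<Rightarrow> real \<Rightarrow>
    'e::euclidean_space measure \<Rightarrow> ('w \<Rightarrow> (real \<times> 'e) measure) \<Rightarrow>
    (real \<Rightarrow> 'w \<Rightarrow> 'e \<Rightarrow> 'v::euclidean_space) \<Rightarrow> (real \<Rightarrow> 'w \<Rightarrow> 'v) \<Rightarrow> bool" where
  "is_jump_integral P F T c v N g J \<longleftrightarrow>
     (\<forall>t\<in>{0..T}. J t \<in> borel_measurable (F t)) \<and>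
     (\<exists>L. (\<forall>n. simple_jump P F T c v (L n)) \<and>
        (\<lambda>n. \<integral>\<^sup>+\<omega>. (\<integral>\<^sup>+t\<in>{0..T}. (\<integral>\<^sup>+x\<in>{x. norm x < c}.
             ennreal ((norm (simple_jump_val (L n) t \<omega> x - g t \<omega> x))\<^sup>2) \<partial>v) \<partial>lborel) \<partial>P)
          \<longlonglongrightarrow> 0 \<and>
        (\<forall>t\<in>{0..T}. (\<lambda>n. \<integral>\<^sup>+\<omega>. ennreal ((norm (simple_jump_integral v N (L n) t \<omega> - J t \<omega>))\<^sup>2) \<partial>P)
          \<longlonglongrightarrow> 0))"


section \<open>Coefficients\<close>

definition adapted_coeff :: "'w measure \<Rightarrow> (real \<Rightarrow> 'w measure) \<Rightarrow> real \<Rightarrow>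
    (real \<Rightarrow> 'w \<Rightarrow> 'a::euclidean_space \<Rightarrow> 'b::euclidean_space \<Rightarrow> 'v::euclidean_space) \<Rightarrow> bool" where
  "adapted_coeff P F T h \<longleftrightarrow>
     (\<lambda>(t, \<omega>, x, s). h t \<omega> x s)
       \<in> borel_measurable (restrict_space borel {0..T} \<Otimes>\<^sub>M P \<Otimes>\<^sub>M borel \<Otimes>\<^sub>M borel) \<and>
     (\<forall>t\<in>{0..T}. (\<lambda>(\<omega>, x, s). h t \<omega> x s) \<in> borel_measurable (F t \<Otimes>\<^sub>M borel \<Otimes>\<^sub>M borel))"

definition adapted_jump_coeff :: "'w measure \<Rightarrow> (real \<Rightarrow> 'w measure) \<Rightarrow> real \<Rightarrow> 'e::euclidean_space measure \<Rightarrow>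
    (real \<Rightarrow> 'w \<Rightarrow> 'a::euclidean_space \<Rightarrow> 'b::euclidean_space \<Rightarrow> 'e \<Rightarrow> 'v::euclidean_space) \<Rightarrow> bool" where
  "adapted_jump_coeff P F T v g \<longleftrightarrow>
     (\<lambda>(t, \<omega>, x, s, z). g t \<omega> x s z)
       \<in> borel_measurable (restrict_space borel {0..T} \<Otimes>\<^sub>M P \<Otimes>\<^sub>M borel \<Otimes>\<^sub>M borel \<Otimes>\<^sub>M v) \<and>
     (\<forall>t\<in>{0..T}. (\<lambda>(\<omega>, x, s, z). g t \<omega> x s z)
       \<in> borel_measurable (F t \<Otimes>\<^sub>M borel \<Otimes>\<^sub>M borel \<Otimes>\<^sub>M v))"

definition time_continuous :: "'w measure \<Rightarrow> real \<Rightarrow>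
    (real \<Rightarrow> 'w \<Rightarrow> 'a::euclidean_space \<Rightarrow> 'b::euclidean_space \<Rightarrow> 'v::euclidean_space) \<Rightarrow> bool" where
  "time_continuous P T h \<longleftrightarrow> (AE \<omega> in P. \<forall>x s. continuous_on {0..T} (\<lambda>t. h t \<omega> x s))"

text \<open>The supply block depends on \<open>(p, S)\<close>, the demand block on \<open>(q, D)\<close>, where \<open>y = (p, q)\<close> and
  \<open>u = (S, D, a)\<close>. Since \<^const>\<open>norm\<close> on \<open>real^'d^'m\<close> is the Frobenius norm, the norm of the pair of
  blocks is also that of the block diagonal matrix, and \<open>block\<close> serves for diagonal blocks too.\<close>

definition block ::
    "(real \<Rightarrow> 'w \<Rightarrow> real^'m \<Rightarrow> real^'m \<Rightarrow> 'v1) \<Rightarrow> (real \<Rightarrow> 'w \<Rightarrow> real^'n \<Rightarrow> real^'n \<Rightarrow> 'v2) \<Rightarrow>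
    real \<Rightarrow> 'w \<Rightarrow> (real^'m) \<times> (real^'n) \<Rightarrow> (real^'m) \<times> (real^'n) \<times> (real^'n^'m) \<Rightarrow> 'v1 \<times> 'v2" where
  "block h1 h2 t \<omega> y u = (h1 t \<omega> (fst y) (fst u), h2 t \<omega> (snd y) (fst (snd u)))"

definition jump_sq :: "real \<Rightarrow> 'e::euclidean_space measure \<Rightarrow> 'f::euclidean_space measure \<Rightarrow>
    ('e \<Rightarrow> 'v1::euclidean_space) \<times> ('f \<Rightarrow> 'v2::euclidean_space) \<Rightarrow> ennreal" where
  "jump_sq c v1 v2 g =
     (\<integral>\<^sup>+x\<in>{x. norm x < c}. ennreal ((norm (fst g x))\<^sup>2) \<partial>v1) +
     (\<integral>\<^sup>+x\<in>{x. norm x < c}. ennreal ((norm (snd g x))\<^sup>2) \<partial>v2)"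

definition jump_diff :: "('e \<Rightarrow> 'v1::euclidean_space) \<times> ('f \<Rightarrow> 'v2::euclidean_space) \<Rightarrow>
    ('e \<Rightarrow> 'v1) \<times> ('f \<Rightarrow> 'v2) \<Rightarrow> ('e \<Rightarrow> 'v1) \<times> ('f \<Rightarrow> 'v2)" where
  "jump_diff g h = (\<lambda>x. fst g x - fst h x, \<lambda>x. snd g x - snd h x)"

definition linear_growth :: "'w measure \<Rightarrow> real \<Rightarrow>
    (real \<Rightarrow> 'w \<Rightarrow> 'y::euclidean_space \<Rightarrow> 'u::euclidean_space \<Rightarrow> 'v::euclidean_space) \<Rightarrow> real \<Rightarrow> bool" where
  "linear_growth P T h K \<longleftrightarrow> (AE \<omega> in P. \<forall>t\<in>{0..T}. \<forall>y u.
     (norm (h t \<omega> y u))\<^sup>2 \<le> K * (1 + (norm y)\<^sup>2 + (norm u)\<^sup>2))"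

definition lipschitz_coeff :: "'w measure \<Rightarrow> real \<Rightarrow>
    (real \<Rightarrow> 'w \<Rightarrow> 'y::euclidean_space \<Rightarrow> 'u::euclidean_space \<Rightarrow> 'v::euclidean_space) \<Rightarrow> real \<Rightarrow> bool" where
  "lipschitz_coeff P T h L \<longleftrightarrow> (AE \<omega> in P. \<forall>t\<in>{0..T}. \<forall>y1 y2 u1 u2.
     (norm (h t \<omega> y1 u1 - h t \<omega> y2 u2))\<^sup>2 \<le> L * ((norm (y1 - y2))\<^sup>2 + (norm (u1 - u2))\<^sup>2))"

definition jump_linear_growth :: "'w measure \<Rightarrow> real \<Rightarrow> real \<Rightarrow>
    'e::euclidean_space measure \<Rightarrow> 'f::euclidean_space measure \<Rightarrow>
    (real \<Rightarrow> 'w \<Rightarrow> 'y::euclidean_space \<Rightarrow> 'u::euclidean_space \<Rightarrow>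
      ('e \<Rightarrow> 'v1::euclidean_space) \<times> ('f \<Rightarrow> 'v2::euclidean_space)) \<Rightarrow> real \<Rightarrow> bool" where
  "jump_linear_growth P T c v1 v2 g K \<longleftrightarrow> (AE \<omega> in P. \<forall>t\<in>{0..T}. \<forall>y u.
     jump_sq c v1 v2 (g t \<omega> y u) \<le> ennreal (K * (1 + (norm y)\<^sup>2 + (norm u)\<^sup>2)))"

definition jump_lipschitz :: "'w measure \<Rightarrow> real \<Rightarrow> real \<Rightarrow>
    'e::euclidean_space measure \<Rightarrow> 'f::euclidean_space measure \<Rightarrow>
    (real \<Rightarrow> 'w \<Rightarrow> 'y::euclidean_space \<Rightarrow> 'u::euclidean_space \<Rightarrow>
      ('e \<Rightarrow> 'v1::euclidean_space) \<times> ('f \<Rightarrow> 'v2::euclidean_space)) \<Rightarrow> real \<Rightarrow> bool" where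
  "jump_lipschitz P T c v1 v2 g L \<longleftrightarrow> (AE \<omega> in P. \<forall>t\<in>{0..T}. \<forall>y1 y2 u1 u2.
     jump_sq c v1 v2 (jump_diff (g t \<omega> y1 u1) (g t \<omega> y2 u2))
       \<le> ennreal (L * ((norm (y1 - y2))\<^sup>2 + (norm (u1 - u2))\<^sup>2)))"

definition uniformly_continuous_param :: "'w measure \<Rightarrow> real \<Rightarrow>
    ('l::metric_space \<Rightarrow> real \<Rightarrow> 'w \<Rightarrow> 'y \<Rightarrow> 'u \<Rightarrow> 'v::euclidean_space) \<Rightarrow> bool" where
  "uniformly_continuous_param P T h \<longleftrightarrow> (\<forall>\<epsilon>>0. \<exists>\<delta>>0. \<forall>l1 l2. dist l1 l2 < \<delta> \<longrightarrow>
     (AE \<omega> in P. \<forall>t\<in>{0..T}. \<forall>y u. norm (h l1 t \<omega> y u - h l2 t \<omega> y u) < \<epsilon>))"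

definition jump_uniformly_continuous_param :: "'w measure \<Rightarrow> real \<Rightarrow> real \<Rightarrow>
    'e::euclidean_space measure \<Rightarrow> 'f::euclidean_space measure \<Rightarrow>
    ('l::metric_space \<Rightarrow> real \<Rightarrow> 'w \<Rightarrow> 'y \<Rightarrow> 'u \<Rightarrow>
      ('e \<Rightarrow> 'v1::euclidean_space) \<times> ('f \<Rightarrow> 'v2::euclidean_space)) \<Rightarrow> bool" where
  "jump_uniformly_continuous_param P T c v1 v2 g \<longleftrightarrow> (\<forall>\<epsilon>>0. \<exists>\<delta>>0. \<forall>l1 l2. dist l1 l2 < \<delta> \<longrightarrow>
     (AE \<omega> in P. \<forall>t\<in>{0..T}. \<forall>y u.
        jump_sq c v1 v2 (jump_diff (g l1 t \<omega> y u) (g l2 t \<omega> y u)) < ennreal (\<epsilon>\<^sup>2)))"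

definition induced_op :: "(real \<Rightarrow> 'w \<Rightarrow> 'y \<Rightarrow> 'u \<Rightarrow> 'v) \<Rightarrow> (real \<Rightarrow> 'w \<Rightarrow> 'y) \<Rightarrow>
    (real \<Rightarrow> 'w \<Rightarrow> 'u) \<Rightarrow> real \<Rightarrow> 'w \<Rightarrow> 'v" where
  "induced_op Fm y u = (\<lambda>s \<omega>. Fm s \<omega> (y s \<omega>) (u s \<omega>))"


section \<open>The stochastic price equilibrium system\<close>

definition U_set :: "'w measure \<Rightarrow> (real \<Rightarrow> 'w measure) \<Rightarrow> real \<Rightarrow> 'v::euclidean_space set \<Rightarrow>
    (real \<Rightarrow> 'w \<Rightarrow> 'v) set" where
  "U_set P F T K = {u \<in> L2ad P F T. AE t in lborel. t \<in> {0..T} \<longrightarrow> (AE \<omega> in P. u t \<omega> \<in> K)}"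

text \<open>The equation of one market in integral form; the fractional integral is
  \<open>\<alpha> \<integral>\<^sub>0\<^sup>t (t - r)\<^bsup>\<alpha> - 1\<^esup> \<sigma>(r) dr\<close>.\<close>

definition market_equation :: "'w measure \<Rightarrow> (real \<Rightarrow> 'w measure) \<Rightarrow> real \<Rightarrow> real \<Rightarrow> real \<Rightarrow>
    (real \<Rightarrow> 'w \<Rightarrow> real^'d) \<Rightarrow> (real^'m) measure \<Rightarrow> ('w \<Rightarrow> (real \<times> (real^'m)) measure) \<Rightarrow>
    (real \<Rightarrow> 'w \<Rightarrow> real^'m \<Rightarrow> real^'m \<Rightarrow> real^'m) \<Rightarrow>
    (real \<Rightarrow> 'w \<Rightarrow> real^'m \<Rightarrow> real^'m \<Rightarrow> real^'m) \<Rightarrow>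
    (real \<Rightarrow> 'w \<Rightarrow> real^'m \<Rightarrow> real^'m \<Rightarrow> real^'d^'m) \<Rightarrow>
    (real \<Rightarrow> 'w \<Rightarrow> real^'m \<Rightarrow> real^'m \<Rightarrow> real^'m \<Rightarrow> real^'m) \<Rightarrow>
    ('w \<Rightarrow> real^'m) \<Rightarrow> (real \<Rightarrow> 'w \<Rightarrow> real^'m) \<Rightarrow> (real \<Rightarrow> 'w \<Rightarrow> real^'m) \<Rightarrow> bool" where
  "market_equation P F T \<alpha> c B v N b \<sigma> f G x0 x s \<longleftrightarrow>
     (\<exists>I J.
        is_ito_integral P F T B
          (\<lambda>r \<omega>. f r \<omega> (left_value x r \<omega>) (left_value s r \<omega>)) I \<and>
        is_jump_integral P F T c v N
          (\<lambda>r \<omega> z. G r \<omega> (left_value x r \<omega>) (left_value s r \<omega>) z) J \<and>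
        square_integrable_martingale P F T J \<and>
        (\<forall>t\<in>{0..T}. AE \<omega> in P.
           x t \<omega> = x0 \<omega>
             + (LBINT r:{0..t}. b r \<omega> (left_value x r \<omega>) (left_value s r \<omega>))
             + \<alpha> *\<^sub>R (LBINT r:{0..t}.
                 (t - r) powr (\<alpha> - 1) *\<^sub>R \<sigma> r \<omega> (left_value x r \<omega>) (left_value s r \<omega>))
             + I t \<omega> + J t \<omega>))"

definition SPEP_solution where
  "SPEP_solution P F T \<alpha> c B1 B2 v1 v2 N1 N2 b1 b2 \<sigma>1 \<sigma>2 f1 f2 G1 G2
     (Fm :: real \<Rightarrow> 'w \<Rightarrow> (real^'m) \<times> (real^'n) \<Rightarrow> (real^'m) \<times> (real^'n) \<times> (real^'n^'m)
            \<Rightarrow> (real^'m) \<times> (real^'n) \<times> (real^'n^'m)) K y0 y u \<longleftrightarrow>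
     y \<in> L2ad P F T \<and> u \<in> U_set P F T K \<and>
     (AE \<omega> in P. y 0 \<omega> = y0 \<omega>) \<and>
     market_equation P F T \<alpha> c B1 v1 N1 b1 \<sigma>1 f1 G1
       (\<lambda>\<omega>. fst (y0 \<omega>)) (\<lambda>t \<omega>. fst (y t \<omega>)) (\<lambda>t \<omega>. fst (u t \<omega>)) \<and>
     market_equation P F T \<alpha> c B2 v2 N2 b2 \<sigma>2 f2 G2
       (\<lambda>\<omega>. snd (y0 \<omega>)) (\<lambda>t \<omega>. snd (y t \<omega>)) (\<lambda>t \<omega>. fst (snd (u t \<omega>))) \<and>
     (\<forall>w\<in>K. AE t in lborel. t \<in> {0..T} \<longrightarrow>
        (AE \<omega> in P. Fm t \<omega> (y t \<omega>) (u t \<omega>) \<bullet> (w - u t \<omega>) \<ge> 0))"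

definition SPEP_unique_solution where
  "SPEP_unique_solution P F T \<alpha> c B1 B2 v1 v2 N1 N2 b1 b2 \<sigma>1 \<sigma>2 f1 f2 G1 G2
     (Fm :: real \<Rightarrow> 'w \<Rightarrow> (real^'m) \<times> (real^'n) \<Rightarrow> (real^'m) \<times> (real^'n) \<times> (real^'n^'m)
            \<Rightarrow> (real^'m) \<times> (real^'n) \<times> (real^'n^'m)) K y0 y u \<longleftrightarrow>
     SPEP_solution P F T \<alpha> c B1 B2 v1 v2 N1 N2 b1 b2 \<sigma>1 \<sigma>2 f1 f2 G1 G2 Fm K y0 y u \<and>
     (\<forall>y' u'. SPEP_solution P F T \<alpha> c B1 B2 v1 v2 N1 N2 b1 b2 \<sigma>1 \<sigma>2 f1 f2 G1 G2 Fm K y0 y' u' \<longrightarrow>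
        (AE t in lborel. t \<in> {0..T} \<longrightarrow> (AE \<omega> in P. y' t \<omega> = y t \<omega> \<and> u' t \<omega> = u t \<omega>)))"


section \<open>Mosco convergence\<close>

definition weakly_converges :: "(nat \<Rightarrow> 'a::{real_inner, complete_space}) \<Rightarrow> 'a \<Rightarrow> bool" where
  "weakly_converges X x \<longleftrightarrow> (\<forall>z. (\<lambda>i. X i \<bullet> z) \<longlonglongrightarrow> x \<bullet> z)"

definition mosco_converges :: "(nat \<Rightarrow> 'a::{real_inner, complete_space} set) \<Rightarrow> 'a set \<Rightarrow> bool" where
  "mosco_converges C C0 \<longleftrightarrow>
     (\<forall>x\<in>C0. \<exists>X. (\<forall>j. X j \<in> C j) \<and> X \<longlonglongrightarrow> x) \<and>
     (\<forall>r X x. strict_mono r \<and> (\<forall>i. X i \<in> C (r i)) \<and> weakly_converges X x \<longrightarrow> x \<in> C0)"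

end

theory Submission
  imports Defs
begin

text \<open>The time-localised variational inequality controls the shipments by the prices. Let
  \<open>g = F\<^sub>\<lambda>(y, u)\<close> be the limiting operator value and test the perturbed inequality with
  \<open>v\<^sub>j = proj\<^bsub>K(\<mu>\<^sub>j)\<^esub> (u - g)\<close>, whose limit is \<open>proj\<^bsub>K(\<mu>)\<^esub> (u - g) = u\<close>: in finite dimension Mosco
  convergence makes the projections converge pointwise, and \<open>\<parallel>v\<^sub>j\<parallel> \<le> \<parallel>u - g\<parallel>\<close> dominates. The
  characterisation of \<open>v\<^sub>j\<close> gives \<open>- \<langle>g, u\<^sub>k\<^sub>j - v\<^sub>j\<rangle> \<le> \<langle>v\<^sub>j - u, u\<^sub>k\<^sub>j - v\<^sub>j\<rangle>\<close>, so strong monotonicity yields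
  \<open>\<parallel>u\<^sub>k\<^sub>j - u\<parallel>\<^sup>2 \<le> C (\<parallel>y\<^sub>k\<^sub>j - y\<parallel>\<^sup>2 + \<epsilon>\<^sub>k\<^sup>2 + \<parallel>v\<^sub>j - u\<parallel>\<^sup>2)\<close> on every interval \<open>[0, t]\<close> and no weak compactness is
  needed. Since \<open>2 (\<alpha> - 1) > -1\<close>, the fractional kernel is square integrable, so Cauchy-Schwarz and the
  Ito isometries bound \<open>E \<parallel>y\<^sub>k\<^sub>j(t) - y(t)\<parallel>\<^sup>2\<close> by the time integral of both differences up to \<open>t\<close> without a
  singular kernel, and Gronwall's inequality concludes.\<close>

text \<open>Four features of the setting shape the estimates. The Lipschitz constants of the
  coefficients may depend on the parameter without a uniform bound, so each comparison passes
  through the limiting coefficient at the perturbed state: only its constants enter, and the change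
  of parameter costs at most \<open>\<epsilon>\<close>. The operators are Lipschitz and monotone
  only in norms over all of [0, T]; as they act pointwise, truncating their arguments at a time
  localises both bounds, as Gronwall's inequality demands. Elements of \<open>L2ad\<close> need not
  have left limits, and \<open>left_value\<close> comes with no measurability; it agrees with the
  path off a countable set of times, so integrands are exchanged path by path for jointly measurable
  ones. Stochastic integrals are given only as mean square limits along some approximating sequence;
  an abstract orthogonal noise yields the isometry for simple integrands of both kinds at once, and
  the passage to the limit is made for differences of two integrals, with a factor 9 that replaces
  any discussion of uniqueness.\<close>

section \<open>Left limits, square norms and projections\<close>

text \<open>Just before such a time t the path stays within e/4 of its left limit on some interval
  \<open>(t - d t, t)\<close>. A second such time inside that interval would have both its value and
  its left limit within e/4 of \<open>l t\<close>, hence a jump smaller than e. The intervals are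
  therefore pairwise disjoint, open and nonempty, and so countable in number.\<close>

lemma countable_left_jumps:
  fixes f :: "real \<Rightarrow> 'a::metric_space"
  assumes "0 < e"
  shows "countable {t. 0 < t \<and> (\<exists>l. (f \<longlongrightarrow> l) (at t within {0..<t}) \<and> e < dist l (f t))}"
    (is "countable ?A")
proof -
  have "\<exists>l d. 0 < d \<and> (f \<longlongrightarrow> l) (at t within {0..<t}) \<and> e < dist l (f t) \<and>
          (\<forall>s\<in>{0..<t}. t - d < s \<longrightarrow> dist (f s) l < e / 4)" if t: "t \<in> ?A" for t
  proof -
    obtain l where l: "(f \<longlongrightarrow> l) (at t within {0..<t})" "e < dist l (f t)" using t by auto
    have "\<forall>\<^sub>F s in at t within {0..<t}. dist (f s) l < e / 4"
      using tendstoD[OF l(1), of "e / 4"] assms by simp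
    then obtain d where "0 < d" "\<forall>s\<in>{0..<t}. s \<noteq> t \<and> dist s t < d \<longrightarrow> dist (f s) l < e / 4"
      unfolding eventually_at by blast
    then show ?thesis
      using l by (intro exI[of _ l] exI[of _ d]) (auto simp: dist_real_def)
  qed
  then have "\<forall>t\<in>?A. \<exists>l d. 0 < d \<and> (f \<longlongrightarrow> l) (at t within {0..<t}) \<and> e < dist l (f t) \<and>
          (\<forall>s\<in>{0..<t}. t - d < s \<longrightarrow> dist (f s) l < e / 4)" by blast
  then obtain l d where "\<forall>t\<in>?A. 0 < d t \<and> (f \<longlongrightarrow> l t) (at t within {0..<t}) \<and> e < dist (l t) (f t) \<and>
          (\<forall>s\<in>{0..<t}. t - d t < s \<longrightarrow> dist (f s) (l t) < e / 4)"
    unfolding bchoice_iff by blast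
  then have ld: "\<And>t. t \<in> ?A \<Longrightarrow> 0 < d t" "\<And>t. t \<in> ?A \<Longrightarrow> (f \<longlongrightarrow> l t) (at t within {0..<t})"
      "\<And>t. t \<in> ?A \<Longrightarrow> e < dist (l t) (f t)"
      "\<And>t s. t \<in> ?A \<Longrightarrow> s \<in> {0..<t} \<Longrightarrow> t - d t < s \<Longrightarrow> dist (f s) (l t) < e / 4"
    by blast+
  have gap: "s \<le> t - d t" if s: "s \<in> ?A" and t: "t \<in> ?A" and "s < t" for s t
  proof (rule ccontr)
    assume "\<not> s \<le> t - d t"
    then have near: "t - d t < s" by simp
    have pos: "0 < s" using s by simp
    have nt: "at s within {0..<s} \<noteq> bot"
      using pos trivial_limit_within[of s "{0..<s}"] islimpt_greaterThanLessThan2[OF pos]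
        islimpt_subset[of s "{0<..<s}" "{0..<s}"] by auto
    have "\<forall>\<^sub>F r in at s within {0..<s}. dist (f r) (l t) \<le> e / 4"
      unfolding eventually_at
      using near ld(4)[OF t] \<open>s < t\<close>
      by (intro exI[of _ "s - (t - d t)"]) (auto simp: dist_real_def intro!: less_imp_le)
    then have "dist (l s) (l t) \<le> e / 4"
      by (rule tendsto_upperbound[OF tendsto_dist[OF ld(2)[OF s] tendsto_const] _ nt])
    moreover have "dist (f s) (l t) < e / 4"
      using ld(4)[OF t, of s] near pos \<open>s < t\<close> by simp
    ultimately have "dist (l s) (f s) < e"
      using dist_triangle2[of "l s" "f s" "l t"] assms by linarith
    then show False using ld(3)[OF s] by simp
  qed
  define I where "I t = {t - d t<..<t}" for t
  have disj: "I s \<inter> I t = {}" if "s \<in> ?A" "t \<in> ?A" "s \<noteq> t" for s t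
    using gap[OF that(1,2)] gap[OF that(2,1)] that(3) by (cases "s < t") (auto simp: I_def)
  have ne: "I t \<noteq> {}" if "t \<in> ?A" for t
    using ld(1)[OF that] by (simp add: I_def)
  have "inj_on I ?A"
  proof (rule inj_onI, rule ccontr)
    fix s t assume st: "s \<in> ?A" "t \<in> ?A" "I s = I t" "s \<noteq> t"
    show False using disj[OF st(1,2,4)] ne[OF st(2)] st(3) by simp
  qed
  moreover have "countable (I ` ?A)"
  proof (rule countable_disjoint_open_subsets)
    show "pairwise disjnt (I ` ?A)"
    proof (rule pairwise_imageI)
      fix s t assume "s \<in> ?A" "t \<in> ?A" "s \<noteq> t"
      then show "disjnt (I s) (I t)" unfolding disjnt_def by (rule disj)
    qed
    show "open S" if "S \<in> I ` ?A" for S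
      using that by (elim imageE) (simp add: I_def)
  qed
  ultimately show ?thesis
    using countable_image_inj_on by blast
qed

text \<open>A nonzero left jump exceeds 1/(n+1) for some n. The statement concerns each single path,
  however irregular, which is what allows \<open>left_value g\<close> to be replaced by
  \<open>g\<close> under every time integral.\<close>

lemma countable_left_value_neq: "countable {t. left_value g t \<omega> \<noteq> g t \<omega>}"
proof -
  define A where "A n = {t. 0 < t \<and> (\<exists>l. ((\<lambda>s. g s \<omega>) \<longlongrightarrow> l) (at t within {0..<t}) \<and>
      inverse (real (Suc n)) < dist l (g t \<omega>))}" for n
  have "{t. left_value g t \<omega> \<noteq> g t \<omega>} \<subseteq> (\<Union>n. A n)"
  proof
    fix t assume "t \<in> {t. left_value g t \<omega> \<noteq> g t \<omega>}"
    then have neq: "left_value g t \<omega> \<noteq> g t \<omega>" by simp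
    then obtain l where t: "0 < t" and l: "((\<lambda>s. g s \<omega>) \<longlongrightarrow> l) (at t within {0..<t})"
      and lv: "left_value g t \<omega> = Lim (at t within {0..<t}) (\<lambda>s. g s \<omega>)"
      unfolding left_value_def by meson
    have nt: "at t within {0..<t} \<noteq> bot"
      using t trivial_limit_within[of t "{0..<t}"] islimpt_greaterThanLessThan2[OF t]
        islimpt_subset[of t "{0<..<t}" "{0..<t}"] by auto
    have "left_value g t \<omega> = l"
      unfolding lv by (rule tendsto_Lim[OF nt l])
    then have "0 < dist l (g t \<omega>)" using neq by simp
    then obtain n where "inverse (real (Suc n)) < dist l (g t \<omega>)"
      using reals_Archimedean by blast
    then show "t \<in> (\<Union>n. A n)" using t l by (auto simp: A_def)
  qed
  moreover have "countable (\<Union>n. A n)"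
    unfolding A_def by (intro countable_UN countable_left_jumps) auto
  ultimately show ?thesis by (rule countable_subset)
qed

lemma AE_left_value: "AE t in lborel. left_value g t \<omega> = g t \<omega>"
proof (rule AE_I')
  show "{t. left_value g t \<omega> \<noteq> g t \<omega>} \<in> null_sets lborel"
    by (rule countable_imp_null_set_lborel[OF countable_left_value_neq])
qed auto

lemma norm_add_sq: "(norm (a + b))\<^sup>2 \<le> 2 * ((norm a)\<^sup>2 + (norm b)\<^sup>2)"
  for a b :: "'a::real_normed_vector"
proof -
  have "(norm (a + b))\<^sup>2 \<le> (norm a + norm b)\<^sup>2"
    by (simp add: norm_triangle_ineq power_mono)
  also have "\<dots> \<le> 2 * ((norm a)\<^sup>2 + (norm b)\<^sup>2)"
    using sum_squares_bound[of "norm a" "norm b"] by (simp add: power2_sum)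
  finally show ?thesis .
qed

lemma norm_diff_sq: "(norm (a - b))\<^sup>2 \<le> 2 * ((norm a)\<^sup>2 + (norm b)\<^sup>2)"
  for a b :: "'a::real_normed_vector"
  using norm_add_sq[of a "- b"] by simp

abbreviation esq :: "'a::real_normed_vector \<Rightarrow> ennreal" where
  "esq x \<equiv> ennreal ((norm x)\<^sup>2)"

lemma ennreal_norm_add3_sq:
  fixes a b c :: "'a::real_normed_vector"
  shows "esq (a + b + c) \<le>
    3 * (esq a + esq b + esq c)"
proof -
  have "(norm (a + b + c))\<^sup>2 \<le> (norm a + norm b + norm c)\<^sup>2"
    by (intro power_mono order_trans[OF norm_triangle_ineq] add_mono order_refl) auto
  also have "\<dots> \<le> 3 * ((norm a)\<^sup>2 + (norm b)\<^sup>2 + (norm c)\<^sup>2)"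
    using sum_squares_bound[of "norm a" "norm b"] sum_squares_bound[of "norm a" "norm c"]
      sum_squares_bound[of "norm b" "norm c"]
    by (simp add: power2_eq_square algebra_simps)
  finally have "esq (a + b + c) \<le> ennreal (3 * ((norm a)\<^sup>2 + (norm b)\<^sup>2 + (norm c)\<^sup>2))"
    by (rule ennreal_leI)
  also have "\<dots> = 3 * (esq a + esq b + esq c)"
    by (subst ennreal_mult) (auto simp del: distrib_left_numeral)
  finally show ?thesis .
qed

text \<open>Cauchy-Schwarz with the weight split off: the constant weight serves the drift, the
  fractional kernel serves the \<open>\<sigma>\<close> term. The finiteness assumptions make both
  integrals genuine; the default value 0 of a divergent Bochner integral would spoil the
  subtraction.\<close>

lemma norm_weighted_integral_diff:
  fixes h h' :: "real \<Rightarrow> 'v::euclidean_space" and w :: "real \<Rightarrow> real"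
  assumes [measurable]: "h \<in> borel_measurable M" "h' \<in> borel_measurable M" "w \<in> borel_measurable M"
    and h: "(\<integral>\<^sup>+r. esq (h r) \<partial>M) < \<infinity>" "(\<integral>\<^sup>+r. esq (h' r) \<partial>M) < \<infinity>"
    and w: "(\<integral>\<^sup>+r. ennreal ((w r)\<^sup>2) \<partial>M) < \<infinity>"
  shows "esq ((\<integral>r. w r *\<^sub>R h r \<partial>M) - (\<integral>r. w r *\<^sub>R h' r \<partial>M)) \<le>
    (\<integral>\<^sup>+r. ennreal ((w r)\<^sup>2) \<partial>M) * (\<integral>\<^sup>+r. esq (h r - h' r) \<partial>M)"
proof -
  have CS: "(\<integral>\<^sup>+r. ennreal (norm (w r *\<^sub>R k r)) \<partial>M)\<^sup>2 \<le>
      (\<integral>\<^sup>+r. ennreal ((w r)\<^sup>2) \<partial>M) * (\<integral>\<^sup>+r. esq (k r) \<partial>M)"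
    if [measurable]: "k \<in> borel_measurable M" for k :: "real \<Rightarrow> 'v"
    using Cauchy_Schwarz_nn_integral[of "\<lambda>r. ennreal \<bar>w r\<bar>" M "\<lambda>r. ennreal (norm (k r))"]
    by (simp add: ennreal_mult ennreal_power)
  have int: "integrable M (\<lambda>r. w r *\<^sub>R k r)"
    if [measurable]: "k \<in> borel_measurable M" and k: "(\<integral>\<^sup>+r. esq (k r) \<partial>M) < \<infinity>" for k :: "real \<Rightarrow> 'v"
  proof (rule integrableI_bounded)
    have "(\<integral>\<^sup>+r. ennreal (norm (w r *\<^sub>R k r)) \<partial>M)\<^sup>2 < \<infinity>"
      by (rule le_less_trans[OF CS]) (use w k in \<open>auto simp: ennreal_mult_less_top\<close>)
    then show "(\<integral>\<^sup>+r. ennreal (norm (w r *\<^sub>R k r)) \<partial>M) < \<infinity>"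
      by (metis infinity_ennreal_def less_top power_eq_top_ennreal zero_neq_numeral)
  qed simp
  have eq: "(\<integral>r. w r *\<^sub>R h r \<partial>M) - (\<integral>r. w r *\<^sub>R h' r \<partial>M) = (\<integral>r. w r *\<^sub>R (h r - h' r) \<partial>M)"
    using int[of h] int[of h'] h by (simp add: scaleR_diff_right)
  have i: "integrable M (\<lambda>r. w r *\<^sub>R (h r - h' r))"
    using int[of h] int[of h'] h by (simp add: scaleR_diff_right)
  have "esq (\<integral>r. w r *\<^sub>R (h r - h' r) \<partial>M) =
      (ennreal (norm (\<integral>r. w r *\<^sub>R (h r - h' r) \<partial>M)))\<^sup>2"
    by (simp add: ennreal_power)
  also have "\<dots> \<le> (\<integral>\<^sup>+r. ennreal (norm (w r *\<^sub>R (h r - h' r))) \<partial>M)\<^sup>2"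
    by (intro power_mono integral_norm_bound_ennreal i) simp
  also have "\<dots> \<le> (\<integral>\<^sup>+r. ennreal ((w r)\<^sup>2) \<partial>M) * (\<integral>\<^sup>+r. esq (h r - h' r) \<partial>M)"
    by (rule CS) simp
  finally show ?thesis unfolding eq .
qed

text \<open>Since 0 lies in every \<open>C j\<close>, the projections stay within distance
  \<open>norm x\<close> of x, so a subsequence bounded away from the claimed limit would have a
  cluster point l. One half of Mosco convergence puts l into \<open>C0\<close> (strong convergence
  is weak convergence); the other half approximates the true projection by points of
  \<open>C j\<close>, which shows that l is at least as close to x. Uniqueness of the closest point
  is the contradiction.\<close>

lemma closest_point_tendsto_mosco:
  fixes C :: "nat \<Rightarrow> 'a::euclidean_space set"
  assumes C: "\<And>j. closed (C j)" "\<And>j. convex (C j)" "\<And>j. 0 \<in> C j"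
    and C0: "closed C0" "convex C0" "0 \<in> C0"
    and mosco: "mosco_converges C C0"
  shows "(\<lambda>j. closest_point (C j) x) \<longlonglongrightarrow> closest_point C0 x"
proof (rule ccontr)
  define p where "p j = closest_point (C j) x" for j
  define q where "q = closest_point C0 x"
  have pC: "p j \<in> C j" for j
    unfolding p_def using C by (intro closest_point_in_set) auto
  have qC: "q \<in> C0"
    unfolding q_def using C0 by (intro closest_point_in_set) auto
  assume "\<not> (\<lambda>j. closest_point (C j) x) \<longlonglongrightarrow> closest_point C0 x"
  then have "\<not> p \<longlonglongrightarrow> q" by (simp add: p_def[abs_def] q_def)
  then obtain d where d: "0 < d" "\<not> (\<forall>\<^sub>F j in sequentially. dist (p j) q < d)"
    unfolding tendsto_iff by blast
  then have "\<exists>\<^sub>F j in sequentially. d \<le> dist (p j) q"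
    by (simp add: frequently_def not_le)
  then have "infinite {j. d \<le> dist (p j) q}"
    using frequently_cofinite[of "\<lambda>j. d \<le> dist (p j) q"] by (simp add: cofinite_eq_sequentially)
  then obtain r where r: "strict_mono (r :: nat \<Rightarrow> nat)" "\<And>i. r i \<in> {j. d \<le> dist (p j) q}"
    using infinite_enumerate by blast
  have bdd: "dist x (p j) \<le> norm x" for j
    using closest_point_le[OF C(1) C(3), of x j] by (simp add: p_def)
  then have "\<forall>i. (p \<circ> r) i \<in> cball x (norm x)" by (simp add: comp_def)
  then obtain s l where s: "strict_mono (s :: nat \<Rightarrow> nat)" and l: "((p \<circ> r) \<circ> s) \<longlonglongrightarrow> l"
    using compact_cball[of x "norm x"] unfolding compact_def by metis
  have rs: "strict_mono (r \<circ> s)" using r(1) s by (simp add: strict_mono_o)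
  have "weakly_converges (\<lambda>i. p ((r \<circ> s) i)) l"
    unfolding weakly_converges_def using l by (auto intro!: tendsto_inner simp: comp_def)
  then have lC: "l \<in> C0"
    using mosco[unfolded mosco_converges_def, THEN conjunct2, rule_format, of "r \<circ> s" "\<lambda>i. p ((r \<circ> s) i)" l]
      rs pC by blast
  obtain X where X: "\<And>j. X j \<in> C j" "X \<longlonglongrightarrow> q"
    using mosco qC unfolding mosco_converges_def by blast
  have "dist x (p ((r \<circ> s) i)) \<le> dist x (X ((r \<circ> s) i))" for i
    unfolding p_def by (rule closest_point_le[OF C(1) X(1)])
  moreover have "(\<lambda>i. dist x (p ((r \<circ> s) i))) \<longlonglongrightarrow> dist x l"
    using l by (intro tendsto_intros) (simp add: comp_def)
  moreover have "(\<lambda>i. dist x (X ((r \<circ> s) i))) \<longlonglongrightarrow> dist x q"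
    using LIMSEQ_subseq_LIMSEQ[OF X(2) rs] by (intro tendsto_intros) (simp add: comp_def)
  ultimately have le: "dist x l \<le> dist x q"
    by (intro LIMSEQ_le) auto
  have "l = q"
    unfolding q_def
  proof (rule closest_point_unique[OF C0(2,1) lC], rule ballI)
    fix z assume "z \<in> C0"
    then show "dist x l \<le> dist x z"
      using closest_point_le[OF C0(1), of z x] le by (simp add: q_def)
  qed
  have "(\<lambda>i. dist (p ((r \<circ> s) i)) q) \<longlonglongrightarrow> dist l q"
    using l by (intro tendsto_intros) (simp add: comp_def)
  then have "d \<le> dist l q"
    using r(2) by (intro LIMSEQ_le_const) auto
  then show False using d(1) \<open>l = q\<close> by simp
qed

text \<open>The projection is nonexpansive and fixes 0. The bound does not involve the set, hence
  gives one majorant for all the sets of a sequence.\<close>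

lemma norm_closest_point_le:
  assumes "closed S" "convex S" "0 \<in> S"
  shows "norm (closest_point S x) \<le> norm x"
  using closest_point_lipschitz[of S x 0] closest_point_self[of 0 S] assms by auto

section \<open>Isometry for simple integrands\<close>

lemma integrable_mult_of_squares:
  fixes X Y :: "'w \<Rightarrow> real"
  assumes [measurable]: "X \<in> borel_measurable M" "Y \<in> borel_measurable M"
    and "integrable M (\<lambda>\<omega>. (X \<omega>)\<^sup>2)" "integrable M (\<lambda>\<omega>. (Y \<omega>)\<^sup>2)"
  shows "integrable M (\<lambda>\<omega>. X \<omega> * Y \<omega>)"
proof (rule Bochner_Integration.integrable_bound[of M "\<lambda>\<omega>. (X \<omega>)\<^sup>2 + (Y \<omega>)\<^sup>2"])
  show "AE \<omega> in M. norm (X \<omega> * Y \<omega>) \<le> norm ((X \<omega>)\<^sup>2 + (Y \<omega>)\<^sup>2)"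
  proof (rule AE_I2)
    fix \<omega>
    have "2 * \<bar>X \<omega>\<bar> * \<bar>Y \<omega>\<bar> \<le> \<bar>X \<omega>\<bar>\<^sup>2 + \<bar>Y \<omega>\<bar>\<^sup>2" by (rule sum_squares_bound)
    moreover have "0 \<le> \<bar>X \<omega>\<bar> * \<bar>Y \<omega>\<bar>" by simp
    ultimately have "\<bar>X \<omega>\<bar> * \<bar>Y \<omega>\<bar> \<le> \<bar>X \<omega>\<bar>\<^sup>2 + \<bar>Y \<omega>\<bar>\<^sup>2" by linarith
    then show "norm (X \<omega> * Y \<omega>) \<le> norm ((X \<omega>)\<^sup>2 + (Y \<omega>)\<^sup>2)"
      by (simp add: abs_mult)
  qed
qed (use assms in auto)

lemma integrable_bounded_mult:
  fixes X \<xi> :: "'w \<Rightarrow> real"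
  assumes X: "integrable M X" and [measurable]: "\<xi> \<in> borel_measurable M"
    and b: "bounded (\<xi> ` space M)"
  shows "integrable M (\<lambda>\<omega>. \<xi> \<omega> * X \<omega>)"
proof -
  obtain K where K: "\<And>\<omega>. \<omega> \<in> space M \<Longrightarrow> \<bar>\<xi> \<omega>\<bar> \<le> K"
    using b unfolding bounded_iff by auto
  have [measurable]: "X \<in> borel_measurable M" using X by simp
  show ?thesis
  proof (rule Bochner_Integration.integrable_bound[of M "\<lambda>\<omega>. K * X \<omega>"])
    show "AE \<omega> in M. norm (\<xi> \<omega> * X \<omega>) \<le> norm (K * X \<omega>)"
      using K by (intro AE_I2) (force simp: abs_mult intro!: mult_right_mono)
  qed (use X in auto)
qed

lemma measure_lborel_Ioc_max: "measure lborel {a<..b} = max 0 (b - a)" for a b :: real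
  by (cases "a \<le> b") auto

text \<open>Independence of a noise from the past is given for sigma-algebras of events; this turns
  it into the factorisation of expectations behind the mean and covariance properties of both
  noises.\<close>

lemma (in prob_space) integral_mult_indep:
  fixes \<xi> Y :: "'a \<Rightarrow> real"
  assumes A: "subalgebra M A" and B: "subalgebra M B" and ind: "indep_set (sets A) (sets B)"
    and \<xi>: "\<xi> \<in> borel_measurable A" "integrable M \<xi>"
    and Y: "Y \<in> borel_measurable B" "integrable M Y"
  shows "(\<integral>\<omega>. \<xi> \<omega> * Y \<omega> \<partial>M) = (\<integral>\<omega>. \<xi> \<omega> \<partial>M) * (\<integral>\<omega>. Y \<omega> \<partial>M)"
proof -
  have spA: "space A = space M" and spB: "space B = space M"
    using A B by (auto simp: subalgebra_def)
  have "indep_var borel \<xi> borel Y"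
    unfolding indep_var_eq
  proof (intro conjI)
    show "indep_set (sigma_sets (space M) {\<xi> -` S \<inter> space M |S. S \<in> sets borel})
        (sigma_sets (space M) {Y -` S \<inter> space M |S. S \<in> sets borel})"
      unfolding indep_set_def
    proof (rule indep_sets_mono_sets[OF ind[unfolded indep_set_def]])
      have "sigma_sets (space A) {\<xi> -` S \<inter> space A |S. S \<in> sets borel} \<subseteq> sets A"
        using measurable_sets[OF \<xi>(1)] by (intro sets.sigma_sets_subset) auto
      moreover have "sigma_sets (space B) {Y -` S \<inter> space B |S. S \<in> sets borel} \<subseteq> sets B"
        using measurable_sets[OF Y(1)] by (intro sets.sigma_sets_subset) auto
      ultimately show "case_bool (sigma_sets (space M) {\<xi> -` S \<inter> space M |S. S \<in> sets borel})
          (sigma_sets (space M) {Y -` S \<inter> space M |S. S \<in> sets borel}) i \<subseteq>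
          case_bool (sets A) (sets B) i" for i
        by (simp add: spA spB split: bool.split)
    qed
  qed (use measurable_from_subalg[OF A \<xi>(1)] measurable_from_subalg[OF B Y(1)] in auto)
  then show ?thesis using \<xi>(2) Y(2) by (rule indep_var_lebesgue_integral)
qed

text \<open>\<open>D a r s\<close> is the increment over \<open>(r, s]\<close> of an orthogonal martingale measure evaluated on the
  set \<open>S a\<close>. Brownian motion is the case of counting measure \<open>m\<close> on its coordinates, the
  compensated Poisson measure the case where \<open>m\<close> is the intensity.\<close>

locale white_noise = prob_space P for P :: "'w measure" +
  fixes F :: "real \<Rightarrow> 'w measure" and m :: "'x measure" and Adm :: "'a set"
    and S :: "'a \<Rightarrow> 'x set" and D :: "'a \<Rightarrow> real \<Rightarrow> real \<Rightarrow> 'w \<Rightarrow> real"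
  assumes subalg: "0 \<le> t \<Longrightarrow> subalgebra P (F t)"
    and F_mono: "0 \<le> s \<Longrightarrow> s \<le> t \<Longrightarrow> sets (F s) \<subseteq> sets (F t)"
    and sf_m: "sigma_finite_measure m"
    and S_sets: "a \<in> Adm \<Longrightarrow> S a \<in> sets m"
    and S_finite: "a \<in> Adm \<Longrightarrow> emeasure m (S a) < \<infinity>"
    and D_meas: "a \<in> Adm \<Longrightarrow> 0 \<le> r \<Longrightarrow> r \<le> s \<Longrightarrow> D a r s \<in> borel_measurable (F s)"
    and D_sq: "a \<in> Adm \<Longrightarrow> 0 \<le> r \<Longrightarrow> r \<le> s \<Longrightarrow> integrable P (\<lambda>\<omega>. (D a r s \<omega>)\<^sup>2)"
    and D_add: "a \<in> Adm \<Longrightarrow> 0 \<le> r \<Longrightarrow> r \<le> s \<Longrightarrow> s \<le> t \<Longrightarrow>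
      AE \<omega> in P. D a r t \<omega> = D a r s \<omega> + D a s t \<omega>"
    and D_mean: "a \<in> Adm \<Longrightarrow> 0 \<le> r \<Longrightarrow> r \<le> s \<Longrightarrow> \<xi> \<in> borel_measurable (F r) \<Longrightarrow> integrable P \<xi> \<Longrightarrow>
      (\<integral>\<omega>. \<xi> \<omega> * D a r s \<omega> \<partial>P) = 0"
    and D_cov: "a \<in> Adm \<Longrightarrow> b \<in> Adm \<Longrightarrow> 0 \<le> r \<Longrightarrow> r \<le> s \<Longrightarrow> \<xi> \<in> borel_measurable (F r) \<Longrightarrow>
      integrable P \<xi> \<Longrightarrow>
      (\<integral>\<omega>. \<xi> \<omega> * (D a r s \<omega> * D b r s \<omega>) \<partial>P) = (\<integral>\<omega>. \<xi> \<omega> \<partial>P) * ((s - r) * measure m (S a \<inter> S b))"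
begin

lemma measurable_F_mono:
  assumes "X \<in> borel_measurable (F s)" "0 \<le> s" "s \<le> t"
  shows "X \<in> borel_measurable (F t)"
proof (rule measurable_from_subalg[OF _ assms(1)])
  show "subalgebra (F t) (F s)"
    using F_mono[OF assms(2,3)] subalg[of s] subalg[of t] assms(2,3) by (auto simp: subalgebra_def)
qed

lemma measurable_F_P: "X \<in> borel_measurable (F s) \<Longrightarrow> 0 \<le> s \<Longrightarrow> X \<in> borel_measurable P"
  by (rule measurable_from_subalg[OF subalg])

lemma D_meas_P: "a \<in> Adm \<Longrightarrow> 0 \<le> r \<Longrightarrow> r \<le> s \<Longrightarrow> D a r s \<in> borel_measurable P"
  using D_meas measurable_F_P by fastforce

lemma D_refl: "a \<in> Adm \<Longrightarrow> 0 \<le> r \<Longrightarrow> AE \<omega> in P. D a r r \<omega> = 0"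
  using D_add[of a r r r] by simp

lemma integrable_D_mult:
  assumes "a \<in> Adm" "b \<in> Adm" "0 \<le> r" "r \<le> s" "0 \<le> r'" "r' \<le> s'"
    and "\<xi> \<in> borel_measurable P" "bounded (\<xi> ` space P)"
  shows "integrable P (\<lambda>\<omega>. \<xi> \<omega> * (D a r s \<omega> * D b r' s' \<omega>))"
  using assms by (intro integrable_bounded_mult integrable_mult_of_squares D_meas_P D_sq)

lemma integrable_D:
  assumes "a \<in> Adm" "0 \<le> r" "r \<le> s" and "\<xi> \<in> borel_measurable P" "bounded (\<xi> ` space P)"
  shows "integrable P (\<lambda>\<omega>. \<xi> \<omega> * D a r s \<omega>)"
proof -
  have "integrable P (\<lambda>\<omega>. 1 * D a r s \<omega>)"
    using assms by (intro integrable_mult_of_squares D_meas_P D_sq) auto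
  then show ?thesis using integrable_bounded_mult[of P "D a r s" \<xi>] assms by simp
qed

text \<open>The factor \<open>\<xi> \<omega> * D a r s \<omega>\<close> is known at time
  \<open>r'\<close>, so the later increment averages it to zero. The time q is kept free because the
  multiplier is known sometimes at r and sometimes only at \<open>r'\<close>.\<close>

lemma D_disjoint:
  assumes ab: "a \<in> Adm" "b \<in> Adm" and t: "0 \<le> r" "r \<le> s" "s \<le> r'" "r' \<le> s'" "0 \<le> q" "q \<le> r'"
    and \<xi>: "\<xi> \<in> borel_measurable (F q)" "bounded (\<xi> ` space P)"
  shows "(\<integral>\<omega>. \<xi> \<omega> * (D a r s \<omega> * D b r' s' \<omega>) \<partial>P) = 0"
proof -
  have "(\<integral>\<omega>. (\<xi> \<omega> * D a r s \<omega>) * D b r' s' \<omega> \<partial>P) = 0"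
  proof (rule D_mean[OF ab(2)])
    show "(\<lambda>\<omega>. \<xi> \<omega> * D a r s \<omega>) \<in> borel_measurable (F r')"
      using D_meas[OF ab(1) t(1,2)] \<xi>(1) t
      by (intro borel_measurable_times) (auto intro: measurable_F_mono)
    show "integrable P (\<lambda>\<omega>. \<xi> \<omega> * D a r s \<omega>)"
      using \<xi> t ab by (intro integrable_D) (auto intro: measurable_F_P)
  qed (use t in auto)
  then show ?thesis by (simp add: mult.assoc)
qed

text \<open>Splitting the longer increment at s leaves the covariance over the common interval and a
  product with a later increment, which has mean zero.\<close>

lemma D_common_start:
  assumes ab: "a \<in> Adm" "b \<in> Adm" and t: "0 \<le> r" "r \<le> s" "s \<le> s'"
    and \<xi>: "\<xi> \<in> borel_measurable (F r)" "bounded (\<xi> ` space P)"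
  shows "(\<integral>\<omega>. \<xi> \<omega> * (D a r s \<omega> * D b r s' \<omega>) \<partial>P) =
    (\<integral>\<omega>. \<xi> \<omega> \<partial>P) * ((s - r) * measure m (S a \<inter> S b))"
proof -
  have \<xi>P: "\<xi> \<in> borel_measurable P" using measurable_F_P \<xi>(1) t by auto
  have i: "integrable P \<xi>"
    using integrable_bounded_mult[OF _ \<xi>P \<xi>(2), of "\<lambda>_. 1"] by simp
  have "(\<integral>\<omega>. \<xi> \<omega> * (D a r s \<omega> * D b r s' \<omega>) \<partial>P) =
      (\<integral>\<omega>. \<xi> \<omega> * (D a r s \<omega> * D b r s \<omega>) + \<xi> \<omega> * (D a r s \<omega> * D b s s' \<omega>) \<partial>P)"
  proof (rule integral_cong_AE)
    show "AE \<omega> in P. \<xi> \<omega> * (D a r s \<omega> * D b r s' \<omega>) =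
        \<xi> \<omega> * (D a r s \<omega> * D b r s \<omega>) + \<xi> \<omega> * (D a r s \<omega> * D b s s' \<omega>)"
      using D_add[OF ab(2) t] by eventually_elim (simp add: algebra_simps)
  qed (use \<xi>P D_meas_P ab t in auto)
  also have "\<dots> = (\<integral>\<omega>. \<xi> \<omega> * (D a r s \<omega> * D b r s \<omega>) \<partial>P) + (\<integral>\<omega>. \<xi> \<omega> * (D a r s \<omega> * D b s s' \<omega>) \<partial>P)"
    using ab t \<xi>P \<xi>(2) by (intro Bochner_Integration.integral_add integrable_D_mult) auto
  also have "\<dots> = (\<integral>\<omega>. \<xi> \<omega> \<partial>P) * ((s - r) * measure m (S a \<inter> S b))"
    using D_cov[OF ab t(1,2) \<xi>(1) i] D_disjoint[OF ab t(1,2) order_refl t(3) t(1,2) \<xi>] by simp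
  finally show ?thesis .
qed

text \<open>The piece of the first increment before \<open>r'\<close> is orthogonal to the second
  increment; the rest starts at \<open>r'\<close> together with it. The maximum with 0 covers
  intervals that do not meet. Arbitrary overlaps must be treated because the lists that represent
  simple integrands allow them.\<close>

lemma D_pair_ordered:
  assumes ab: "a \<in> Adm" "b \<in> Adm" and t: "0 \<le> r" "r \<le> s" "r \<le> r'" "r' \<le> s'"
    and \<xi>: "\<xi> \<in> borel_measurable (F r')" "bounded (\<xi> ` space P)"
  shows "(\<integral>\<omega>. \<xi> \<omega> * (D a r s \<omega> * D b r' s' \<omega>) \<partial>P) =
    (\<integral>\<omega>. \<xi> \<omega> \<partial>P) * (max 0 (min s s' - r') * measure m (S a \<inter> S b))"
proof (cases "s \<le> r'")
  case True
  then show ?thesis using D_disjoint[OF ab t(1,2) True t(4) _ order_refl \<xi>] t by simp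
next
  case False
  then have s: "r' \<le> s" "0 \<le> r'" using t by auto
  have \<xi>P: "\<xi> \<in> borel_measurable P" by (rule measurable_F_P[OF \<xi>(1) s(2)])
  have "(\<integral>\<omega>. \<xi> \<omega> * (D a r s \<omega> * D b r' s' \<omega>) \<partial>P) =
      (\<integral>\<omega>. \<xi> \<omega> * (D a r r' \<omega> * D b r' s' \<omega>) + \<xi> \<omega> * (D a r' s \<omega> * D b r' s' \<omega>) \<partial>P)"
  proof (rule integral_cong_AE)
    show "AE \<omega> in P. \<xi> \<omega> * (D a r s \<omega> * D b r' s' \<omega>) =
        \<xi> \<omega> * (D a r r' \<omega> * D b r' s' \<omega>) + \<xi> \<omega> * (D a r' s \<omega> * D b r' s' \<omega>)"
      using D_add[OF ab(1) t(1,3) s(1)] by eventually_elim (simp add: algebra_simps)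
  qed (use \<xi>P D_meas_P ab t s in auto)
  also have "\<dots> = (\<integral>\<omega>. \<xi> \<omega> * (D a r r' \<omega> * D b r' s' \<omega>) \<partial>P) + (\<integral>\<omega>. \<xi> \<omega> * (D a r' s \<omega> * D b r' s' \<omega>) \<partial>P)"
    using ab t s \<xi>P \<xi>(2) by (intro Bochner_Integration.integral_add integrable_D_mult) auto
  also have "(\<integral>\<omega>. \<xi> \<omega> * (D a r r' \<omega> * D b r' s' \<omega>) \<partial>P) = 0"
    by (rule D_disjoint[OF ab t(1,3) order_refl t(4) s(2) order_refl \<xi>])
  also have "(\<integral>\<omega>. \<xi> \<omega> * (D a r' s \<omega> * D b r' s' \<omega>) \<partial>P) =
      (\<integral>\<omega>. \<xi> \<omega> \<partial>P) * ((min s s' - r') * measure m (S a \<inter> S b))"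
  proof (cases "s \<le> s'")
    case True
    then show ?thesis using D_common_start[OF ab s(2,1) True \<xi>] by (simp add: min_def)
  next
    case False
    then show ?thesis using D_common_start[OF ab(2,1) s(2) t(4) _ \<xi>, of s]
      by (simp add: min_def mult.commute[of "D a _ _ _"] Int_commute)
  qed
  finally show ?thesis using s t by simp
qed

lemma D_pair:
  assumes ab: "a \<in> Adm" "b \<in> Adm" and t: "0 \<le> r" "r \<le> s" "0 \<le> r'" "r' \<le> s'"
    and \<xi>: "\<xi> \<in> borel_measurable (F (max r r'))" "bounded (\<xi> ` space P)"
  shows "(\<integral>\<omega>. \<xi> \<omega> * (D a r s \<omega> * D b r' s' \<omega>) \<partial>P) =
    (\<integral>\<omega>. \<xi> \<omega> \<partial>P) * (max 0 (min s s' - max r r') * measure m (S a \<inter> S b))"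
proof (cases "r \<le> r'")
  case True
  then show ?thesis using D_pair_ordered[OF ab t(1,2) True t(4)] \<xi> by (simp add: max_def)
next
  case False
  then show ?thesis using D_pair_ordered[OF ab(2,1) t(3,4) _ t(2), of \<xi>] \<xi>
    by (simp add: max_def mult.commute[of "D a _ _ _"] Int_commute min.commute)
qed

definition simple :: "(real \<times> real \<times> 'a \<times> ('w \<Rightarrow> 'v::euclidean_space)) list \<Rightarrow> bool" where
  "simple L \<longleftrightarrow> (\<forall>(r, s, a, \<phi>)\<in>set L. 0 \<le> r \<and> r \<le> s \<and> a \<in> Adm \<and>
     \<phi> \<in> borel_measurable (F r) \<and> bounded (\<phi> ` space P))"

definition simple_field :: "(real \<times> real \<times> 'a \<times> ('w \<Rightarrow> 'v::euclidean_space)) list \<Rightarrow> real \<Rightarrow> 'w \<Rightarrow> 'x \<Rightarrow> 'v" where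
  "simple_field L t \<omega> x = (\<Sum>(r, s, a, \<phi>)\<leftarrow>L. (indicator {r<..s} t * indicator (S a) x) *\<^sub>R \<phi> \<omega>)"

definition simple_integral :: "(real \<times> real \<times> 'a \<times> ('w \<Rightarrow> 'v::euclidean_space)) list \<Rightarrow> real \<Rightarrow> 'w \<Rightarrow> 'v" where
  "simple_integral L t \<omega> = (\<Sum>(r, s, a, \<phi>)\<leftarrow>L. D a (min r t) (min s t) \<omega> *\<^sub>R \<phi> \<omega>)"

text \<open>If t precedes the start of one of the intervals, stopping collapses its increment to one
  over \<open>{t<..t}\<close>, which vanishes almost surely by \<open>D_refl\<close>. Otherwise
  stopping only shortens the right ends, and the inner product of the two coefficients, known at the
  later of the two starts, is the multiplier in \<open>D_pair\<close>.\<close>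

lemma simple_pair:
  fixes \<phi> \<psi> :: "'w \<Rightarrow> 'v::euclidean_space"
  assumes s1: "simple [(r, s, a, \<phi>)]" and s2: "simple [(r', s', b, \<psi>)]" and t: "0 \<le> t"
  shows "integrable P (\<lambda>\<omega>. (\<phi> \<omega> \<bullet> \<psi> \<omega>) * (D a (min r t) (min s t) \<omega> * D b (min r' t) (min s' t) \<omega>))"
    and "(\<integral>\<omega>. (\<phi> \<omega> \<bullet> \<psi> \<omega>) * (D a (min r t) (min s t) \<omega> * D b (min r' t) (min s' t) \<omega>) \<partial>P) =
      (\<integral>\<omega>. \<phi> \<omega> \<bullet> \<psi> \<omega> \<partial>P) *
        (measure lborel ({r<..s} \<inter> {r'<..s'} \<inter> {0..t}) * measure m (S a \<inter> S b))"
proof -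
  have h: "0 \<le> r" "r \<le> s" "a \<in> Adm" "\<phi> \<in> borel_measurable (F r)" "bounded (\<phi> ` space P)"
    and h': "0 \<le> r'" "r' \<le> s'" "b \<in> Adm" "\<psi> \<in> borel_measurable (F r')" "bounded (\<psi> ` space P)"
    using s1 s2 by (auto simp: simple_def)
  have bdd: "bounded ((\<lambda>\<omega>. \<phi> \<omega> \<bullet> \<psi> \<omega>) ` space P)"
  proof -
    obtain K K' where "\<And>\<omega>. \<omega> \<in> space P \<Longrightarrow> norm (\<phi> \<omega>) \<le> K" "\<And>\<omega>. \<omega> \<in> space P \<Longrightarrow> norm (\<psi> \<omega>) \<le> K'"
      using h(5) h'(5) unfolding bounded_iff by auto
    then have "\<bar>\<phi> \<omega> \<bullet> \<psi> \<omega>\<bar> \<le> K * K'" if "\<omega> \<in> space P" for \<omega>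
      using that Cauchy_Schwarz_ineq2[of "\<phi> \<omega>" "\<psi> \<omega>"]
      by (meson mult_mono norm_ge_zero order_trans)
    then show ?thesis unfolding bounded_iff by auto
  qed
  have meas: "(\<lambda>\<omega>. \<phi> \<omega> \<bullet> \<psi> \<omega>) \<in> borel_measurable (F (max r r'))"
    using h h' by (intro borel_measurable_inner) (auto intro: measurable_F_mono)
  then have measP: "(\<lambda>\<omega>. \<phi> \<omega> \<bullet> \<psi> \<omega>) \<in> borel_measurable P"
    by (rule measurable_F_P) (use h in auto)
  show "integrable P (\<lambda>\<omega>. (\<phi> \<omega> \<bullet> \<psi> \<omega>) * (D a (min r t) (min s t) \<omega> * D b (min r' t) (min s' t) \<omega>))"
    using h h' t bdd measP by (intro integrable_D_mult) auto
  show "(\<integral>\<omega>. (\<phi> \<omega> \<bullet> \<psi> \<omega>) * (D a (min r t) (min s t) \<omega> * D b (min r' t) (min s' t) \<omega>) \<partial>P) =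
      (\<integral>\<omega>. \<phi> \<omega> \<bullet> \<psi> \<omega> \<partial>P) *
        (measure lborel ({r<..s} \<inter> {r'<..s'} \<inter> {0..t}) * measure m (S a \<inter> S b))"
  proof (cases "t < r \<or> t < r'")
    case True
    have "AE \<omega> in P. (\<phi> \<omega> \<bullet> \<psi> \<omega>) * (D a (min r t) (min s t) \<omega> * D b (min r' t) (min s' t) \<omega>) = 0"
    proof (cases "t < r")
      case True
      then have "min r t = t" "min s t = t" using h by auto
      then show ?thesis using D_refl[OF h(3) t] by auto
    next
      case False
      then have "min r' t = t" "min s' t = t" using True h' by auto
      then show ?thesis using D_refl[OF h'(3) t] by auto
    qed
    then have "(\<integral>\<omega>. (\<phi> \<omega> \<bullet> \<psi> \<omega>) * (D a (min r t) (min s t) \<omega> * D b (min r' t) (min s' t) \<omega>) \<partial>P) = 0"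
      by (rule integral_eq_zero_AE)
    moreover have "{r<..s} \<inter> {r'<..s'} \<inter> {0..t} = {}" using True by auto
    ultimately show ?thesis by simp
  next
    case False
    then have m: "min r t = r" "min r' t = r'" by auto
    have "{r<..s} \<inter> {r'<..s'} \<inter> {0..t} = {max r r'<..min (min s t) (min s' t)}"
      using h h' by auto
    then have "measure lborel ({r<..s} \<inter> {r'<..s'} \<inter> {0..t}) = max 0 (min (min s t) (min s' t) - max r r')"
      by (simp only: measure_lborel_Ioc_max)
    moreover have "r \<le> min s t" "r' \<le> min s' t" using h h' False by auto
    note D_pair[OF h(3) h'(3) h(1) this(1) h'(1) this(2) meas bdd]
    ultimately show ?thesis
      unfolding m by simp
  qed
qed

text \<open>Both squared norms are expanded into double sums over pairs of list positions. The pair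
  (i, j) contributes the mean of \<open>\<phi> i \<omega> \<bullet> \<phi> j \<omega>\<close> times
  the product measure of \<open>A i \<inter> A j\<close>, on the left by \<open>simple_pair\<close>
  and on the right by Fubini. Working with pairs avoids refining the list to disjoint intervals and
  sets.\<close>

lemma simple_isometry:
  fixes L :: "(real \<times> real \<times> 'a \<times> ('w \<Rightarrow> 'v::euclidean_space)) list"
  assumes L: "simple L" and t: "0 \<le> t"
  shows "(\<integral>\<^sup>+\<omega>. esq (simple_integral L t \<omega>) \<partial>P) =
    (\<integral>\<^sup>+\<omega>. (\<integral>\<^sup>+\<tau>\<in>{0..t}. (\<integral>\<^sup>+x. esq (simple_field L \<tau> \<omega> x) \<partial>m) \<partial>lborel) \<partial>P)"
proof -
  interpret m: sigma_finite_measure m by (rule sf_m)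
  interpret pair: pair_sigma_finite lborel m ..
  define I where "I = {..<length L}"
  define r s a \<phi> where "r i = fst (L ! i)" and "s i = fst (snd (L ! i))" and
    "a i = fst (snd (snd (L ! i)))" and "\<phi> i = snd (snd (snd (L ! i)))" for i
  have Li: "L ! i = (r i, s i, a i, \<phi> i)" for i
    by (simp add: r_def s_def a_def \<phi>_def)
  have simple: "simple [(r i, s i, a i, \<phi> i)]" if "i \<in> I" for i
    using L that nth_mem[of i L] Li[of i] unfolding simple_def I_def by fastforce
  have aI: "a i \<in> Adm" and \<phi>b: "bounded (\<phi> i ` space P)" and \<phi>m: "\<phi> i \<in> borel_measurable P" if "i \<in> I" for i
    using simple[OF that] by (auto simp: simple_def intro: measurable_F_P)
  define X where "X i \<omega> = D (a i) (min (r i) t) (min (s i) t) \<omega>" for i \<omega>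
  define A where "A i = ({r i<..s i} \<inter> {0..t}) \<times> S (a i)" for i
  define c where "c i j = measure lborel ({r i<..s i} \<inter> {r j<..s j} \<inter> {0..t}) * measure m (S (a i) \<inter> S (a j))" for i j
  have int_eq: "simple_integral L t \<omega> = (\<Sum>i\<in>I. X i \<omega> *\<^sub>R \<phi> i \<omega>)" for \<omega>
    unfolding simple_integral_def I_def X_def
    by (simp add: sum_list_sum_nth atLeast0LessThan Li)
  have field_eq: "indicator {0..t} \<tau> *\<^sub>R simple_field L \<tau> \<omega> x = (\<Sum>i\<in>I. indicator (A i) (\<tau>, x) *\<^sub>R \<phi> i \<omega>)" for \<tau> \<omega> x
    unfolding simple_field_def I_def A_def
    by (simp add: sum_list_sum_nth atLeast0LessThan Li scaleR_sum_right indicator_times indicator_inter_arith mult_ac)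
  have AiA [measurable]: "A i \<in> sets (lborel \<Otimes>\<^sub>M m)" if "i \<in> I" for i
    unfolding A_def using S_sets[OF aI[OF that]] by simp
  have em: "emeasure (lborel \<Otimes>\<^sub>M m) (A i \<inter> A j) = ennreal (c i j)" if "i \<in> I" "j \<in> I" for i j
  proof -
    have "A i \<inter> A j = ({r i<..s i} \<inter> {r j<..s j} \<inter> {0..t}) \<times> (S (a i) \<inter> S (a j))"
      unfolding A_def by auto
    then have "emeasure (lborel \<Otimes>\<^sub>M m) (A i \<inter> A j) =
        emeasure lborel ({r i<..s i} \<inter> {r j<..s j} \<inter> {0..t}) * emeasure m (S (a i) \<inter> S (a j))"
      using S_sets[OF aI[OF that(1)]] S_sets[OF aI[OF that(2)]]
      by (simp add: m.emeasure_pair_measure_Times)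
    moreover have "emeasure lborel ({r i<..s i} \<inter> {r j<..s j} \<inter> {0..t}) < \<infinity>"
      using emeasure_mono[of "{r i<..s i} \<inter> {r j<..s j} \<inter> {0..t}" "{0..t}" lborel] t
      by (auto simp: less_top[symmetric] top_unique)
    moreover have "emeasure m (S (a i) \<inter> S (a j)) < \<infinity>"
      using emeasure_mono[of "S (a i) \<inter> S (a j)" "S (a i)" m] S_finite[OF aI[OF that(1)]] S_sets[OF aI[OF that(1)]]
      by (auto intro: le_less_trans)
    ultimately show ?thesis
      by (simp add: c_def emeasure_eq_ennreal_measure ennreal_mult less_top)
  qed
  let ?f = "\<lambda>\<omega> z. \<Sum>i\<in>I. indicator (A i) z *\<^sub>R \<phi> i \<omega>"
  have sq: "(norm (?f \<omega> z))\<^sup>2 = (\<Sum>i\<in>I. \<Sum>j\<in>I. indicator (A i \<inter> A j) z * (\<phi> i \<omega> \<bullet> \<phi> j \<omega>))" for \<omega> z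
    by (simp add: power2_norm_eq_inner inner_sum_left inner_sum_right indicator_inter_arith
        sum_distrib_left inner_commute mult_ac)
  have iA: "integrable (lborel \<Otimes>\<^sub>M m) (\<lambda>z. indicator (A i \<inter> A j) z * (\<phi> i \<omega> \<bullet> \<phi> j \<omega>))" if "i \<in> I" "j \<in> I" for i j \<omega>
    using em[OF that] that by (intro integrable_mult_left integrable_real_indicator sets.Int AiA) auto
  have int_f: "(\<integral>z. (norm (?f \<omega> z))\<^sup>2 \<partial>(lborel \<Otimes>\<^sub>M m)) = (\<Sum>i\<in>I. \<Sum>j\<in>I. (\<phi> i \<omega> \<bullet> \<phi> j \<omega>) * c i j)" for \<omega>
  proof -
    have "(\<integral>z. indicator (A i \<inter> A j) z * (\<phi> i \<omega> \<bullet> \<phi> j \<omega>) \<partial>(lborel \<Otimes>\<^sub>M m)) = (\<phi> i \<omega> \<bullet> \<phi> j \<omega>) * c i j"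
      if "i \<in> I" "j \<in> I" for i j
    proof -
      have "measure (lborel \<Otimes>\<^sub>M m) (A i \<inter> A j) = c i j"
        using em[OF that] by (simp add: measure_def c_def)
      moreover have "A i \<inter> A j \<inter> space (lborel \<Otimes>\<^sub>M m) = A i \<inter> A j"
        using sets.sets_into_space[OF AiA[OF that(1)]] by auto
      ultimately show ?thesis
        by simp
    qed
    note eq = this
    have "(\<integral>z. (norm (?f \<omega> z))\<^sup>2 \<partial>(lborel \<Otimes>\<^sub>M m)) =
        (\<Sum>i\<in>I. \<integral>z. (\<Sum>j\<in>I. indicator (A i \<inter> A j) z * (\<phi> i \<omega> \<bullet> \<phi> j \<omega>)) \<partial>(lborel \<Otimes>\<^sub>M m))"
      unfolding sq using iA by (intro Bochner_Integration.integral_sum Bochner_Integration.integrable_sum)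
    also have "\<dots> =
        (\<Sum>i\<in>I. \<Sum>j\<in>I. \<integral>z. indicator (A i \<inter> A j) z * (\<phi> i \<omega> \<bullet> \<phi> j \<omega>) \<partial>(lborel \<Otimes>\<^sub>M m))"
      using iA by (intro sum.cong refl Bochner_Integration.integral_sum)
    also have "\<dots> = (\<Sum>i\<in>I. \<Sum>j\<in>I. (\<phi> i \<omega> \<bullet> \<phi> j \<omega>) * c i j)"
      using eq by (intro sum.cong refl)
    finally show ?thesis .
  qed
  have inner: "(\<integral>\<^sup>+\<tau>\<in>{0..t}. (\<integral>\<^sup>+x. esq (simple_field L \<tau> \<omega> x) \<partial>m) \<partial>lborel) =
      ennreal (\<Sum>i\<in>I. \<Sum>j\<in>I. (\<phi> i \<omega> \<bullet> \<phi> j \<omega>) * c i j)" for \<omega>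
  proof -
    have "(\<integral>\<^sup>+\<tau>\<in>{0..t}. (\<integral>\<^sup>+x. esq (simple_field L \<tau> \<omega> x) \<partial>m) \<partial>lborel) =
        (\<integral>\<^sup>+\<tau>. (\<integral>\<^sup>+x. esq (?f \<omega> (\<tau>, x)) \<partial>m) \<partial>lborel)"
      by (intro nn_integral_cong) (auto simp flip: field_eq split: split_indicator)
    also have "\<dots> = (\<integral>\<^sup>+z. esq (?f \<omega> z) \<partial>(lborel \<Otimes>\<^sub>M m))"
      by (rule m.nn_integral_fst) measurable
    also have "\<dots> = ennreal (\<integral>z. (norm (?f \<omega> z))\<^sup>2 \<partial>(lborel \<Otimes>\<^sub>M m))"
    proof (rule nn_integral_eq_integral)
      show "integrable (lborel \<Otimes>\<^sub>M m) (\<lambda>z. (norm (?f \<omega> z))\<^sup>2)"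
        unfolding sq using iA by (intro Bochner_Integration.integrable_sum)
    qed simp
    finally show ?thesis unfolding int_f .
  qed
  have sqX: "(norm (\<Sum>i\<in>I. X i \<omega> *\<^sub>R \<phi> i \<omega>))\<^sup>2 = (\<Sum>i\<in>I. \<Sum>j\<in>I. (\<phi> i \<omega> \<bullet> \<phi> j \<omega>) * (X i \<omega> * X j \<omega>))" for \<omega>
    by (simp add: power2_norm_eq_inner inner_sum_left inner_sum_right sum_distrib_left inner_commute mult_ac)
  have iX: "integrable P (\<lambda>\<omega>. (\<phi> i \<omega> \<bullet> \<phi> j \<omega>) * (X i \<omega> * X j \<omega>))" if "i \<in> I" "j \<in> I" for i j
    unfolding X_def by (rule simple_pair(1)[OF simple[OF that(1)] simple[OF that(2)] t])
  have i\<phi>: "integrable P (\<lambda>\<omega>. \<phi> i \<omega> \<bullet> \<phi> j \<omega>)" if "i \<in> I" "j \<in> I" for i j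
  proof -
    note bij = \<phi>b[OF that(1)] \<phi>b[OF that(2)] and mij = \<phi>m[OF that(1)] \<phi>m[OF that(2)]
    obtain K K' where "\<And>\<omega>. \<omega> \<in> space P \<Longrightarrow> norm (\<phi> i \<omega>) \<le> K" "\<And>\<omega>. \<omega> \<in> space P \<Longrightarrow> norm (\<phi> j \<omega>) \<le> K'"
      using bij unfolding bounded_iff by auto
    then have "norm (\<phi> i \<omega> \<bullet> \<phi> j \<omega>) \<le> K * K'" if "\<omega> \<in> space P" for \<omega>
      using that Cauchy_Schwarz_ineq2[of "\<phi> i \<omega>" "\<phi> j \<omega>"]
      unfolding real_norm_def by (meson mult_mono norm_ge_zero order_trans)
    then show ?thesis
      using mij by (intro integrable_const_bound[of _ "K * K'"]) auto
  qed
  have "(\<integral>\<^sup>+\<omega>. esq (simple_integral L t \<omega>) \<partial>P) =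
      ennreal (\<integral>\<omega>. (\<Sum>i\<in>I. \<Sum>j\<in>I. (\<phi> i \<omega> \<bullet> \<phi> j \<omega>) * (X i \<omega> * X j \<omega>)) \<partial>P)"
  proof -
    have "integrable P (\<lambda>\<omega>. (norm (\<Sum>i\<in>I. X i \<omega> *\<^sub>R \<phi> i \<omega>))\<^sup>2)"
      unfolding sqX using iX by (intro Bochner_Integration.integrable_sum)
    then show ?thesis
      unfolding int_eq sqX[symmetric] by (intro nn_integral_eq_integral) auto
  qed
  also have "(\<integral>\<omega>. (\<Sum>i\<in>I. \<Sum>j\<in>I. (\<phi> i \<omega> \<bullet> \<phi> j \<omega>) * (X i \<omega> * X j \<omega>)) \<partial>P) =
      (\<integral>\<omega>. (\<Sum>i\<in>I. \<Sum>j\<in>I. (\<phi> i \<omega> \<bullet> \<phi> j \<omega>) * c i j) \<partial>P)"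
    using iX i\<phi> simple_pair(2)[OF simple simple t]
    by (simp add: Bochner_Integration.integral_sum X_def c_def)
  also have "ennreal \<dots> = (\<integral>\<^sup>+\<omega>. ennreal (\<Sum>i\<in>I. \<Sum>j\<in>I. (\<phi> i \<omega> \<bullet> \<phi> j \<omega>) * c i j) \<partial>P)"
  proof (rule nn_integral_eq_integral[symmetric])
    show "integrable P (\<lambda>\<omega>. \<Sum>i\<in>I. \<Sum>j\<in>I. (\<phi> i \<omega> \<bullet> \<phi> j \<omega>) * c i j)"
      using i\<phi> by auto
    \<comment> \<open>Single terms of the double sum may be negative; the whole is nonnegative
      because it is the integral of a squared norm.\<close>
    show "AE \<omega> in P. 0 \<le> (\<Sum>i\<in>I. \<Sum>j\<in>I. (\<phi> i \<omega> \<bullet> \<phi> j \<omega>) * c i j)"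
      unfolding int_f[symmetric] by simp
  qed
  finally show ?thesis unfolding inner .
qed

end

section \<open>Mean square limits of simple integrals\<close>

context white_noise
begin

text \<open>Since list entries may overlap, the difference of two simple integrands is simple by
  mere concatenation, and the isometry applies to differences directly.\<close>

lemma simple_append_uminus:
  fixes L L' :: "(real \<times> real \<times> 'a \<times> ('w \<Rightarrow> 'v::euclidean_space)) list"
  defines "L'' \<equiv> L @ map (\<lambda>(r, s, a, \<phi>). (r, s, a, \<lambda>\<omega>. - \<phi> \<omega>)) L'"
  shows "simple L \<Longrightarrow> simple L' \<Longrightarrow> simple L''"
    and "simple_field L'' t \<omega> x = simple_field L t \<omega> x - simple_field L' t \<omega> x"
    and "simple_integral L'' t \<omega> = simple_integral L t \<omega> - simple_integral L' t \<omega>"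
proof -
  show "simple L''" if L: "simple L" and L': "simple L'"
    unfolding simple_def L''_def
  proof (clarsimp, elim disjE, goal_cases)
    case (1 r s a \<phi>) then show ?case using L by (auto simp: simple_def)
  next
    case (2 r s a \<phi>)
    then obtain \<psi> where e: "\<phi> = (\<lambda>\<omega>. - \<psi> \<omega>)" "(r, s, a, \<psi>) \<in> set L'" by auto
    then have h: "0 \<le> r" "r \<le> s" "a \<in> Adm" "\<psi> \<in> borel_measurable (F r)" "bounded (\<psi> ` space P)"
      using L' by (auto simp: simple_def)
    have "(\<lambda>\<omega>. - \<psi> \<omega>) ` space P = uminus ` (\<psi> ` space P)" by auto
    then show ?case using h e by (simp add: bounded_uminus)
  qed
  show "simple_field L'' t \<omega> x = simple_field L t \<omega> x - simple_field L' t \<omega> x"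
    unfolding simple_field_def L''_def
    by (induction L') (auto simp: algebra_simps)
  show "simple_integral L'' t \<omega> = simple_integral L t \<omega> - simple_integral L' t \<omega>"
    unfolding simple_integral_def L''_def
    by (induction L') (auto simp: algebra_simps)
qed

lemma measurable_simple_field:
  fixes L :: "(real \<times> real \<times> 'a \<times> ('w \<Rightarrow> 'v::euclidean_space)) list"
  assumes "simple L"
  shows "(\<lambda>(t, \<omega>, x). simple_field L t \<omega> x) \<in> borel_measurable (borel \<Otimes>\<^sub>M P \<Otimes>\<^sub>M m)"
  using assms
proof (induction L)
  case Nil
  then show ?case by (simp add: simple_field_def)
next
  case (Cons e L)
  obtain r s a \<phi> where e: "e = (r, s, a, \<phi>)" by (cases e)
  have h: "0 \<le> r" "a \<in> Adm" "\<phi> \<in> borel_measurable (F r)" and L: "simple L"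
    using Cons.prems by (auto simp: simple_def e)
  have [measurable]: "\<phi> \<in> borel_measurable P" "S a \<in> sets m"
    using measurable_F_P h S_sets by auto
  note [measurable] = Cons.IH[OF L]
  have "(\<lambda>(t, \<omega>, x). simple_field (e # L) t \<omega> x) = (\<lambda>z. (indicator {r<..s} (fst z) *
      indicator (S a) (snd (snd z))) *\<^sub>R \<phi> (fst (snd z)) + (case z of (t, \<omega>, x) \<Rightarrow> simple_field L t \<omega> x))"
    by (auto simp: simple_field_def e)
  then show ?case by simp
qed

lemma measurable_simple_integral:
  fixes L :: "(real \<times> real \<times> 'a \<times> ('w \<Rightarrow> 'v::euclidean_space)) list"
  assumes "simple L" "0 \<le> t"
  shows "simple_integral L t \<in> borel_measurable P"
  using assms(1)
proof (induction L)
  case Nil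
  then show ?case by (simp add: simple_integral_def)
next
  case (Cons e L)
  obtain r s a \<phi> where e: "e = (r, s, a, \<phi>)" by (cases e)
  have h: "0 \<le> r" "r \<le> s" "a \<in> Adm" "\<phi> \<in> borel_measurable (F r)" and L: "simple L"
    using Cons.prems by (auto simp: simple_def e)
  have [measurable]: "\<phi> \<in> borel_measurable P" "D a (min r t) (min s t) \<in> borel_measurable P"
    using measurable_F_P h D_meas_P assms(2) by auto
  note [measurable] = Cons.IH[OF L]
  have "simple_integral (e # L) t = (\<lambda>\<omega>. D a (min r t) (min s t) \<omega> *\<^sub>R \<phi> \<omega> + simple_integral L t \<omega>)"
    by (auto simp: simple_integral_def e)
  then show ?case by simp
qed

text \<open>The iterated form, with the sample point outermost, is the one in the definitions of the
  stochastic integrals; it is insensitive to changing the integrand at a null set of times on each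
  path.\<close>

definition field_sq :: "real \<Rightarrow> (real \<Rightarrow> 'w \<Rightarrow> 'x \<Rightarrow> 'v::euclidean_space) \<Rightarrow> ennreal" where
  "field_sq t g = (\<integral>\<^sup>+\<omega>. (\<integral>\<^sup>+\<tau>\<in>{0..t}. (\<integral>\<^sup>+x. esq (g \<tau> \<omega> x) \<partial>m) \<partial>lborel) \<partial>P)"

lemma field_sq_mono: "s \<le> t \<Longrightarrow> field_sq s g \<le> field_sq t g"
  unfolding field_sq_def by (intro nn_integral_mono) (auto split: split_indicator)

lemma field_sq_diff_commute: "field_sq t (\<lambda>\<tau> \<omega> x. f \<tau> \<omega> x - g \<tau> \<omega> x) = field_sq t (\<lambda>\<tau> \<omega> x. g \<tau> \<omega> x - f \<tau> \<omega> x)"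
  unfolding field_sq_def by (simp add: norm_minus_commute)

lemma measurable_field_sq:
  fixes g :: "real \<Rightarrow> 'w \<Rightarrow> 'x \<Rightarrow> 'v::euclidean_space"
  assumes "(\<lambda>(t, \<omega>, x). g t \<omega> x) \<in> borel_measurable (borel \<Otimes>\<^sub>M P \<Otimes>\<^sub>M m)"
  shows "(\<lambda>(\<omega>, \<tau>, x). indicator {0..t} \<tau> * esq (g \<tau> \<omega> x))
    \<in> borel_measurable (P \<Otimes>\<^sub>M lborel \<Otimes>\<^sub>M m)"
proof -
  have time: "(\<lambda>z. fst (snd z) :: real) \<in> P \<Otimes>\<^sub>M lborel \<Otimes>\<^sub>M m \<rightarrow>\<^sub>M borel"
    using measurable_compose[OF measurable_snd measurable_fst, of P lborel m] by simp
  have "(\<lambda>z. (fst (snd z), fst z, snd (snd z))) \<in> P \<Otimes>\<^sub>M lborel \<Otimes>\<^sub>M m \<rightarrow>\<^sub>M borel \<Otimes>\<^sub>M P \<Otimes>\<^sub>M m"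
    using time by (intro measurable_Pair) auto
  from measurable_compose[OF this assms]
  have [measurable]: "(\<lambda>z. g (fst (snd z)) (fst z) (snd (snd z))) \<in> borel_measurable (P \<Otimes>\<^sub>M lborel \<Otimes>\<^sub>M m)"
    by simp
  have [measurable]: "(\<lambda>z. indicator {0..t} (fst (snd z)) :: ennreal) \<in> borel_measurable (P \<Otimes>\<^sub>M lborel \<Otimes>\<^sub>M m)"
    by (rule measurable_compose[OF time borel_measurable_indicator]) simp
  show ?thesis unfolding case_prod_beta' by measurable
qed

text \<open>The product form is what makes the integral additive: sums of \<open>nn_integral\<close>
  can be split for jointly measurable integrands without checking each iterated layer.\<close>

lemma field_sq_eq:
  assumes "(\<lambda>(t, \<omega>, x). g t \<omega> x) \<in> borel_measurable (borel \<Otimes>\<^sub>M P \<Otimes>\<^sub>M m)"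
  shows "field_sq t g = (\<integral>\<^sup>+(\<omega>, \<tau>, x). indicator {0..t} \<tau> * esq (g \<tau> \<omega> x) \<partial>(P \<Otimes>\<^sub>M lborel \<Otimes>\<^sub>M m))"
proof -
  interpret m: sigma_finite_measure m by (rule sf_m)
  interpret lm: sigma_finite_measure "lborel \<Otimes>\<^sub>M m"
    by (rule sigma_finite_pair_measure[OF sigma_finite_lborel sf_m])
  have [measurable]: "(\<lambda>z. g (fst z) \<omega> (snd z)) \<in> borel_measurable (borel \<Otimes>\<^sub>M m)" if "\<omega> \<in> space P" for \<omega>
    using measurable_compose[of "\<lambda>z. (fst z, \<omega>, snd z)", OF _ assms] that by simp
  have "(\<integral>\<^sup>+z. (case z of (\<omega>, \<tau>, x) \<Rightarrow> indicator {0..t} \<tau> * esq (g \<tau> \<omega> x)) \<partial>(P \<Otimes>\<^sub>M lborel \<Otimes>\<^sub>M m)) =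
      (\<integral>\<^sup>+\<omega>. (\<integral>\<^sup>+(\<tau>, x). indicator {0..t} \<tau> * esq (g \<tau> \<omega> x) \<partial>(lborel \<Otimes>\<^sub>M m)) \<partial>P)"
    using lm.nn_integral_fst[OF measurable_field_sq[OF assms, of t]] by simp
  also have "\<dots> = (\<integral>\<^sup>+\<omega>. (\<integral>\<^sup>+\<tau>. (\<integral>\<^sup>+x. indicator {0..t} \<tau> * esq (g \<tau> \<omega> x) \<partial>m) \<partial>lborel) \<partial>P)"
  proof (rule nn_integral_cong)
    fix \<omega> assume [measurable]: "\<omega> \<in> space P"
    have "(\<lambda>(\<tau>, x). indicator {0..t} \<tau> * esq (g \<tau> \<omega> x)) \<in> borel_measurable (lborel \<Otimes>\<^sub>M m)"
      by measurable
    from m.nn_integral_fst[OF this]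
    show "(\<integral>\<^sup>+(\<tau>, x). indicator {0..t} \<tau> * esq (g \<tau> \<omega> x) \<partial>(lborel \<Otimes>\<^sub>M m)) =
        (\<integral>\<^sup>+\<tau>. (\<integral>\<^sup>+x. indicator {0..t} \<tau> * esq (g \<tau> \<omega> x) \<partial>m) \<partial>lborel)"
      by simp
  qed
  also have "\<dots> = field_sq t g"
    unfolding field_sq_def
    by (intro nn_integral_cong) (auto split: split_indicator)
  finally show ?thesis ..
qed

lemma field_sq_add3:
  assumes [measurable]: "(\<lambda>(t, \<omega>, x). f t \<omega> x) \<in> borel_measurable (borel \<Otimes>\<^sub>M P \<Otimes>\<^sub>M m)"
    "(\<lambda>(t, \<omega>, x). g t \<omega> x) \<in> borel_measurable (borel \<Otimes>\<^sub>M P \<Otimes>\<^sub>M m)"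
    "(\<lambda>(t, \<omega>, x). h t \<omega> x) \<in> borel_measurable (borel \<Otimes>\<^sub>M P \<Otimes>\<^sub>M m)"
  shows "field_sq t (\<lambda>\<tau> \<omega> x. f \<tau> \<omega> x + g \<tau> \<omega> x + h \<tau> \<omega> x) \<le> 3 * (field_sq t f + field_sq t g + field_sq t h)"
proof -
  note [measurable] = assms[unfolded case_prod_beta']
  let ?R = "P \<Otimes>\<^sub>M lborel \<Otimes>\<^sub>M m"
  let ?q = "\<lambda>f. \<lambda>(\<omega>, \<tau>, x). indicator {0..t} \<tau> * esq (f \<tau> \<omega> x)"
  have "field_sq t (\<lambda>\<tau> \<omega> x. f \<tau> \<omega> x + g \<tau> \<omega> x + h \<tau> \<omega> x) =
      (\<integral>\<^sup>+z. ?q (\<lambda>\<tau> \<omega> x. f \<tau> \<omega> x + g \<tau> \<omega> x + h \<tau> \<omega> x) z \<partial>?R)"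
    by (rule field_sq_eq) measurable
  also have "\<dots> \<le> (\<integral>\<^sup>+z. 3 * (?q f z + ?q g z + ?q h z) \<partial>?R)"
    by (intro nn_integral_mono) (auto split: split_indicator simp del: distrib_left_numeral intro: ennreal_norm_add3_sq)
  also have "\<dots> = 3 * ((\<integral>\<^sup>+z. ?q f z \<partial>?R) + (\<integral>\<^sup>+z. ?q g z \<partial>?R) + (\<integral>\<^sup>+z. ?q h z \<partial>?R))"
    using measurable_field_sq[OF assms(1), of t] measurable_field_sq[OF assms(2), of t]
      measurable_field_sq[OF assms(3), of t]
    by (simp add: nn_integral_cmult nn_integral_add del: distrib_left_numeral)
  also have "\<dots> = 3 * (field_sq t f + field_sq t g + field_sq t h)"
    by (simp add: field_sq_eq assms)
  finally show ?thesis .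
qed

text \<open>The difference of the limits is compared with the difference of the simple integrals
  (three terms, factor 3); the isometry converts the latter into a difference of simple integrands,
  which is compared with \<open>g - g'\<close> (again three terms, factor 3). Hence 9 in place of
  the sharp constant 1. Any approximating sequences will do, so no uniqueness of the stochastic
  integral enters.\<close>

lemma stochastic_integral_diff_le:
  fixes L L' :: "nat \<Rightarrow> (real \<times> real \<times> 'a \<times> ('w \<Rightarrow> 'v::euclidean_space)) list"
  assumes L: "\<And>n. simple (L n)" and L': "\<And>n. simple (L' n)" and t: "0 \<le> t" "t \<le> T"
    and [measurable]: "I \<in> borel_measurable P" "I' \<in> borel_measurable P"
    and g [measurable]: "(\<lambda>(t, \<omega>, x). g t \<omega> x) \<in> borel_measurable (borel \<Otimes>\<^sub>M P \<Otimes>\<^sub>M m)"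
    and g' [measurable]: "(\<lambda>(t, \<omega>, x). g' t \<omega> x) \<in> borel_measurable (borel \<Otimes>\<^sub>M P \<Otimes>\<^sub>M m)"
    and lim: "(\<lambda>n. field_sq T (\<lambda>\<tau> \<omega> x. simple_field (L n) \<tau> \<omega> x - g \<tau> \<omega> x)) \<longlonglongrightarrow> 0"
    and lim': "(\<lambda>n. field_sq T (\<lambda>\<tau> \<omega> x. simple_field (L' n) \<tau> \<omega> x - g' \<tau> \<omega> x)) \<longlonglongrightarrow> 0"
    and I: "(\<lambda>n. \<integral>\<^sup>+\<omega>. esq (simple_integral (L n) t \<omega> - I \<omega>) \<partial>P) \<longlonglongrightarrow> 0"
    and I': "(\<lambda>n. \<integral>\<^sup>+\<omega>. esq (simple_integral (L' n) t \<omega> - I' \<omega>) \<partial>P) \<longlonglongrightarrow> 0"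
  shows "(\<integral>\<^sup>+\<omega>. esq (I \<omega> - I' \<omega>) \<partial>P) \<le> 9 * field_sq t (\<lambda>\<tau> \<omega> x. g \<tau> \<omega> x - g' \<tau> \<omega> x)"
proof -
  let ?e = "\<lambda>n. \<integral>\<^sup>+\<omega>. esq (simple_integral (L n) t \<omega> - I \<omega>) \<partial>P"
  let ?e' = "\<lambda>n. \<integral>\<^sup>+\<omega>. esq (simple_integral (L' n) t \<omega> - I' \<omega>) \<partial>P"
  let ?d = "\<lambda>n. field_sq T (\<lambda>\<tau> \<omega> x. simple_field (L n) \<tau> \<omega> x - g \<tau> \<omega> x)"
  let ?d' = "\<lambda>n. field_sq T (\<lambda>\<tau> \<omega> x. simple_field (L' n) \<tau> \<omega> x - g' \<tau> \<omega> x)"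
  let ?g = "field_sq t (\<lambda>\<tau> \<omega> x. g \<tau> \<omega> x - g' \<tau> \<omega> x)"
  note [measurable] = measurable_simple_integral[OF L t(1)] measurable_simple_integral[OF L' t(1)]
    measurable_simple_field[OF L, unfolded case_prod_beta'] measurable_simple_field[OF L', unfolded case_prod_beta']
    g[unfolded case_prod_beta'] g'[unfolded case_prod_beta']
  have bound: "(\<integral>\<^sup>+\<omega>. esq (I \<omega> - I' \<omega>) \<partial>P) \<le> 3 * (?e n + 3 * (?d n + ?g + ?d' n) + ?e' n)" for n
  proof -
    have iso: "(\<integral>\<^sup>+\<omega>. esq (simple_integral (L n) t \<omega> - simple_integral (L' n) t \<omega>) \<partial>P) =
        field_sq t (\<lambda>\<tau> \<omega> x. simple_field (L n) \<tau> \<omega> x - simple_field (L' n) \<tau> \<omega> x)"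
      using simple_isometry[OF simple_append_uminus(1)[OF L L'] t(1), of n n]
      by (simp add: simple_append_uminus(2,3) field_sq_def)
    have "field_sq t (\<lambda>\<tau> \<omega> x. simple_field (L n) \<tau> \<omega> x - simple_field (L' n) \<tau> \<omega> x) =
        field_sq t (\<lambda>\<tau> \<omega> x. (simple_field (L n) \<tau> \<omega> x - g \<tau> \<omega> x) + (g \<tau> \<omega> x - g' \<tau> \<omega> x)
          + (g' \<tau> \<omega> x - simple_field (L' n) \<tau> \<omega> x))"
      by simp
    also have "\<dots> \<le> 3 * (field_sq t (\<lambda>\<tau> \<omega> x. simple_field (L n) \<tau> \<omega> x - g \<tau> \<omega> x) + ?g +
        field_sq t (\<lambda>\<tau> \<omega> x. g' \<tau> \<omega> x - simple_field (L' n) \<tau> \<omega> x))"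
      by (rule field_sq_add3) measurable
    also have "\<dots> \<le> 3 * (?d n + ?g + ?d' n)"
      using t(2) by (subst field_sq_diff_commute[of t g']) (intro mult_left_mono add_mono field_sq_mono order_refl; simp)
    finally have mid: "field_sq t (\<lambda>\<tau> \<omega> x. simple_field (L n) \<tau> \<omega> x - simple_field (L' n) \<tau> \<omega> x) \<le> 3 * (?d n + ?g + ?d' n)" .
    have "(\<integral>\<^sup>+\<omega>. esq (I \<omega> - I' \<omega>) \<partial>P) \<le>
        (\<integral>\<^sup>+\<omega>. 3 * (esq (simple_integral (L n) t \<omega> - I \<omega>)
          + esq (simple_integral (L n) t \<omega> - simple_integral (L' n) t \<omega>)
          + esq (simple_integral (L' n) t \<omega> - I' \<omega>)) \<partial>P)"
    proof (rule nn_integral_mono)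
      fix \<omega>
      show "esq (I \<omega> - I' \<omega>) \<le> 3 * (esq (simple_integral (L n) t \<omega> - I \<omega>)
          + esq (simple_integral (L n) t \<omega> - simple_integral (L' n) t \<omega>)
          + esq (simple_integral (L' n) t \<omega> - I' \<omega>))"
        using ennreal_norm_add3_sq[of "I \<omega> - simple_integral (L n) t \<omega>"
            "simple_integral (L n) t \<omega> - simple_integral (L' n) t \<omega>" "simple_integral (L' n) t \<omega> - I' \<omega>"]
        by (simp add: norm_minus_commute[of "I \<omega>"])
    qed
    also have "\<dots> = 3 * (?e n + field_sq t (\<lambda>\<tau> \<omega> x. simple_field (L n) \<tau> \<omega> x - simple_field (L' n) \<tau> \<omega> x) + ?e' n)"
      by (simp add: nn_integral_cmult nn_integral_add iso)
    also have "\<dots> \<le> 3 * (?e n + 3 * (?d n + ?g + ?d' n) + ?e' n)"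
      by (intro mult_left_mono add_mono mid order_refl) simp
    finally show ?thesis .
  qed
  have "(\<lambda>n. 3 * (?e n + 3 * (?d n + ?g + ?d' n) + ?e' n)) \<longlonglongrightarrow> 3 * (0 + 3 * (0 + ?g + 0) + 0)"
    by (intro ennreal_tendsto_cmult tendsto_add tendsto_const lim lim' I I') auto
  then have "(\<integral>\<^sup>+\<omega>. esq (I \<omega> - I' \<omega>) \<partial>P) \<le> 3 * (0 + 3 * (0 + ?g + 0) + 0)"
    by (rule LIMSEQ_le_const) (use bound in auto)
  also have "\<dots> = 9 * ?g"
    by (simp add: mult.assoc[symmetric])
  finally show ?thesis .
qed

end

section \<open>Ito integrals\<close>

lemma complete_filtered_prob_spaceD:
  assumes "complete_filtered_prob_space P F"
  shows "prob_space P" and "0 \<le> t \<Longrightarrow> subalgebra P (F t)"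
    and "0 \<le> s \<Longrightarrow> s \<le> t \<Longrightarrow> sets (F s) \<subseteq> sets (F t)"
proof -
  show "prob_space P" "0 \<le> t \<Longrightarrow> subalgebra P (F t)"
    using assms by (auto simp: complete_filtered_prob_space_def)
  have "filtration (space P) (\<lambda>t. F (max 0 t))"
    using assms by (auto simp: complete_filtered_prob_space_def)
  from filtration.sets_F_mono[OF this, of s t]
  show "0 \<le> s \<Longrightarrow> s \<le> t \<Longrightarrow> sets (F s) \<subseteq> sets (F t)" by simp
qed

lemma measurable_vec_nth: "(\<lambda>x :: real^'d. x $ b) \<in> borel_measurable borel"
  by (intro borel_measurable_continuous_onI continuous_intros)

lemma brownian_increment_moments:
  assumes P: "prob_space P" and B: "brownian_motion P F B" and t: "0 \<le> s" "s \<le> t"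
  shows "integrable P (\<lambda>\<omega>. (B t \<omega> - B s \<omega>) $ i)"
    and "integrable P (\<lambda>\<omega>. ((B t \<omega> - B s \<omega>) $ i)\<^sup>2)"
    and "(\<integral>\<omega>. (B t \<omega> - B s \<omega>) $ i \<partial>P) = 0"
    and "(\<integral>\<omega>. (B t \<omega> - B s \<omega>) $ i * (B t \<omega> - B s \<omega>) $ j \<partial>P) = (if i = j then t - s else 0)"
proof -
  interpret prob_space P by (rule P)
  have "integrable P (\<lambda>\<omega>. (B t \<omega> - B s \<omega>) $ i) \<and> integrable P (\<lambda>\<omega>. ((B t \<omega> - B s \<omega>) $ i)\<^sup>2) \<and>
    (\<integral>\<omega>. (B t \<omega> - B s \<omega>) $ i \<partial>P) = 0 \<and>
    (\<integral>\<omega>. (B t \<omega> - B s \<omega>) $ i * (B t \<omega> - B s \<omega>) $ j \<partial>P) = (if i = j then t - s else 0)"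
  \<comment> \<open>The law of an increment is prescribed for s < t only; for equal times every
    quantity is zero.\<close>
  proof (cases "s = t")
    case True
    then show ?thesis by simp
  next
    case False
    then have st: "s < t" using t by simp
    let ?X = "\<lambda>i \<omega>. (B t \<omega> - B s \<omega>) $ i"
    have D: "distributed P lborel (?X i) (normal_density 0 (sqrt (t - s)))" for i
      using B st t unfolding brownian_motion_def by blast
    have ind: "indep_vars (\<lambda>_. borel) ?X UNIV"
      using B st t unfolding brownian_motion_def by blast
    have sd: "0 < sqrt (t - s)" using st by simp
    have i1: "integrable P (?X i)" for i
      using distributed_integrable[OF D[of i], of "\<lambda>x. x"] integrable_normal_moment[OF sd, of 0 1] by simp
    have i2: "integrable P (\<lambda>\<omega>. (?X i \<omega>)\<^sup>2)" for i
      using distributed_integrable[OF D[of i], of "\<lambda>x. x\<^sup>2"] integrable_normal_moment[OF sd, of 0 2] by simp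
    have m1: "expectation (?X i) = 0" for i
      by (rule normal_distributed_expectation[OF sd D])
    have m2: "expectation (\<lambda>\<omega>. (?X i \<omega>)\<^sup>2) = t - s" for i
      using normal_distributed_variance[OF sd D[of i]] st m1[of i] by simp
    have "expectation (\<lambda>\<omega>. ?X i \<omega> * ?X j \<omega>) = (if i = j then t - s else 0)"
    proof (cases "i = j")
      case True
      then show ?thesis using m2[of j] by (simp add: power2_eq_square)
    next
      case False
      have "indep_vars (\<lambda>_. borel) ?X {i, j}"
        by (rule indep_vars_subset[OF ind]) simp
      from indep_vars_lebesgue_integral[OF _ this] i1
      have "expectation (\<lambda>\<omega>. \<Prod>k\<in>{i, j}. ?X k \<omega>) = (\<Prod>k\<in>{i, j}. expectation (?X k))"
        by simp
      then show ?thesis using False m1[of i] m1[of j] by simp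
    qed
    then show ?thesis using i1 i2 m1 by blast
  qed
  then show "integrable P (\<lambda>\<omega>. (B t \<omega> - B s \<omega>) $ i)"
    and "integrable P (\<lambda>\<omega>. ((B t \<omega> - B s \<omega>) $ i)\<^sup>2)"
    and "(\<integral>\<omega>. (B t \<omega> - B s \<omega>) $ i \<partial>P) = 0"
    and "(\<integral>\<omega>. (B t \<omega> - B s \<omega>) $ i * (B t \<omega> - B s \<omega>) $ j \<partial>P) = (if i = j then t - s else 0)"
    by blast+
qed

text \<open>With singletons as sets of marks, the covariance requirement says that distinct
  coordinates of an increment are orthogonal and that each has variance s - r. Independence of the
  increment from \<open>F r\<close> lets the multiplier \<open>\<xi>\<close> factor out.\<close>

lemma white_noise_brownian:
  fixes B :: "real \<Rightarrow> 'w \<Rightarrow> real^'d"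
  assumes cf: "complete_filtered_prob_space P F" and B: "brownian_motion P F B"
  shows "white_noise P F (count_space UNIV) UNIV (\<lambda>b. {b}) (\<lambda>b r s \<omega>. (B s \<omega> - B r \<omega>) $ b)"
proof -
  interpret prob_space P by (rule complete_filtered_prob_spaceD(1)[OF cf])
  note sub = complete_filtered_prob_spaceD(2)[OF cf] and mono = complete_filtered_prob_spaceD(3)[OF cf]
  note mom = brownian_increment_moments[OF prob_space_axioms B]
  have Bm: "B r \<in> borel_measurable (F s)" if "0 \<le> r" "r \<le> s" for r s
  proof (rule measurable_from_subalg)
    show "subalgebra (F s) (F r)"
      using mono[OF that] sub[of r] sub[of s] that by (auto simp: subalgebra_def)
    show "B r \<in> borel_measurable (F r)" using B that by (auto simp: brownian_motion_def)
  qed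
  have BP: "B r \<in> borel_measurable P" if "0 \<le> r" for r
    using measurable_from_subalg[OF sub Bm] that by auto
  have ind: "(\<integral>\<omega>. \<xi> \<omega> * f (B s \<omega> - B r \<omega>) \<partial>P) = (\<integral>\<omega>. \<xi> \<omega> \<partial>P) * (\<integral>\<omega>. f (B s \<omega> - B r \<omega>) \<partial>P)"
    if t: "0 \<le> r" "r \<le> s" and \<xi>: "\<xi> \<in> borel_measurable (F r)" "integrable P \<xi>"
      and f: "f \<in> borel_measurable borel" "integrable P (\<lambda>\<omega>. f (B s \<omega> - B r \<omega>))"
    for r s \<xi> and f :: "real^'d \<Rightarrow> real"
  proof (cases "r = s")
    case True
    then show ?thesis by (simp add: prob_space)
  next
    case False
    \<comment> \<open>The sigma-algebra generated by the increment: its sets are exactly the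
      preimages named in \<open>brownian_motion\<close>, so that \<open>integral_mult_indep\<close>
      becomes applicable.\<close>
    let ?V = "vimage_algebra (space P) (\<lambda>\<omega>. B s \<omega> - B r \<omega>) borel"
    have sV: "sets ?V = {(\<lambda>\<omega>. B s \<omega> - B r \<omega>) -` X \<inter> space P | X. X \<in> sets borel}"
      by (rule sets_vimage_algebra2) simp
    have mV: "(\<lambda>\<omega>. B s \<omega> - B r \<omega>) \<in> borel_measurable ?V"
      by (rule measurable_vimage_algebra1) simp
    have [measurable]: "B s \<in> borel_measurable P" "B r \<in> borel_measurable P"
      using BP t by auto
    show ?thesis
    proof (rule integral_mult_indep[OF sub[OF t(1)] _ _ \<xi>(1,2) _ f(2)])
      show "subalgebra P ?V"
        unfolding subalgebra_def sV by auto
      show "indep_set (sets (F r)) (sets ?V)"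
        unfolding sV using B t False unfolding brownian_motion_def by auto
      show "(\<lambda>\<omega>. f (B s \<omega> - B r \<omega>)) \<in> borel_measurable ?V"
        by (rule measurable_compose[OF mV f(1)])
    qed
  qed
  show ?thesis
  proof unfold_locales
    show "0 \<le> t \<Longrightarrow> subalgebra P (F t)" for t by (rule sub)
    show "0 \<le> s \<Longrightarrow> s \<le> t \<Longrightarrow> sets (F s) \<subseteq> sets (F t)" for s t by (rule mono)
    show "\<exists>A. countable A \<and> A \<subseteq> sets (count_space UNIV) \<and> \<Union> A = space (count_space (UNIV :: 'd set)) \<and>
        (\<forall>a\<in>A. emeasure (count_space UNIV) a \<noteq> \<infinity>)"
      by (intro exI[of _ "{UNIV}"]) auto
    show "{b} \<in> sets (count_space UNIV)" "emeasure (count_space UNIV) {b} < \<infinity>" for b :: 'd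
      by auto
    show "(\<lambda>\<omega>. (B s \<omega> - B r \<omega>) $ b) \<in> borel_measurable (F s)" if "0 \<le> r" "r \<le> s" for b r s
    proof -
      have [measurable]: "B r \<in> borel_measurable (F s)" "B s \<in> borel_measurable (F s)"
        using Bm that by auto
      from measurable_compose[OF _ measurable_vec_nth, of "\<lambda>\<omega>. B s \<omega> - B r \<omega>"]
      show ?thesis by simp
    qed
    show "integrable P (\<lambda>\<omega>. ((B s \<omega> - B r \<omega>) $ b)\<^sup>2)" if "0 \<le> r" "r \<le> s" for b r s
      by (rule mom(2)[OF that])
    show "AE \<omega> in P. (B t \<omega> - B r \<omega>) $ b = (B s \<omega> - B r \<omega>) $ b + (B t \<omega> - B s \<omega>) $ b" for b r s t
      by simp
    show "(\<integral>\<omega>. \<xi> \<omega> * (B s \<omega> - B r \<omega>) $ b \<partial>P) = 0"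
      if "0 \<le> r" "r \<le> s" "\<xi> \<in> borel_measurable (F r)" "integrable P \<xi>" for b r s \<xi>
      using ind[OF that, of "\<lambda>x. x $ b", OF measurable_vec_nth] mom(1,3)[OF that(1,2)] by simp
    show "(\<integral>\<omega>. \<xi> \<omega> * ((B s \<omega> - B r \<omega>) $ a * (B s \<omega> - B r \<omega>) $ b) \<partial>P) =
        (\<integral>\<omega>. \<xi> \<omega> \<partial>P) * ((s - r) * measure (count_space UNIV) ({a} \<inter> {b}))"
      if "0 \<le> r" "r \<le> s" "\<xi> \<in> borel_measurable (F r)" "integrable P \<xi>" for a b r s \<xi>
    proof -
      have [measurable]: "B s \<in> borel_measurable P" "B r \<in> borel_measurable P"
        using BP that by auto
      have "(\<lambda>\<omega>. (B s \<omega> - B r \<omega>) $ b) \<in> borel_measurable P" for b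
        by (rule measurable_compose[OF _ measurable_vec_nth]) simp
      then have "integrable P (\<lambda>\<omega>. (B s \<omega> - B r \<omega>) $ a * (B s \<omega> - B r \<omega>) $ b)"
        by (intro integrable_mult_of_squares mom(2)[OF that(1,2)])
      from ind[OF that, of "\<lambda>x. x $ a * x $ b", OF _ this] borel_measurable_times[OF measurable_vec_nth measurable_vec_nth] mom(4)[OF that(1,2), of a b]
      show ?thesis by (cases "a = b") (auto simp: measure_count_space)
    qed
  qed
qed

lemma norm_vec_sq: "(norm v)\<^sup>2 = (\<Sum>i\<in>UNIV. (norm (v $ i))\<^sup>2)"
  for v :: "'a::real_normed_vector^'k"
  unfolding norm_vec_def L2_set_def by (simp add: sum_nonneg)

text \<open>This reconciles the counting measure on the columns with the Frobenius norm in the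
  definition of the Ito integral.\<close>

lemma norm_matrix_columns: "(norm A)\<^sup>2 = (\<Sum>b\<in>UNIV. (norm (column b A))\<^sup>2)" for A :: "real^'d^'m"
proof -
  have "(\<Sum>b\<in>UNIV. (norm (column b A))\<^sup>2) = (\<Sum>b\<in>UNIV. \<Sum>i\<in>UNIV. (A $ i $ b)\<^sup>2)"
    unfolding norm_vec_sq[of "column b A" for b] by (simp add: column_def)
  also have "\<dots> = (\<Sum>i\<in>UNIV. \<Sum>b\<in>UNIV. (A $ i $ b)\<^sup>2)"
    by (rule sum.swap)
  also have "\<dots> = (norm A)\<^sup>2"
    unfolding norm_vec_sq[of A] norm_vec_sq[of "A $ i" for i] by simp
  finally show ?thesis by simp
qed

lemma measurable_column: "(column b :: real^'d^'m \<Rightarrow> _) \<in> borel_measurable borel"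
proof -
  have "continuous_on UNIV (column b :: real^'d^'m \<Rightarrow> _)"
    unfolding column_def by (intro continuous_intros)
  then show ?thesis
    by (rule borel_measurable_continuous_onI)
qed

text \<open>Congruence of \<open>nn_integral\<close> asks for no measurability. It can therefore
  carry an approximation statement from an integrand built with \<open>left_value\<close> to a
  jointly measurable one.\<close>

lemma nn_integral_AE_subst:
  fixes g h :: "real \<Rightarrow> 'w \<Rightarrow> 'v"
  assumes "\<And>\<omega>. \<omega> \<in> space P \<Longrightarrow> AE r in lborel. r \<in> A \<longrightarrow> g r \<omega> = h r \<omega>"
  shows "(\<integral>\<^sup>+\<omega>. (\<integral>\<^sup>+t\<in>A. \<Phi> t \<omega> (g t \<omega>) \<partial>lborel) \<partial>P) = (\<integral>\<^sup>+\<omega>. (\<integral>\<^sup>+t\<in>A. \<Phi> t \<omega> (h t \<omega>) \<partial>lborel) \<partial>P)"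
proof (rule nn_integral_cong, rule nn_integral_cong_AE)
  fix \<omega> assume "\<omega> \<in> space P"
  from assms[OF this]
  show "AE t in lborel. \<Phi> t \<omega> (g t \<omega>) * indicator A t = \<Phi> t \<omega> (h t \<omega>) * indicator A t"
    by eventually_elim (auto split: split_indicator)
qed

context
  fixes P :: "'w measure" and F :: "real \<Rightarrow> 'w measure" and B :: "real \<Rightarrow> 'w \<Rightarrow> real^'d"
  assumes cf: "complete_filtered_prob_space P F" and B: "brownian_motion P F B"
begin

interpretation white_noise P F "count_space UNIV" "UNIV :: 'd set" "\<lambda>b. {b}" "\<lambda>b r s \<omega>. (B s \<omega> - B r \<omega>) $ b"
  by (rule white_noise_brownian[OF cf B])

text \<open>The abstract noise has scalar increments and vector-valued coefficients. A matrix
  coefficient is therefore split into its columns, each integrated against its own Brownian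
  coordinate; the \<open>SOME\<close> merely fixes an enumeration of the coordinates.\<close>

definition columns_of :: "(real \<times> real \<times> ('w \<Rightarrow> real^'d^'m)) list \<Rightarrow> (real \<times> real \<times> 'd \<times> ('w \<Rightarrow> real^'m)) list" where
  "columns_of L = concat (map (\<lambda>(r, s, \<phi>). map (\<lambda>b. (r, s, b, \<lambda>\<omega>. column b (\<phi> \<omega>)))
     (SOME bs. set bs = UNIV \<and> distinct bs)) L)"

lemma coordinates_list: "set (SOME bs. set bs = (UNIV :: 'd set) \<and> distinct bs) = UNIV"
    "distinct (SOME bs. set bs = (UNIV :: 'd set) \<and> distinct bs)"
  using someI_ex[OF finite_distinct_list[of "UNIV :: 'd set"]] by auto

lemma simple_columns:
  assumes "simple_process P F T L"
  shows "simple (columns_of L)"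
  unfolding simple_def columns_of_def
proof (clarsimp simp: coordinates_list, goal_cases)
  case (1 r s \<phi> b)
  then have h: "0 \<le> r" "r \<le> s" "\<phi> \<in> borel_measurable (F r)" "bounded (\<phi> ` space P)"
    using assms by (auto simp: simple_process_def)
  have lin: "bounded_linear (column b :: real^'d^'m \<Rightarrow> _)"
    unfolding linear_conv_bounded_linear[symmetric] by (intro linearI) (auto simp: column_def vec_eq_iff)
  have "bounded (column b ` \<phi> ` space P)"
    using bounded_linear_image[OF h(4) lin] .
  then show ?case
    using h measurable_compose[OF h(3) measurable_column] by (simp add: image_image)
qed

lemma simple_field_columns:
  "simple_field (columns_of L) t \<omega> x = column x (simple_process_val L t \<omega>)"
proof (induction L)
  case Nil
  then show ?case by (simp add: simple_field_def columns_of_def simple_process_val_def column_def zero_vec_def)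
next
  case (Cons e L)
  obtain r s \<phi> where e: "e = (r, s, \<phi>)" by (cases e)
  have "simple_field (columns_of (e # L)) t \<omega> x =
      (\<Sum>b\<in>UNIV. (indicator {r<..s} t * indicator {b} x) *\<^sub>R column b (\<phi> \<omega>)) + simple_field (columns_of L) t \<omega> x"
    by (simp add: simple_field_def columns_of_def e comp_def sum_list_distinct_conv_sum_set coordinates_list)
  also have "(\<Sum>b\<in>UNIV. (indicator {r<..s} t * indicator {b} x) *\<^sub>R column b (\<phi> \<omega>)) =
      indicator {r<..s} t *\<^sub>R column x (\<phi> \<omega>)"
    by (subst sum.remove[of _ x]) auto
  also have "\<dots> + simple_field (columns_of L) t \<omega> x = column x (simple_process_val (e # L) t \<omega>)"
    unfolding Cons.IH by (simp add: simple_process_val_def e column_def vec_eq_iff)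
  finally show ?case .
qed

lemma simple_integral_columns:
  "simple_integral (columns_of L) t \<omega> = simple_ito B L t \<omega>"
proof (induction L)
  case Nil
  then show ?case unfolding simple_integral_def columns_of_def simple_ito_def by simp
next
  case (Cons e L)
  obtain r s \<phi> where e: "e = (r, s, \<phi>)" by (cases e)
  have "simple_integral (columns_of (e # L)) t \<omega> =
      (\<Sum>b\<in>UNIV. ((B (min s t) \<omega> - B (min r t) \<omega>) $ b) *\<^sub>R column b (\<phi> \<omega>)) + simple_integral (columns_of L) t \<omega>"
    unfolding simple_integral_def columns_of_def e
    by (simp add: comp_def sum_list_distinct_conv_sum_set coordinates_list)
  also have "\<dots> = simple_ito B (e # L) t \<omega>"
    unfolding Cons.IH by (simp add: simple_ito_def e matrix_mult_sum scalar_mult_eq_scaleR)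
  finally show ?case .
qed

lemma field_sq_columns:
  fixes g :: "real \<Rightarrow> 'w \<Rightarrow> real^'d^'m"
  shows
  "field_sq t (\<lambda>\<tau> \<omega> x. column x (g \<tau> \<omega>)) = (\<integral>\<^sup>+\<omega>. (\<integral>\<^sup>+\<tau>\<in>{0..t}. esq (g \<tau> \<omega>) \<partial>lborel) \<partial>P)"
  unfolding field_sq_def
  by (intro nn_integral_cong) (simp add: nn_integral_count_space_finite norm_matrix_columns sum_nonneg)

lemma column_diff: "column x (A - A') = column x A - column x A'" for A A' :: "real^'d^'m"
  by (simp add: column_def vec_eq_iff)

text \<open>The processes \<open>h\<close>, \<open>h'\<close> are jointly measurable substitutes for
  the integrands \<open>g\<close>, \<open>g'\<close>, which in the application contain left limits.
  The bound is stated for the substitutes, where Fubini is available.\<close>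

lemma ito_integral_diff_le:
  fixes g g' h h' :: "real \<Rightarrow> 'w \<Rightarrow> real^'d^'m"
  assumes I: "is_ito_integral P F T B g I" and I': "is_ito_integral P F T B g' I'" and t: "0 \<le> t" "t \<le> T"
    and h: "(\<lambda>(t, \<omega>). h t \<omega>) \<in> borel_measurable (borel \<Otimes>\<^sub>M P)"
    and h': "(\<lambda>(t, \<omega>). h' t \<omega>) \<in> borel_measurable (borel \<Otimes>\<^sub>M P)"
    and gh: "\<And>\<omega>. \<omega> \<in> space P \<Longrightarrow> AE r in lborel. r \<in> {0..T} \<longrightarrow> g r \<omega> = h r \<omega>"
    and gh': "\<And>\<omega>. \<omega> \<in> space P \<Longrightarrow> AE r in lborel. r \<in> {0..T} \<longrightarrow> g' r \<omega> = h' r \<omega>"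
  shows "(\<integral>\<^sup>+\<omega>. esq (I t \<omega> - I' t \<omega>) \<partial>P) \<le>
    9 * (\<integral>\<^sup>+\<omega>. (\<integral>\<^sup>+r\<in>{0..t}. esq (h r \<omega> - h' r \<omega>) \<partial>lborel) \<partial>P)"
proof -
  obtain L where L: "\<And>n. simple_process P F T (L n)"
      "(\<lambda>n. \<integral>\<^sup>+\<omega>. (\<integral>\<^sup>+t\<in>{0..T}. esq (simple_process_val (L n) t \<omega> - g t \<omega>) \<partial>lborel) \<partial>P) \<longlonglongrightarrow> 0"
      "\<forall>t\<in>{0..T}. (\<lambda>n. \<integral>\<^sup>+\<omega>. esq (simple_ito B (L n) t \<omega> - I t \<omega>) \<partial>P) \<longlonglongrightarrow> 0"
    using I unfolding is_ito_integral_def by blast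
  obtain L' where L': "\<And>n. simple_process P F T (L' n)"
      "(\<lambda>n. \<integral>\<^sup>+\<omega>. (\<integral>\<^sup>+t\<in>{0..T}. esq (simple_process_val (L' n) t \<omega> - g' t \<omega>) \<partial>lborel) \<partial>P) \<longlonglongrightarrow> 0"
      "\<forall>t\<in>{0..T}. (\<lambda>n. \<integral>\<^sup>+\<omega>. esq (simple_ito B (L' n) t \<omega> - I' t \<omega>) \<partial>P) \<longlonglongrightarrow> 0"
    using I' unfolding is_ito_integral_def by blast
  have meas: "(\<lambda>(t, \<omega>, x). column x (k t \<omega>)) \<in> borel_measurable (borel \<Otimes>\<^sub>M P \<Otimes>\<^sub>M count_space UNIV)"
    if k: "(\<lambda>(t, \<omega>). k t \<omega>) \<in> borel_measurable (borel \<Otimes>\<^sub>M P)" for k :: "real \<Rightarrow> 'w \<Rightarrow> real^'d^'m"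
  proof -
    \<comment> \<open>Here the column index is itself a variable of integration. Writing the column
      as a finite sum over fixed indices b reduces joint measurability to that of each fixed
      column.\<close>
    have eq: "(\<lambda>(t, \<omega>, x). column x (k t \<omega>)) =
        (\<lambda>z. \<Sum>b\<in>UNIV. indicator {b} (snd (snd z)) *\<^sub>R column b (k (fst z) (fst (snd z))))"
    proof
      fix z
      show "(case z of (t, \<omega>, x) \<Rightarrow> column x (k t \<omega>)) =
          (\<Sum>b\<in>UNIV. indicator {b} (snd (snd z)) *\<^sub>R column b (k (fst z) (fst (snd z))))"
        by (subst sum.remove[of _ "snd (snd z)"]) (auto simp: case_prod_beta)
    qed
    have "(\<lambda>z. k (fst z) (fst (snd z))) \<in> borel_measurable (borel \<Otimes>\<^sub>M P \<Otimes>\<^sub>M count_space (UNIV :: 'd set))"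
      using measurable_compose[of "\<lambda>z. (fst z, fst (snd z))" "borel \<Otimes>\<^sub>M P \<Otimes>\<^sub>M count_space (UNIV :: 'd set)", OF _ k] by simp
    from measurable_compose[OF this measurable_column]
    have [measurable]: "(\<lambda>z. column b (k (fst z) (fst (snd z)))) \<in> borel_measurable (borel \<Otimes>\<^sub>M P \<Otimes>\<^sub>M count_space (UNIV :: 'd set))" for b .
    show ?thesis unfolding eq by measurable
  qed
  have It: "I t \<in> borel_measurable P" and I't: "I' t \<in> borel_measurable P"
    using I I' t by (auto simp: is_ito_integral_def intro: measurable_F_P)
  have "(\<integral>\<^sup>+\<omega>. esq (I t \<omega> - I' t \<omega>) \<partial>P) \<le>
      9 * field_sq t (\<lambda>\<tau> \<omega> x. column x (h \<tau> \<omega>) - column x (h' \<tau> \<omega>))"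
  proof (rule stochastic_integral_diff_le[OF simple_columns[OF L(1)] simple_columns[OF L'(1)] t It I't meas[OF h] meas[OF h']])
    show "(\<lambda>n. field_sq T (\<lambda>\<tau> \<omega> x. simple_field (columns_of (L n)) \<tau> \<omega> x - column x (h \<tau> \<omega>))) \<longlonglongrightarrow> 0"
      unfolding simple_field_columns column_diff[symmetric] field_sq_columns
      using L(2) by (simp only: nn_integral_AE_subst[OF gh,
          where \<Phi>="\<lambda>t \<omega> y. esq (simple_process_val (L _) t \<omega> - y)"])
    show "(\<lambda>n. field_sq T (\<lambda>\<tau> \<omega> x. simple_field (columns_of (L' n)) \<tau> \<omega> x - column x (h' \<tau> \<omega>))) \<longlonglongrightarrow> 0"
      unfolding simple_field_columns column_diff[symmetric] field_sq_columns
      using L'(2) by (simp only: nn_integral_AE_subst[OF gh',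
          where \<Phi>="\<lambda>t \<omega> y. esq (simple_process_val (L' _) t \<omega> - y)"])
  qed (unfold simple_integral_columns, use L(3) L'(3) t in auto)
  then show ?thesis
    unfolding column_diff[symmetric] field_sq_columns .
qed

end

section \<open>Compensated Poisson integrals\<close>

text \<open>The integrand of the Levy condition is positive away from 0, so its superlevel sets at
  height 1/(n+1) exhaust the space; each has finite measure by Markov's inequality.\<close>

lemma levy_intensity_sigma_finite:
  assumes "levy_intensity (v :: 'e::euclidean_space measure)"
  shows "sigma_finite_measure v"
proof -
  have sets: "sets v = sets (restrict_space borel (- {0}))"
    and fin: "(\<integral>\<^sup>+x. ennreal ((norm x)\<^sup>2 / (1 + (norm x)\<^sup>2)) \<partial>v) < \<infinity>"
    using assms by (auto simp: levy_intensity_def)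
  have sp: "space v = - {0}"
    using sets_eq_imp_space_eq[OF sets] by simp
  let ?f = "\<lambda>x::'e. (norm x)\<^sup>2 / (1 + (norm x)\<^sup>2)"
  have [measurable]: "?f \<in> borel_measurable v"
    unfolding measurable_cong_sets[OF sets refl] by (intro measurable_restrict_space1) measurable
  define A where "A n = {x \<in> space v. inverse (real (Suc n)) \<le> ?f x}" for n
  have A [measurable]: "A n \<in> sets v" for n
    unfolding A_def by measurable
  show ?thesis
  proof
    show "\<exists>A. countable A \<and> A \<subseteq> sets v \<and> \<Union> A = space v \<and> (\<forall>a\<in>A. emeasure v a \<noteq> \<infinity>)"
    proof (intro exI[of _ "range A"] conjI ballI)
      show "\<Union> (range A) = space v"
      proof (intro equalityI subsetI)
        fix x assume x: "x \<in> space v"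
        then have "x \<noteq> 0" by (simp add: sp)
        then have "0 < ?f x" by (intro divide_pos_pos) (auto simp: add_pos_nonneg)
        then obtain n where "inverse (real (Suc n)) < ?f x" using reals_Archimedean by blast
        then show "x \<in> \<Union> (range A)" using x by (auto simp: A_def intro!: exI[of _ n])
      qed (auto simp: A_def)
      fix a assume "a \<in> range A"
      then obtain n where a: "a = A n" by auto
      have "ennreal (inverse (real (Suc n))) * emeasure v (A n) = (\<integral>\<^sup>+x. ennreal (inverse (real (Suc n))) * indicator (A n) x \<partial>v)"
        by (simp add: nn_integral_cmult_indicator)
      also have "\<dots> \<le> (\<integral>\<^sup>+x. ennreal (?f x) \<partial>v)"
        by (intro nn_integral_mono) (auto simp: A_def split: split_indicator intro!: ennreal_leI)
      finally have "ennreal (inverse (real (Suc n))) * emeasure v (A n) < \<infinity>" using fin by (rule le_less_trans)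
      then show "emeasure v a \<noteq> \<infinity>"
        unfolding a by (auto simp: ennreal_mult_less_top)
    qed (use A in auto)
  qed
qed

text \<open>The exponential series gives total mass 1. The identity
  \<open>real (Suc k) * p (Suc k) = \<mu> * p k\<close> then reduces the first moment to the mass
  and the second moment to the first.\<close>

lemma poisson_sums:
  fixes \<mu> :: real
  defines "p \<equiv> \<lambda>k. exp (- \<mu>) * \<mu> ^ k / fact k"
  shows "p sums 1" and "(\<lambda>k. real k * p k) sums \<mu>" and "(\<lambda>k. (real k)\<^sup>2 * p k) sums (\<mu>\<^sup>2 + \<mu>)"
proof -
  have "(\<lambda>k. \<mu> ^ k /\<^sub>R fact k) sums exp \<mu>" by (rule exp_converges)
  then have "(\<lambda>k. exp (- \<mu>) * (\<mu> ^ k /\<^sub>R fact k)) sums (exp (- \<mu>) * exp \<mu>)"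
    by (rule sums_mult)
  then show p: "p sums 1"
    by (simp add: p_def exp_minus divide_inverse mult_ac scaleR_conv_of_real)
  have step: "real (Suc k) * p (Suc k) = \<mu> * p k" for k
    by (simp add: p_def field_simps del: of_nat_Suc)
  have "(\<lambda>k. real (Suc k) * p (Suc k)) sums \<mu>"
    unfolding step using sums_mult[OF p, of \<mu>] by simp
  then show q: "(\<lambda>k. real k * p k) sums \<mu>"
    by (subst (asm) sums_Suc_iff) simp
  have "(real (Suc k))\<^sup>2 * p (Suc k) = \<mu> * (real k * p k + p k)" for k
  proof -
    have "(real (Suc k))\<^sup>2 * p (Suc k) = real (Suc k) * (real (Suc k) * p (Suc k))"
      by (simp add: power2_eq_square mult.assoc)
    also have "\<dots> = \<mu> * (real k * p k + p k)"
      unfolding step by (simp add: algebra_simps)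
    finally show ?thesis .
  qed
  then have "(\<lambda>k. (real (Suc k))\<^sup>2 * p (Suc k)) sums (\<mu> * (\<mu> + 1))"
    using sums_mult[OF sums_add[OF q p], of \<mu>] by simp
  then show "(\<lambda>k. (real k)\<^sup>2 * p k) sums (\<mu>\<^sup>2 + \<mu>)"
    by (subst (asm) sums_Suc_iff) (simp add: power2_eq_square algebra_simps)
qed

context
  fixes P :: "'w measure" and F :: "real \<Rightarrow> 'w measure"
    and v :: "'e::euclidean_space measure" and N :: "'w \<Rightarrow> (real \<times> 'e) measure"
  assumes cf: "complete_filtered_prob_space P F" and v: "levy_intensity v"
    and N: "poisson_random_measure P F v N"
begin

interpretation prob_space P by (rule complete_filtered_prob_spaceD(1)[OF cf])

abbreviation "\<nu> \<equiv> time_jump_measure v"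

lemma sets_N: "\<omega> \<in> space P \<Longrightarrow> sets (N \<omega>) = sets \<nu>"
  and measurable_N: "C \<in> sets \<nu> \<Longrightarrow> (\<lambda>\<omega>. emeasure (N \<omega>) C) \<in> borel_measurable P"
  and N_adapted: "0 \<le> t \<Longrightarrow> C \<in> sets \<nu> \<Longrightarrow> C \<subseteq> {0..t} \<times> UNIV \<Longrightarrow> (\<lambda>\<omega>. emeasure (N \<omega>) C) \<in> borel_measurable (F t)"
  and N_indep: "0 \<le> s \<Longrightarrow> indep_set (sets (F s)) (random_measure_events P v N ({s<..} \<times> UNIV))"
  using N unfolding poisson_random_measure_def by blast+

lemma N_pmf:
  assumes "C \<in> sets \<nu>" "emeasure \<nu> C < \<infinity>"
  shows "measure P {\<omega> \<in> space P. emeasure (N \<omega>) C = of_nat k} = exp (- measure \<nu> C) * measure \<nu> C ^ k / fact k"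
  using N assms unfolding poisson_random_measure_def by meson

lemma N_event: "C \<in> sets \<nu> \<Longrightarrow> {\<omega> \<in> space P. emeasure (N \<omega>) C = of_nat k} \<in> sets P"
  using measurable_N[of C] by measurable

text \<open>The Poisson weights sum to 1, so the events on which the count equals k exhaust the
  space up to a null set. This excludes infinite counts, which \<open>measure\<close> would report
  as 0.\<close>

lemma AE_N_nat:
  assumes C: "C \<in> sets \<nu>" "emeasure \<nu> C < \<infinity>"
  shows "AE \<omega> in P. \<exists>k::nat. emeasure (N \<omega>) C = of_nat k"
proof -
  let ?A = "\<lambda>k::nat. {\<omega> \<in> space P. emeasure (N \<omega>) C = of_nat k}"
  have "(\<lambda>k. measure P (?A k)) sums measure P (\<Union>k. ?A k)"
    by (rule finite_measure_UNION) (use N_event[OF C(1)] in \<open>auto simp: disjoint_family_on_def\<close>)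
  moreover have "(\<lambda>k. measure P (?A k)) sums 1"
    unfolding N_pmf[OF C] by (rule poisson_sums)
  ultimately have "measure P (\<Union>k. ?A k) = 1" by (rule sums_unique2)
  then have "AE \<omega> in P. \<omega> \<in> (\<Union>k. ?A k)"
    using N_event[OF C(1)] by (subst AE_in_set_eq_1) auto
  then show ?thesis by eventually_elim auto
qed

text \<open>The expectation is decomposed along the value of the count, which is almost surely a
  natural number; the two moments needed later are the cases of the identity and the square.\<close>

lemma nn_integral_N:
  assumes C: "C \<in> sets \<nu>" "emeasure \<nu> C < \<infinity>" and f: "\<And>k. 0 \<le> f (real k)"
    and s: "(\<lambda>k. f (real k) * (exp (- measure \<nu> C) * measure \<nu> C ^ k / fact k)) sums S"
  shows "(\<integral>\<^sup>+\<omega>. ennreal (f (measure (N \<omega>) C)) \<partial>P) = ennreal S"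
proof -
  let ?A = "\<lambda>k::nat. {\<omega> \<in> space P. emeasure (N \<omega>) C = of_nat k}"
  have "(\<integral>\<^sup>+\<omega>. ennreal (f (measure (N \<omega>) C)) \<partial>P) =
      (\<integral>\<^sup>+\<omega>. (\<Sum>k. ennreal (f (real k)) * indicator (?A k) \<omega>) \<partial>P)"
  proof (rule nn_integral_cong_AE)
    show "AE \<omega> in P. ennreal (f (measure (N \<omega>) C)) = (\<Sum>k. ennreal (f (real k)) * indicator (?A k) \<omega>)"
      using AE_N_nat[OF C] AE_space
    proof eventually_elim
      case (elim \<omega>)
      then obtain k :: nat where k: "emeasure (N \<omega>) C = of_nat k" by auto
      have "(\<Sum>k. ennreal (f (real k)) * indicator (?A k) \<omega>) = (\<Sum>j\<in>{k}. ennreal (f (real j)) * indicator (?A j) \<omega>)"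
        using elim k by (intro suminf_finite) auto
      moreover have "measure (N \<omega>) C = real k"
        using k by (simp add: measure_def)
      ultimately show ?case using elim k by simp
    qed
  qed
  also have "\<dots> = (\<Sum>k. \<integral>\<^sup>+\<omega>. ennreal (f (real k)) * indicator (?A k) \<omega> \<partial>P)"
    by (intro nn_integral_suminf borel_measurable_times_ennreal borel_measurable_indicator borel_measurable_const
        N_event[OF C(1)])
  also have "\<dots> = (\<Sum>k. ennreal (f (real k) * (exp (- measure \<nu> C) * measure \<nu> C ^ k / fact k)))"
  proof (rule suminf_cong)
    fix k
    have "(\<integral>\<^sup>+\<omega>. ennreal (f (real k)) * indicator (?A k) \<omega> \<partial>P) = ennreal (f (real k)) * emeasure P (?A k)"
      by (rule nn_integral_cmult_indicator[OF N_event[OF C(1)]])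
    also have "emeasure P (?A k) = ennreal (exp (- measure \<nu> C) * measure \<nu> C ^ k / fact k)"
      unfolding emeasure_eq_measure N_pmf[OF C] ..
    finally show "(\<integral>\<^sup>+\<omega>. ennreal (f (real k)) * indicator (?A k) \<omega> \<partial>P) =
        ennreal (f (real k) * (exp (- measure \<nu> C) * measure \<nu> C ^ k / fact k))"
      using f[of k] by (simp only: ennreal_mult')
  qed
  also have "\<dots> = ennreal S"
    using s f by (subst suminf_ennreal2) (auto simp: sums_iff)
  finally show ?thesis .
qed

lemma measurable_measure_N: "C \<in> sets \<nu> \<Longrightarrow> (\<lambda>\<omega>. measure (N \<omega>) C) \<in> borel_measurable P"
  unfolding measure_def using measurable_N by (intro measurable_compose[OF _ borel_measurable_enn2real]) auto

lemma N_moments: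
  assumes C: "C \<in> sets \<nu>" "emeasure \<nu> C < \<infinity>"
  shows "integrable P (\<lambda>\<omega>. measure (N \<omega>) C)" "expectation (\<lambda>\<omega>. measure (N \<omega>) C) = measure \<nu> C"
    "integrable P (\<lambda>\<omega>. (measure (N \<omega>) C)\<^sup>2)"
    "expectation (\<lambda>\<omega>. (measure (N \<omega>) C)\<^sup>2) = (measure \<nu> C)\<^sup>2 + measure \<nu> C"
proof -
  have m: "(\<lambda>\<omega>. measure (N \<omega>) C) \<in> borel_measurable P" by (rule measurable_measure_N[OF C(1)])
  have 1: "(\<integral>\<^sup>+\<omega>. ennreal (measure (N \<omega>) C) \<partial>P) = ennreal (measure \<nu> C)"
    by (rule nn_integral_N[OF C, of "\<lambda>x. x", OF _ poisson_sums(2)]) simp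
  have 2: "(\<integral>\<^sup>+\<omega>. ennreal ((measure (N \<omega>) C)\<^sup>2) \<partial>P) = ennreal ((measure \<nu> C)\<^sup>2 + measure \<nu> C)"
    by (rule nn_integral_N[OF C, of "\<lambda>x. x\<^sup>2", OF _ poisson_sums(3)]) simp
  have "has_bochner_integral P (\<lambda>\<omega>. measure (N \<omega>) C) (measure \<nu> C)"
    by (rule has_bochner_integral_nn_integral[OF m _ _ 1]) auto
  then show "integrable P (\<lambda>\<omega>. measure (N \<omega>) C)" "expectation (\<lambda>\<omega>. measure (N \<omega>) C) = measure \<nu> C"
    by (auto simp: has_bochner_integral_iff)
  have "has_bochner_integral P (\<lambda>\<omega>. (measure (N \<omega>) C)\<^sup>2) ((measure \<nu> C)\<^sup>2 + measure \<nu> C)"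
    by (rule has_bochner_integral_nn_integral[OF _ _ _ 2]) (use m in auto)
  then show "integrable P (\<lambda>\<omega>. (measure (N \<omega>) C)\<^sup>2)"
    "expectation (\<lambda>\<omega>. (measure (N \<omega>) C)\<^sup>2) = (measure \<nu> C)\<^sup>2 + measure \<nu> C"
    by (auto simp: has_bochner_integral_iff)
qed

text \<open>The compensated random measure. For a set of infinite intensity the default value of
  \<open>measure\<close> makes it meaningless, so moments and additivity are stated for finite
  intensity.\<close>

definition Nt :: "(real \<times> 'e) set \<Rightarrow> 'w \<Rightarrow> real" where
  "Nt C \<omega> = measure (N \<omega>) C - measure \<nu> C"

lemma measurable_Nt: "C \<in> sets \<nu> \<Longrightarrow> Nt C \<in> borel_measurable P"
  unfolding Nt_def using measurable_measure_N by simp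

lemma Nt_moments:
  assumes C: "C \<in> sets \<nu>" "emeasure \<nu> C < \<infinity>"
  shows "integrable P (Nt C)" "expectation (Nt C) = 0" "integrable P (\<lambda>\<omega>. (Nt C \<omega>)\<^sup>2)"
    "expectation (\<lambda>\<omega>. (Nt C \<omega>)\<^sup>2) = measure \<nu> C"
proof -
  note mom = N_moments[OF C]
  show "integrable P (Nt C)" "expectation (Nt C) = 0"
    using mom unfolding Nt_def by (simp_all add: prob_space)
  have eq: "(Nt C \<omega>)\<^sup>2 = (measure (N \<omega>) C)\<^sup>2 - 2 * measure \<nu> C * measure (N \<omega>) C + (measure \<nu> C)\<^sup>2" for \<omega>
    unfolding Nt_def by (simp add: power2_diff)
  show "integrable P (\<lambda>\<omega>. (Nt C \<omega>)\<^sup>2)" "expectation (\<lambda>\<omega>. (Nt C \<omega>)\<^sup>2) = measure \<nu> C"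
    unfolding eq using mom by (simp_all add: prob_space power2_eq_square)
qed

text \<open>The counts of the two parts are finite only almost surely, and \<open>measure\<close>
  adds up only for parts of finite measure. This is why \<open>white_noise\<close> asks for
  additivity of increments almost everywhere.\<close>

lemma Nt_Un:
  assumes U: "U \<in> sets \<nu>" "emeasure \<nu> U < \<infinity>" and W: "W \<in> sets \<nu>" "emeasure \<nu> W < \<infinity>" and d: "U \<inter> W = {}"
  shows "AE \<omega> in P. Nt (U \<union> W) \<omega> = Nt U \<omega> + Nt W \<omega>"
  using AE_N_nat[OF U] AE_N_nat[OF W] AE_space
proof eventually_elim
  case (elim \<omega>)
  then have "emeasure (N \<omega>) U \<noteq> \<infinity>" "emeasure (N \<omega>) W \<noteq> \<infinity>" by (auto simp: ennreal_of_nat_eq_real_of_nat)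
  then have "measure (N \<omega>) (U \<union> W) = measure (N \<omega>) U + measure (N \<omega>) W"
    using U W d sets_N[of \<omega>] elim by (intro measure_Union) auto
  moreover have "measure \<nu> (U \<union> W) = measure \<nu> U + measure \<nu> W"
    using U W d by (intro measure_Union) auto
  ultimately show ?case by (simp add: Nt_def)
qed

lemma emeasure_Un_finite:
  "U \<in> sets M \<Longrightarrow> emeasure M U < \<infinity> \<Longrightarrow> W \<in> sets M \<Longrightarrow> emeasure M W < \<infinity> \<Longrightarrow> emeasure M (U \<union> W) < \<infinity>"
  using emeasure_subadditive[of U M W] by (auto intro: le_less_trans)

text \<open>Comparing the variance over a disjoint union with the variances over its parts gives
  orthogonality.\<close>

lemma Nt_orthogonal:
  assumes U: "U \<in> sets \<nu>" "emeasure \<nu> U < \<infinity>" and W: "W \<in> sets \<nu>" "emeasure \<nu> W < \<infinity>" and d: "U \<inter> W = {}"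
  shows "expectation (\<lambda>\<omega>. Nt U \<omega> * Nt W \<omega>) = 0"
proof -
  have UW: "U \<union> W \<in> sets \<nu>" "emeasure \<nu> (U \<union> W) < \<infinity>"
    using U W emeasure_Un_finite by auto
  have m [measurable]: "Nt U \<in> borel_measurable P" "Nt W \<in> borel_measurable P" "Nt (U \<union> W) \<in> borel_measurable P"
    using measurable_Nt U W UW by auto
  have i: "integrable P (\<lambda>\<omega>. Nt U \<omega> * Nt W \<omega>)"
    using Nt_moments(3)[OF U] Nt_moments(3)[OF W] by (intro integrable_mult_of_squares) auto
  have "measure \<nu> (U \<union> W) = expectation (\<lambda>\<omega>. (Nt (U \<union> W) \<omega>)\<^sup>2)"
    using Nt_moments(4)[OF UW] by simp
  also have "\<dots> = expectation (\<lambda>\<omega>. (Nt U \<omega>)\<^sup>2 + (Nt W \<omega>)\<^sup>2 + 2 * (Nt U \<omega> * Nt W \<omega>))"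
  proof (rule integral_cong_AE)
    show "AE \<omega> in P. (Nt (U \<union> W) \<omega>)\<^sup>2 = (Nt U \<omega>)\<^sup>2 + (Nt W \<omega>)\<^sup>2 + 2 * (Nt U \<omega> * Nt W \<omega>)"
      using Nt_Un[OF U W d] by eventually_elim (simp add: power2_sum)
  qed simp_all
  also have "\<dots> = measure \<nu> U + measure \<nu> W + 2 * expectation (\<lambda>\<omega>. Nt U \<omega> * Nt W \<omega>)"
    using i Nt_moments[OF U] Nt_moments[OF W] by simp
  finally show ?thesis
    using measure_Union[of \<nu> U W] U W d by auto
qed

text \<open>Both sets are cut along their intersection. Of the four products that arise, three
  concern disjoint sets and have mean zero; the fourth is the variance over the
  intersection.\<close>

lemma Nt_covariance:
  assumes U: "U \<in> sets \<nu>" "emeasure \<nu> U < \<infinity>" and W: "W \<in> sets \<nu>" "emeasure \<nu> W < \<infinity>"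
  shows "expectation (\<lambda>\<omega>. Nt U \<omega> * Nt W \<omega>) = measure \<nu> (U \<inter> W)"
proof -
  let ?X = "U \<inter> W" and ?Y = "U - W" and ?Z = "W - U"
  have fin: "emeasure \<nu> A < \<infinity>" if "A \<subseteq> B" "B \<in> sets \<nu>" "emeasure \<nu> B < \<infinity>" for A B
    using emeasure_mono[OF that(1,2)] that(3) by (rule le_less_trans)
  have X: "?X \<in> sets \<nu>" "emeasure \<nu> ?X < \<infinity>" and Y: "?Y \<in> sets \<nu>" "emeasure \<nu> ?Y < \<infinity>"
    and Z: "?Z \<in> sets \<nu>" "emeasure \<nu> ?Z < \<infinity>"
    using U W fin[of ?X U] fin[of ?Y U] fin[of ?Z W] by auto
  note m [measurable] = measurable_Nt[OF X(1)] measurable_Nt[OF Y(1)] measurable_Nt[OF Z(1)]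
    measurable_Nt[OF U(1)] measurable_Nt[OF W(1)]
  note sq = Nt_moments(3)[OF X] Nt_moments(3)[OF Y] Nt_moments(3)[OF Z]
  have i: "integrable P (\<lambda>\<omega>. Nt ?X \<omega> * Nt ?Z \<omega>)" "integrable P (\<lambda>\<omega>. Nt ?Y \<omega> * Nt ?X \<omega>)"
      "integrable P (\<lambda>\<omega>. Nt ?Y \<omega> * Nt ?Z \<omega>)"
    using sq by (auto intro!: integrable_mult_of_squares m)
  have "expectation (\<lambda>\<omega>. Nt U \<omega> * Nt W \<omega>) =
      expectation (\<lambda>\<omega>. (Nt ?X \<omega>)\<^sup>2 + Nt ?X \<omega> * Nt ?Z \<omega> + Nt ?Y \<omega> * Nt ?X \<omega> + Nt ?Y \<omega> * Nt ?Z \<omega>)"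
  proof (rule integral_cong_AE)
    have "?X \<union> ?Y = U" "?X \<union> ?Z = W" by auto
    then have "AE \<omega> in P. Nt U \<omega> = Nt ?X \<omega> + Nt ?Y \<omega>" "AE \<omega> in P. Nt W \<omega> = Nt ?X \<omega> + Nt ?Z \<omega>"
      using Nt_Un[OF X Y] Nt_Un[OF X Z] by auto
    then show "AE \<omega> in P. Nt U \<omega> * Nt W \<omega> =
        (Nt ?X \<omega>)\<^sup>2 + Nt ?X \<omega> * Nt ?Z \<omega> + Nt ?Y \<omega> * Nt ?X \<omega> + Nt ?Y \<omega> * Nt ?Z \<omega>"
      by eventually_elim (simp add: power2_eq_square algebra_simps)
  qed simp_all
  also have "\<dots> = measure \<nu> ?X + 0 + 0 + 0"
  proof -
    have "?X \<inter> ?Z = {}" "?Y \<inter> ?X = {}" "?Y \<inter> ?Z = {}" by auto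
    then show ?thesis
      using i sq Nt_moments(4)[OF X] Nt_orthogonal[OF X Z] Nt_orthogonal[OF Y X] Nt_orthogonal[OF Y Z]
      by simp
  qed
  finally show ?thesis by simp
qed

lemma sigma_finite_v: "sigma_finite_measure v"
  by (rule levy_intensity_sigma_finite[OF v])

lemma strip_sets: "0 \<le> r \<Longrightarrow> A \<in> sets v \<Longrightarrow> {r<..s} \<times> A \<in> sets \<nu>"
  unfolding time_jump_measure_def
  by (intro pair_measureI) (auto simp: sets_restrict_space intro!: image_eqI[of _ _ "{r<..s}"])

lemma strip_measure:
  assumes "0 \<le> r" "r \<le> s" "A \<in> sets v"
  shows "emeasure \<nu> ({r<..s} \<times> A) = ennreal (s - r) * emeasure v A"
proof -
  interpret v: sigma_finite_measure v by (rule sigma_finite_v)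
  have sub: "{r<..s} \<subseteq> {0..}" using assms by auto
  have "{r<..s} \<in> sets (restrict_space lborel {0..})"
    using sub by (subst sets_restrict_space_iff) auto
  then show ?thesis
    unfolding time_jump_measure_def using assms sub
    by (simp add: v.emeasure_pair_measure_Times emeasure_restrict_space)
qed

lemma strip:
  assumes "0 \<le> r" "r \<le> s" "A \<in> sets v" "emeasure v A < \<infinity>"
  shows "{r<..s} \<times> A \<in> sets \<nu>" "emeasure \<nu> ({r<..s} \<times> A) < \<infinity>"
    "measure \<nu> ({r<..s} \<times> A) = (s - r) * measure v A"
  using strip_sets[OF assms(1,3)] strip_measure[OF assms(1-3)] assms
  by (auto simp: ennreal_mult_less_top measure_def enn2real_mult)

text \<open>Counts over sets after time s generate a sigma-algebra independent of
  \<open>F s\<close>. Allowing a function of two compensated counts covers the mean (one count) and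
  the covariance (a product) alike.\<close>

lemma Nt_indep:
  fixes \<xi> :: "'w \<Rightarrow> real" and f :: "real \<Rightarrow> real \<Rightarrow> real"
  assumes C: "C \<in> sets \<nu>" "C \<subseteq> {s<..} \<times> UNIV" and C': "C' \<in> sets \<nu>" "C' \<subseteq> {s<..} \<times> UNIV" and s: "0 \<le> s"
    and \<xi>: "\<xi> \<in> borel_measurable (F s)" "integrable P \<xi>"
    and f: "(\<lambda>(x, y). f x y) \<in> borel_measurable borel" "integrable P (\<lambda>\<omega>. f (Nt C \<omega>) (Nt C' \<omega>))"
  shows "expectation (\<lambda>\<omega>. \<xi> \<omega> * f (Nt C \<omega>) (Nt C' \<omega>)) = expectation \<xi> * expectation (\<lambda>\<omega>. f (Nt C \<omega>) (Nt C' \<omega>))"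
proof -
  define E where "E = {(\<lambda>\<omega>. emeasure (N \<omega>) A) -` X \<inter> space P | A X.
        A \<in> sets \<nu> \<and> A \<subseteq> {s<..} \<times> UNIV \<and> X \<in> sets (borel :: ennreal measure)}"
  have EP: "E \<subseteq> sets P"
    using measurable_N by (auto simp: E_def intro: measurable_sets)
  have Esub: "E \<subseteq> Pow (space P)" using EP sets.sets_into_space by blast
  let ?G = "sigma (space P) E"
  have sG: "sets ?G = random_measure_events P v N ({s<..} \<times> UNIV)"
    using Esub unfolding random_measure_events_def E_def by (simp add: sets_measure_of)
  have mG: "Nt D \<in> borel_measurable ?G" if D: "D \<in> sets \<nu>" "D \<subseteq> {s<..} \<times> UNIV" for D
  proof -
    have "(\<lambda>\<omega>. emeasure (N \<omega>) D) \<in> borel_measurable ?G"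
    proof (rule measurableI)
      fix X :: "ennreal set" assume "X \<in> sets borel"
      then have "(\<lambda>\<omega>. emeasure (N \<omega>) D) -` X \<inter> space P \<in> E"
        using D by (auto simp: E_def)
      then show "(\<lambda>\<omega>. emeasure (N \<omega>) D) -` X \<inter> space ?G \<in> sets ?G"
        using Esub by (auto simp: space_measure_of_conv)
    qed simp
    then show ?thesis
      unfolding Nt_def measure_def by (intro borel_measurable_diff measurable_compose[OF _ borel_measurable_enn2real]) auto
  qed
  show ?thesis
  proof (rule integral_mult_indep[OF complete_filtered_prob_spaceD(2)[OF cf s] _ _ \<xi> _ f(2)])
    show "indep_set (sets (F s)) (sets ?G)"
      unfolding sG by (rule N_indep[OF s])
    show "subalgebra P ?G"
      using EP Esub by (auto simp: subalgebra_def space_measure_of_conv sets.sigma_sets_subset sets_measure_of)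
    show "(\<lambda>\<omega>. f (Nt C \<omega>) (Nt C' \<omega>)) \<in> borel_measurable ?G"
      using measurable_compose[OF borel_measurable_Pair[OF mG[OF C] mG[OF C']] f(1)] by simp
  qed
qed

text \<open>Leaving out the left end r places the strip strictly after r, where its count is
  independent of \<open>F r\<close>; including the right end keeps it within
  \<open>{0..s} \<times> UNIV\<close>, where its count is known at time s. Consecutive strips are
  then disjoint and join up.\<close>

lemma white_noise_poisson:
  "white_noise P F v {A \<in> sets v. emeasure v A < \<infinity>} (\<lambda>A. A) (\<lambda>A r s. Nt ({r<..s} \<times> A))"
proof -
  note sub = complete_filtered_prob_spaceD(2)[OF cf] and mono = complete_filtered_prob_spaceD(3)[OF cf]
  show ?thesis
  proof (intro white_noise.intro white_noise_axioms.intro)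
    show "prob_space P" by (rule prob_space_axioms)
    show "0 \<le> t \<Longrightarrow> subalgebra P (F t)" for t by (rule sub)
    show "0 \<le> s \<Longrightarrow> s \<le> t \<Longrightarrow> sets (F s) \<subseteq> sets (F t)" for s t by (rule mono)
    show "sigma_finite_measure v" by (rule sigma_finite_v)
    fix A assume "A \<in> {A \<in> sets v. emeasure v A < \<infinity>}"
    then have A: "A \<in> sets v" "emeasure v A < \<infinity>" by auto
    show "A \<in> sets v" "emeasure v A < \<infinity>" by (fact A)+
    show "Nt ({r<..s} \<times> A) \<in> borel_measurable (F s)" if "0 \<le> r" "r \<le> s" for r s
      unfolding Nt_def measure_def using that strip(1)[OF that A]
      by (intro borel_measurable_diff measurable_compose[OF N_adapted borel_measurable_enn2real]) auto
    show "integrable P (\<lambda>\<omega>. (Nt ({r<..s} \<times> A) \<omega>)\<^sup>2)" if "0 \<le> r" "r \<le> s" for r s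
      by (rule Nt_moments(3)[OF strip(1,2)[OF that A]])
    show "AE \<omega> in P. Nt ({r<..t} \<times> A) \<omega> = Nt ({r<..s} \<times> A) \<omega> + Nt ({s<..t} \<times> A) \<omega>"
      if t: "0 \<le> r" "r \<le> s" "s \<le> t" for r s t
    proof -
      have "{r<..s} \<times> A \<union> {s<..t} \<times> A = {r<..t} \<times> A" using t by auto
      moreover have "{r<..s} \<times> A \<inter> {s<..t} \<times> A = {}" by auto
      ultimately show ?thesis
        using Nt_Un[OF strip(1,2)[OF t(1,2) A] strip(1,2)[OF _ t(3) A]] t by simp
    qed
    show "expectation (\<lambda>\<omega>. \<xi> \<omega> * Nt ({r<..s} \<times> A) \<omega>) = 0"
      if t: "0 \<le> r" "r \<le> s" and \<xi>: "\<xi> \<in> borel_measurable (F r)" "integrable P \<xi>" for r s \<xi>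
    proof -
      have "{r<..s} \<times> A \<subseteq> {r<..} \<times> UNIV" by auto
      then show ?thesis
        using Nt_indep[OF strip(1)[OF t A] _ strip(1)[OF t A] _ t(1) \<xi>, of "\<lambda>x y. x"]
          Nt_moments(1,2)[OF strip(1,2)[OF t A]] by (simp add: borel_prod[symmetric] case_prod_beta')
    qed
    fix B assume "B \<in> {A \<in> sets v. emeasure v A < \<infinity>}"
    then have B: "B \<in> sets v" "emeasure v B < \<infinity>" by auto
    show "expectation (\<lambda>\<omega>. \<xi> \<omega> * (Nt ({r<..s} \<times> A) \<omega> * Nt ({r<..s} \<times> B) \<omega>)) =
        expectation \<xi> * ((s - r) * measure v (A \<inter> B))"
      if t: "0 \<le> r" "r \<le> s" and \<xi>: "\<xi> \<in> borel_measurable (F r)" "integrable P \<xi>" for r s \<xi>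
    proof -
      note sA = strip[OF t A] and sB = strip[OF t B]
      have AB: "A \<inter> B \<in> sets v" "emeasure v (A \<inter> B) < \<infinity>"
        using A B emeasure_mono[of "A \<inter> B" A v] by (auto intro: le_less_trans)
      have i: "integrable P (\<lambda>\<omega>. Nt ({r<..s} \<times> A) \<omega> * Nt ({r<..s} \<times> B) \<omega>)"
        by (intro integrable_mult_of_squares measurable_Nt sA sB Nt_moments(3))
      have f: "(\<lambda>(x, y). x * y :: real) \<in> borel_measurable borel"
        unfolding borel_prod[symmetric] by measurable
      have "expectation (\<lambda>\<omega>. \<xi> \<omega> * (Nt ({r<..s} \<times> A) \<omega> * Nt ({r<..s} \<times> B) \<omega>)) =
          expectation \<xi> * expectation (\<lambda>\<omega>. Nt ({r<..s} \<times> A) \<omega> * Nt ({r<..s} \<times> B) \<omega>)"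
        by (rule Nt_indep[OF sA(1) _ sB(1) _ t(1) \<xi> f i]) auto
      also have "expectation (\<lambda>\<omega>. Nt ({r<..s} \<times> A) \<omega> * Nt ({r<..s} \<times> B) \<omega>) =
          measure \<nu> ({r<..s} \<times> (A \<inter> B))"
        unfolding Nt_covariance[OF sA(1,2) sB(1,2)] by (rule arg_cong[of _ _ "measure \<nu>"]) auto
      finally show ?thesis using strip(3)[OF t AB] by simp
    qed
  qed
qed

interpretation white_noise P F v "{A \<in> sets v. emeasure v A < \<infinity>}" "\<lambda>A. A" "\<lambda>A r s. Nt ({r<..s} \<times> A)"
  by (rule white_noise_poisson)

lemma simple_jump_simple: "simple_jump P F T c v L \<Longrightarrow> simple L"
  unfolding simple_jump_def simple_def by fastforce

lemma simple_field_jump: "simple_field L t \<omega> x = simple_jump_val L t \<omega> x"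
  unfolding simple_field_def simple_jump_val_def ..

lemma simple_integral_jump:
  assumes "simple_jump P F T c v L" "0 \<le> t"
  shows "simple_integral L t \<omega> = simple_jump_integral v N L t \<omega>"
proof -
  have "Nt ({min r t<..min s t} \<times> A) \<omega> =
      measure (N \<omega>) ({min r t<..min s t} \<times> A) - (min s t - min r t) * measure v A"
    if "(r, s, A, \<phi>) \<in> set L" for r s A \<phi>
  proof -
    have "0 \<le> r" "r \<le> s" "A \<in> sets v" "emeasure v A < \<infinity>"
      using that assms(1) by (auto simp: simple_jump_def)
    then show ?thesis
      using strip(3)[of "min r t" "min s t" A] assms(2) by (simp add: Nt_def)
  qed
  then show ?thesis
    unfolding simple_integral_def simple_jump_integral_def
    by (intro arg_cong[of _ _ sum_list] map_cong) auto
qed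

lemma simple_jump_val_support:
  assumes "simple_jump P F T c v L" "\<not> norm x < c"
  shows "simple_jump_val L t \<omega> x = 0"
proof -
  have "indicator A x = (0::real)" if "(r, s, A, \<phi>) \<in> set L" for r s A \<phi>
  proof -
    have "A \<subseteq> {x. norm x < c}" using assms(1) that by (auto simp: simple_jump_def)
    then show ?thesis using assms(2) by (auto split: split_indicator)
  qed
  then show ?thesis
    unfolding simple_jump_val_def
    by (subst map_cong[OF refl, of L _ "\<lambda>_. 0"]) auto
qed

text \<open>As for Ito integrals, \<open>h\<close> and \<open>h'\<close> are measurable substitutes
  for integrands with left limits. The additional point is that the definition integrates marks over
  a ball only, whereas the abstract noise integrates over all marks.\<close>

lemma jump_integral_diff_le:
  fixes g g' h h' :: "real \<Rightarrow> 'w \<Rightarrow> 'e \<Rightarrow> 'v::euclidean_space"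
  assumes J: "is_jump_integral P F T c v N g J" and J': "is_jump_integral P F T c v N g' J'"
    and t: "0 \<le> t" "t \<le> T"
    and h: "(\<lambda>(t, \<omega>, x). h t \<omega> x) \<in> borel_measurable (borel \<Otimes>\<^sub>M P \<Otimes>\<^sub>M v)"
    and h': "(\<lambda>(t, \<omega>, x). h' t \<omega> x) \<in> borel_measurable (borel \<Otimes>\<^sub>M P \<Otimes>\<^sub>M v)"
    and gh: "\<And>\<omega>. \<omega> \<in> space P \<Longrightarrow> AE r in lborel. r \<in> {0..T} \<longrightarrow> g r \<omega> = h r \<omega>"
    and gh': "\<And>\<omega>. \<omega> \<in> space P \<Longrightarrow> AE r in lborel. r \<in> {0..T} \<longrightarrow> g' r \<omega> = h' r \<omega>"
  shows "(\<integral>\<^sup>+\<omega>. esq (J t \<omega> - J' t \<omega>) \<partial>P) \<le>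
    9 * (\<integral>\<^sup>+\<omega>. (\<integral>\<^sup>+r\<in>{0..t}. (\<integral>\<^sup>+x\<in>{x. norm x < c}. esq (h r \<omega> x - h' r \<omega> x) \<partial>v) \<partial>lborel) \<partial>P)"
proof -
  \<comment> \<open>Extending integrands by zero beyond the ball turns integrals over the ball into
    integrals over all marks. Simple integrands already vanish there.\<close>
  define cut where "cut k r \<omega> x = indicator {x. norm x < c} x *\<^sub>R k r \<omega> x" for k :: "real \<Rightarrow> 'w \<Rightarrow> 'e \<Rightarrow> 'v" and r \<omega> x
  \<comment> \<open>The intensity lives on the space without the origin, so only the punctured ball
    belongs to its sigma-algebra.\<close>
  have ball: "{x \<in> space v. norm x < c} \<in> sets v"
  proof -
    have "sets v = sets (restrict_space borel (- {0}))" using v by (simp add: levy_intensity_def)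
    moreover from sets_eq_imp_space_eq[OF this]
    have "{x \<in> space v. norm x < c} = - {0} \<inter> {x. norm x < c}" by auto
    ultimately show ?thesis
      by (auto simp: sets_restrict_space intro!: image_eqI[of _ _ "{x. norm x < c}"])
  qed
  have meas: "(\<lambda>(t, \<omega>, x). cut k t \<omega> x) \<in> borel_measurable (borel \<Otimes>\<^sub>M P \<Otimes>\<^sub>M v)"
    if k: "(\<lambda>(t, \<omega>, x). k t \<omega> x) \<in> borel_measurable (borel \<Otimes>\<^sub>M P \<Otimes>\<^sub>M v)" for k
  proof -
    have "(\<lambda>x. indicator {x. norm x < c} x :: real) \<in> borel_measurable v"
      using ball by (subst borel_measurable_indicator_iff) (simp add: Int_def conj_commute)
    from measurable_compose[OF _ this, of "\<lambda>z. snd (snd z)" "borel \<Otimes>\<^sub>M P \<Otimes>\<^sub>M v"] k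
    show ?thesis
      unfolding cut_def case_prod_beta' by (intro borel_measurable_scaleR) auto
  qed
  obtain L where L: "\<And>n. simple_jump P F T c v (L n)"
      "(\<lambda>n. \<integral>\<^sup>+\<omega>. (\<integral>\<^sup>+t\<in>{0..T}. (\<integral>\<^sup>+x\<in>{x. norm x < c}.
             esq (simple_jump_val (L n) t \<omega> x - g t \<omega> x) \<partial>v) \<partial>lborel) \<partial>P) \<longlonglongrightarrow> 0"
      "\<forall>t\<in>{0..T}. (\<lambda>n. \<integral>\<^sup>+\<omega>. esq (simple_jump_integral v N (L n) t \<omega> - J t \<omega>) \<partial>P) \<longlonglongrightarrow> 0"
    using J unfolding is_jump_integral_def by blast
  obtain L' where L': "\<And>n. simple_jump P F T c v (L' n)"
      "(\<lambda>n. \<integral>\<^sup>+\<omega>. (\<integral>\<^sup>+t\<in>{0..T}. (\<integral>\<^sup>+x\<in>{x. norm x < c}.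
             esq (simple_jump_val (L' n) t \<omega> x - g' t \<omega> x) \<partial>v) \<partial>lborel) \<partial>P) \<longlonglongrightarrow> 0"
      "\<forall>t\<in>{0..T}. (\<lambda>n. \<integral>\<^sup>+\<omega>. esq (simple_jump_integral v N (L' n) t \<omega> - J' t \<omega>) \<partial>P) \<longlonglongrightarrow> 0"
    using J' unfolding is_jump_integral_def by blast
  have val: "field_sq T (\<lambda>\<tau> \<omega> x. simple_field K \<tau> \<omega> x - cut k \<tau> \<omega> x) =
      (\<integral>\<^sup>+\<omega>. (\<integral>\<^sup>+t\<in>{0..T}. (\<integral>\<^sup>+x\<in>{x. norm x < c}. esq (simple_jump_val K t \<omega> x - k t \<omega> x) \<partial>v) \<partial>lborel) \<partial>P)"
    if "simple_jump P F T c v K" for K k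
    unfolding field_sq_def simple_field_jump cut_def
    by (intro nn_integral_cong arg_cong2[of _ _ _ _ "(*)"] refl)
      (auto split: split_indicator simp: simple_jump_val_support[OF that])
  have Jt: "J t \<in> borel_measurable P" and J't: "J' t \<in> borel_measurable P"
    using J J' t by (auto simp: is_jump_integral_def intro: measurable_F_P)
  have "(\<integral>\<^sup>+\<omega>. esq (J t \<omega> - J' t \<omega>) \<partial>P) \<le> 9 * field_sq t (\<lambda>\<tau> \<omega> x. cut h \<tau> \<omega> x - cut h' \<tau> \<omega> x)"
  proof (rule stochastic_integral_diff_le[OF simple_jump_simple[OF L(1)] simple_jump_simple[OF L'(1)] t Jt J't meas[OF h] meas[OF h']])
    have "field_sq T (\<lambda>\<tau> \<omega> x. simple_field (L n) \<tau> \<omega> x - cut h \<tau> \<omega> x) =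
        (\<integral>\<^sup>+\<omega>. (\<integral>\<^sup>+t\<in>{0..T}. (\<integral>\<^sup>+x\<in>{x. norm x < c}.
          esq (simple_jump_val (L n) t \<omega> x - g t \<omega> x) \<partial>v) \<partial>lborel) \<partial>P)" for n
      unfolding val[OF L(1)] by (rule nn_integral_AE_subst[OF gh, symmetric])
    then show "(\<lambda>n. field_sq T (\<lambda>\<tau> \<omega> x. simple_field (L n) \<tau> \<omega> x - cut h \<tau> \<omega> x)) \<longlonglongrightarrow> 0"
      using L(2) by simp
    have "field_sq T (\<lambda>\<tau> \<omega> x. simple_field (L' n) \<tau> \<omega> x - cut h' \<tau> \<omega> x) =
        (\<integral>\<^sup>+\<omega>. (\<integral>\<^sup>+t\<in>{0..T}. (\<integral>\<^sup>+x\<in>{x. norm x < c}.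
          esq (simple_jump_val (L' n) t \<omega> x - g' t \<omega> x) \<partial>v) \<partial>lborel) \<partial>P)" for n
      unfolding val[OF L'(1)] by (rule nn_integral_AE_subst[OF gh', symmetric])
    then show "(\<lambda>n. field_sq T (\<lambda>\<tau> \<omega> x. simple_field (L' n) \<tau> \<omega> x - cut h' \<tau> \<omega> x)) \<longlonglongrightarrow> 0"
      using L'(2) by simp
    show "(\<lambda>n. \<integral>\<^sup>+\<omega>. esq (simple_integral (L n) t \<omega> - J t \<omega>) \<partial>P) \<longlonglongrightarrow> 0"
      unfolding simple_integral_jump[OF L(1) t(1)] using L(3) t by auto
    show "(\<lambda>n. \<integral>\<^sup>+\<omega>. esq (simple_integral (L' n) t \<omega> - J' t \<omega>) \<partial>P) \<longlonglongrightarrow> 0"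
      unfolding simple_integral_jump[OF L'(1) t(1)] using L'(3) t by auto
  qed
  also have "field_sq t (\<lambda>\<tau> \<omega> x. cut h \<tau> \<omega> x - cut h' \<tau> \<omega> x) =
      (\<integral>\<^sup>+\<omega>. (\<integral>\<^sup>+r\<in>{0..t}. (\<integral>\<^sup>+x\<in>{x. norm x < c}. esq (h r \<omega> x - h' r \<omega> x) \<partial>v) \<partial>lborel) \<partial>P)"
    unfolding field_sq_def cut_def
    by (intro nn_integral_cong arg_cong2[of _ _ _ _ "(*)"] refl) (auto split: split_indicator)
  finally show ?thesis .
qed

end

section \<open>The price equation\<close>

text \<open>Values in \<open>ennreal\<close> allow these integrals to be compared before any is
  known to be finite; the order of integration is that of \<open>L2ad\<close>.\<close>

definition E_int :: "'w measure \<Rightarrow> real \<Rightarrow> (real \<Rightarrow> 'w \<Rightarrow> ennreal) \<Rightarrow> ennreal" where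
  "E_int P t q = (\<integral>\<^sup>+\<omega>. (\<integral>\<^sup>+r\<in>{0..t}. q r \<omega> \<partial>lborel) \<partial>P)"

lemma E_int_cong: "(\<And>r \<omega>. r \<in> {0..t} \<Longrightarrow> \<omega> \<in> space P \<Longrightarrow> q r \<omega> = q' r \<omega>) \<Longrightarrow> E_int P t q = E_int P t q'"
  unfolding E_int_def by (intro nn_integral_cong) (auto split: split_indicator)

lemma E_int_mono_AE:
  assumes "AE \<omega> in P. \<forall>r\<in>{0..t}. q r \<omega> \<le> q' r \<omega>"
  shows "E_int P t q \<le> E_int P t q'"
  unfolding E_int_def
proof (rule nn_integral_mono_AE)
  show "AE \<omega> in P. (\<integral>\<^sup>+r\<in>{0..t}. q r \<omega> \<partial>lborel) \<le> (\<integral>\<^sup>+r\<in>{0..t}. q' r \<omega> \<partial>lborel)"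
    using assms by eventually_elim (auto intro!: nn_integral_mono split: split_indicator)
qed

lemma E_int_mono: "(\<And>r \<omega>. r \<in> {0..t} \<Longrightarrow> \<omega> \<in> space P \<Longrightarrow> q r \<omega> \<le> q' r \<omega>) \<Longrightarrow> E_int P t q \<le> E_int P t q'"
  by (intro E_int_mono_AE AE_I2) auto

lemma E_int_mono_time: "s \<le> t \<Longrightarrow> E_int P s q \<le> E_int P t q"
  unfolding E_int_def by (intro nn_integral_mono) (auto split: split_indicator)

lemma measurable_time_integral:
  fixes q :: "real \<Rightarrow> 'w \<Rightarrow> ennreal"
  assumes "(\<lambda>(r, \<omega>). q r \<omega>) \<in> borel_measurable (borel \<Otimes>\<^sub>M P)"
  shows "(\<lambda>\<omega>. \<integral>\<^sup>+r\<in>{0..t}. q r \<omega> \<partial>lborel) \<in> borel_measurable P"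
    and "\<omega> \<in> space P \<Longrightarrow> (\<lambda>r. q r \<omega>) \<in> borel_measurable borel"
proof -
  have [measurable]: "(\<lambda>z. q (snd z) (fst z)) \<in> borel_measurable (P \<Otimes>\<^sub>M borel)"
    using measurable_compose[of "\<lambda>z. (snd z, fst z)" "P \<Otimes>\<^sub>M borel", OF _ assms] by simp
  have "(\<lambda>(\<omega>, r). q r \<omega> * indicator {0..t} r) \<in> borel_measurable (P \<Otimes>\<^sub>M lborel)"
    unfolding measurable_cong_sets[OF sets_pair_measure_cong[OF refl sets_lborel] refl] by measurable
  then show "(\<lambda>\<omega>. \<integral>\<^sup>+r\<in>{0..t}. q r \<omega> \<partial>lborel) \<in> borel_measurable P"
    by (rule sigma_finite_measure.borel_measurable_nn_integral[OF sigma_finite_lborel])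
  show "(\<lambda>r. q r \<omega>) \<in> borel_measurable borel" if "\<omega> \<in> space P"
    using measurable_compose[of "\<lambda>r. (r, \<omega>)" borel, OF _ assms] that by simp
qed

lemma E_int_add:
  assumes q: "(\<lambda>(r, \<omega>). q r \<omega>) \<in> borel_measurable (borel \<Otimes>\<^sub>M P)"
    and q': "(\<lambda>(r, \<omega>). q' r \<omega>) \<in> borel_measurable (borel \<Otimes>\<^sub>M P)"
  shows "E_int P t (\<lambda>r \<omega>. q r \<omega> + q' r \<omega>) = E_int P t q + E_int P t q'"
proof -
  have "(\<integral>\<^sup>+r\<in>{0..t}. (q r \<omega> + q' r \<omega>) \<partial>lborel) = (\<integral>\<^sup>+r\<in>{0..t}. q r \<omega> \<partial>lborel) + (\<integral>\<^sup>+r\<in>{0..t}. q' r \<omega> \<partial>lborel)"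
    if \<omega>: "\<omega> \<in> space P" for \<omega>
    using measurable_time_integral(2)[OF q \<omega>] measurable_time_integral(2)[OF q' \<omega>]
    by (simp add: distrib_right nn_integral_add)
  then have "E_int P t (\<lambda>r \<omega>. q r \<omega> + q' r \<omega>) =
      (\<integral>\<^sup>+\<omega>. (\<integral>\<^sup>+r\<in>{0..t}. q r \<omega> \<partial>lborel) + (\<integral>\<^sup>+r\<in>{0..t}. q' r \<omega> \<partial>lborel) \<partial>P)"
    unfolding E_int_def by (intro nn_integral_cong) auto
  also have "\<dots> = E_int P t q + E_int P t q'"
    unfolding E_int_def by (intro nn_integral_add measurable_time_integral q q')
  finally show ?thesis .
qed

lemma E_int_cmult:
  assumes q: "(\<lambda>(r, \<omega>). q r \<omega>) \<in> borel_measurable (borel \<Otimes>\<^sub>M P)"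
  shows "E_int P t (\<lambda>r \<omega>. C * q r \<omega>) = C * E_int P t q"
proof -
  have "(\<integral>\<^sup>+r\<in>{0..t}. (C * q r \<omega>) \<partial>lborel) = C * (\<integral>\<^sup>+r\<in>{0..t}. q r \<omega> \<partial>lborel)" if \<omega>: "\<omega> \<in> space P" for \<omega>
    using measurable_time_integral(2)[OF q \<omega>] by (simp add: mult.assoc nn_integral_cmult)
  then have "E_int P t (\<lambda>r \<omega>. C * q r \<omega>) = (\<integral>\<^sup>+\<omega>. C * (\<integral>\<^sup>+r\<in>{0..t}. q r \<omega> \<partial>lborel) \<partial>P)"
    unfolding E_int_def by (intro nn_integral_cong) auto
  also have "\<dots> = C * E_int P t q"
    unfolding E_int_def by (intro nn_integral_cmult measurable_time_integral q)
  finally show ?thesis .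
qed

text \<open>Processes are measurable in time on \<open>[0, T]\<close> only; freezing them outside by
  \<open>t \<mapsto> max 0 (min T t)\<close> gives versions that are measurable for all times.\<close>

lemma measurable_clamp: "0 \<le> T \<Longrightarrow> (\<lambda>t. max 0 (min T t)) \<in> borel \<rightarrow>\<^sub>M restrict_space borel {0..T::real}"
  by (intro measurable_restrict_space2) auto

lemma joint_measurable_clamp:
  assumes T: "0 \<le> T" and x: "(\<lambda>(t, \<omega>). x t \<omega>) \<in> borel_measurable (restrict_space borel {0..T::real} \<Otimes>\<^sub>M P)"
  shows "(\<lambda>(t, \<omega>). x (max 0 (min T t)) \<omega>) \<in> borel_measurable (borel \<Otimes>\<^sub>M P)"
proof -
  have "(\<lambda>z. (max 0 (min T (fst z)), snd z)) \<in> borel \<Otimes>\<^sub>M P \<rightarrow>\<^sub>M restrict_space borel {0..T} \<Otimes>\<^sub>M P"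
    by (intro measurable_Pair measurable_compose[OF measurable_fst measurable_clamp[OF T]]) auto
  from measurable_compose[OF this x] show ?thesis by (simp add: case_prod_beta')
qed

lemma coeff_joint_measurable:
  assumes h: "adapted_coeff P F T h" and T: "0 \<le> T"
    and x: "(\<lambda>(t, \<omega>). x t \<omega>) \<in> borel_measurable (restrict_space borel {0..T} \<Otimes>\<^sub>M P)"
    and s: "(\<lambda>(t, \<omega>). s t \<omega>) \<in> borel_measurable (restrict_space borel {0..T} \<Otimes>\<^sub>M P)"
  shows "(\<lambda>(t, \<omega>). h t \<omega> (x t \<omega>) (s t \<omega>)) \<in> borel_measurable (restrict_space borel {0..T} \<Otimes>\<^sub>M P)"
proof -
  have h': "(\<lambda>(t, \<omega>, x, s). h t \<omega> x s)
      \<in> borel_measurable (restrict_space borel {0..T} \<Otimes>\<^sub>M P \<Otimes>\<^sub>M borel \<Otimes>\<^sub>M borel)"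
    using h by (auto simp: adapted_coeff_def)
  have "(\<lambda>z. (fst z, snd z, x (fst z) (snd z), s (fst z) (snd z))) \<in>
      restrict_space borel {0..T} \<Otimes>\<^sub>M P \<rightarrow>\<^sub>M restrict_space borel {0..T} \<Otimes>\<^sub>M P \<Otimes>\<^sub>M borel \<Otimes>\<^sub>M borel"
    using x s by (intro measurable_Pair) (auto simp: case_prod_beta')
  from measurable_compose[OF this h'] show ?thesis by (simp add: case_prod_beta')
qed

lemma jump_coeff_joint_measurable:
  assumes h: "adapted_jump_coeff P F T v h" and T: "0 \<le> T"
    and x: "(\<lambda>(t, \<omega>). x t \<omega>) \<in> borel_measurable (restrict_space borel {0..T} \<Otimes>\<^sub>M P)"
    and s: "(\<lambda>(t, \<omega>). s t \<omega>) \<in> borel_measurable (restrict_space borel {0..T} \<Otimes>\<^sub>M P)"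
  defines "k \<equiv> \<lambda>t. max 0 (min T t)"
  shows "(\<lambda>(t, \<omega>, z). h (k t) \<omega> (x (k t) \<omega>) (s (k t) \<omega>) z) \<in> borel_measurable (borel \<Otimes>\<^sub>M P \<Otimes>\<^sub>M v)"
proof -
  have h': "(\<lambda>(t, \<omega>, x, s, z). h t \<omega> x s z)
      \<in> borel_measurable (restrict_space borel {0..T} \<Otimes>\<^sub>M P \<Otimes>\<^sub>M borel \<Otimes>\<^sub>M borel \<Otimes>\<^sub>M v)"
    using h by (auto simp: adapted_jump_coeff_def)
  have proj: "(\<lambda>z. (fst z, fst (snd z))) \<in> borel \<Otimes>\<^sub>M P \<Otimes>\<^sub>M v \<rightarrow>\<^sub>M borel \<Otimes>\<^sub>M P" by measurable
  have x': "(\<lambda>z. x (k (fst z)) (fst (snd z))) \<in> borel_measurable (borel \<Otimes>\<^sub>M P \<Otimes>\<^sub>M v)"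
    using measurable_compose[OF proj joint_measurable_clamp[OF T x]] by (simp add: k_def)
  have s': "(\<lambda>z. s (k (fst z)) (fst (snd z))) \<in> borel_measurable (borel \<Otimes>\<^sub>M P \<Otimes>\<^sub>M v)"
    using measurable_compose[OF proj joint_measurable_clamp[OF T s]] by (simp add: k_def)
  have "(\<lambda>z. (k (fst z), fst (snd z), x (k (fst z)) (fst (snd z)), s (k (fst z)) (fst (snd z)), snd (snd z))) \<in>
      borel \<Otimes>\<^sub>M P \<Otimes>\<^sub>M v \<rightarrow>\<^sub>M restrict_space borel {0..T} \<Otimes>\<^sub>M P \<Otimes>\<^sub>M borel \<Otimes>\<^sub>M borel \<Otimes>\<^sub>M v"
    using measurable_compose[OF measurable_fst measurable_clamp[OF T], of "P \<Otimes>\<^sub>M v"] x' s'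
    by (intro measurable_Pair) (auto simp: k_def)
  from measurable_compose[OF this h'] show ?thesis by (simp add: case_prod_beta')
qed

text \<open>The integrands differ at countably many times only, and a Bochner integral does not
  notice this whatever \<open>k\<close> is.\<close>

lemma set_integral_left_value:
  "(LBINT r:A. k r (left_value x r \<omega>) (left_value s r \<omega>)) = (LBINT r:A. k r (x r \<omega>) (s r \<omega>))"
  for k :: "real \<Rightarrow> 'a::euclidean_space \<Rightarrow> 'b::euclidean_space \<Rightarrow> 'c::euclidean_space"
  unfolding set_lebesgue_integral_def
  by (rule integral_discrete_difference[of
        "{t. left_value x t \<omega> \<noteq> x t \<omega>} \<union> {t. left_value s t \<omega> \<noteq> s t \<omega>}"])
    (auto simp: countable_left_value_neq)

lemma AE_left_value2:
  "AE r in lborel. r \<in> A \<longrightarrow> k r (left_value x r \<omega>) (left_value s r \<omega>) = k r (x r \<omega>) (s r \<omega>)"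
  using AE_left_value[of x \<omega>] AE_left_value[of s \<omega>] by eventually_elim simp

lemma set_integral_weighted_diff:
  fixes h h' :: "real \<Rightarrow> 'v::euclidean_space" and w :: "real \<Rightarrow> real"
  assumes [measurable]: "h \<in> borel_measurable borel" "h' \<in> borel_measurable borel" "w \<in> borel_measurable borel"
    and "(\<integral>\<^sup>+r\<in>{0..t}. esq (h r) \<partial>lborel) < \<infinity>" "(\<integral>\<^sup>+r\<in>{0..t}. esq (h' r) \<partial>lborel) < \<infinity>"
    and "(\<integral>\<^sup>+r\<in>{0..t}. ennreal ((w r)\<^sup>2) \<partial>lborel) < \<infinity>"
  shows "esq ((LBINT r:{0..t}. w r *\<^sub>R h r) - (LBINT r:{0..t}. w r *\<^sub>R h' r)) \<le>
    (\<integral>\<^sup>+r\<in>{0..t}. ennreal ((w r)\<^sup>2) \<partial>lborel) * (\<integral>\<^sup>+r\<in>{0..t}. esq (h r - h' r) \<partial>lborel)"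
proof -
  have m: "f \<in> borel_measurable (restrict_space lborel {0..t})" if "f \<in> borel_measurable borel" for f :: "real \<Rightarrow> 'b::topological_space"
    using that by (intro measurable_restrict_space1) simp
  show ?thesis
    using norm_weighted_integral_diff[of h "restrict_space lborel {0..t}" h' w] assms
    by (simp add: m nn_integral_restrict_space integral_restrict_space set_lebesgue_integral_def)
qed

definition kernel_sq :: "real \<Rightarrow> real \<Rightarrow> ennreal" where
  "kernel_sq \<alpha> T = (\<integral>\<^sup>+r\<in>{0..T}. ennreal ((r powr (\<alpha> - 1))\<^sup>2) \<partial>lborel)"

lemma kernel_sq_finite:
  assumes "1/2 < \<alpha>" "0 \<le> T"
  shows "kernel_sq \<alpha> T < \<infinity>"
proof -
  have eq: "(r powr (\<alpha> - 1))\<^sup>2 = r powr (2 * \<alpha> - 2)" for r :: real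
    by (simp add: power2_eq_square flip: powr_add)
  obtain I where "((\<lambda>r. r powr (2 * \<alpha> - 2)) has_integral I) {0..T}"
    using integrable_on_powr_from_0[of "2 * \<alpha> - 2" T] assms by (auto simp: integrable_on_def)
  from nn_integral_has_integral_lebesgue'[OF _ this]
  show ?thesis unfolding kernel_sq_def eq by simp
qed

text \<open>The reflection \<open>r \<mapsto> t - r\<close> moves the singularity from t to 0, after
  which the domain is contained in [0, T]. The bound is thus the same for all t.\<close>

lemma kernel_sq_le:
  assumes "t \<le> T"
  shows "(\<integral>\<^sup>+r\<in>{0..t}. ennreal (((t - r) powr (\<alpha> - 1))\<^sup>2) \<partial>lborel) \<le> kernel_sq \<alpha> T"
proof -
  have "(\<integral>\<^sup>+r\<in>{0..t}. ennreal (((t - r) powr (\<alpha> - 1))\<^sup>2) \<partial>lborel) =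
      (\<integral>\<^sup>+r. ennreal (((t - (t + (-1) * r)) powr (\<alpha> - 1))\<^sup>2) * indicator {0..t} (t + (-1) * r) \<partial>lborel)"
    by (subst nn_integral_real_affine[where c="-1" and t=t]) auto
  also have "\<dots> \<le> kernel_sq \<alpha> T"
    unfolding kernel_sq_def using assms by (intro nn_integral_mono) (auto split: split_indicator)
  finally show ?thesis .
qed

lemma ennreal_norm_add4_sq:
  fixes a b c d :: "'a::real_normed_vector"
  shows "esq (a + b + c + d) \<le>
    4 * (esq a + esq b + esq c + esq d)"
proof -
  have "(norm ((a + b) + (c + d)))\<^sup>2 \<le> 2 * ((norm (a + b))\<^sup>2 + (norm (c + d))\<^sup>2)"
    by (rule norm_add_sq)
  also have "\<dots> \<le> 2 * (2 * ((norm a)\<^sup>2 + (norm b)\<^sup>2) + 2 * ((norm c)\<^sup>2 + (norm d)\<^sup>2))"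
    by (intro mult_left_mono add_mono norm_add_sq) simp
  also have "\<dots> = 4 * ((norm a)\<^sup>2 + (norm b)\<^sup>2 + (norm c)\<^sup>2 + (norm d)\<^sup>2)"
    by simp
  finally have "(norm ((a + b) + (c + d)))\<^sup>2 \<le> 4 * ((norm a)\<^sup>2 + (norm b)\<^sup>2 + (norm c)\<^sup>2 + (norm d)\<^sup>2)" .
  then have "esq (a + b + c + d) \<le> ennreal (4 * ((norm a)\<^sup>2 + (norm b)\<^sup>2 + (norm c)\<^sup>2 + (norm d)\<^sup>2))"
    by (intro ennreal_leI) (simp add: add.assoc)
  also have "\<dots> = 4 * (esq a + esq b + esq c + esq d)"
    by (subst ennreal_mult) (auto simp del: distrib_left_numeral)
  finally show ?thesis .
qed

text \<open>The 4 comes from splitting the difference of two solutions into four terms. In the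
  bracket, 9 belongs to the stochastic integrals, \<open>T\<close> to the drift and the last summand
  to the fractional integral, both by Cauchy-Schwarz. The sum replaces the maximum of the
  three.\<close>

definition market_const :: "real \<Rightarrow> real \<Rightarrow> ennreal" where
  "market_const \<alpha> T = 4 * (9 + ennreal T + ennreal (\<alpha>\<^sup>2) * kernel_sq \<alpha> T)"

lemma market_const_finite: "1/2 < \<alpha> \<Longrightarrow> 0 \<le> T \<Longrightarrow> market_const \<alpha> T < \<infinity>"
  using kernel_sq_finite[of \<alpha> T] by (simp add: market_const_def ennreal_mult_less_top)

definition jump_norm_sq :: "real \<Rightarrow> 'e::euclidean_space measure \<Rightarrow> ('e \<Rightarrow> 'v::euclidean_space) \<Rightarrow> ennreal" where
  "jump_norm_sq c v g = (\<integral>\<^sup>+z\<in>{z. norm z < c}. esq (g z) \<partial>v)"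

lemma measurable_jump_norm_sq:
  fixes g :: "real \<Rightarrow> 'w \<Rightarrow> 'e::euclidean_space \<Rightarrow> 'v::euclidean_space"
  assumes v: "levy_intensity v" and g: "(\<lambda>(t, \<omega>, z). g t \<omega> z) \<in> borel_measurable (borel \<Otimes>\<^sub>M P \<Otimes>\<^sub>M v)"
  shows "(\<lambda>(t, \<omega>). jump_norm_sq c v (g t \<omega>)) \<in> borel_measurable (borel \<Otimes>\<^sub>M P)"
proof -
  have sets: "sets v = sets (restrict_space borel (- {0}))" using v by (simp add: levy_intensity_def)
  have i: "(\<lambda>x. indicator {x. norm x < c} x :: ennreal) \<in> borel_measurable v"
    unfolding measurable_cong_sets[OF sets refl]
    by (intro measurable_restrict_space1 borel_measurable_indicator) simp
  have "(\<lambda>z. (fst (fst z), snd (fst z), snd z)) \<in> (borel \<Otimes>\<^sub>M P) \<Otimes>\<^sub>M v \<rightarrow>\<^sub>M borel \<Otimes>\<^sub>M P \<Otimes>\<^sub>M v"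
    by measurable
  from measurable_compose[OF this g]
  have "(\<lambda>z. g (fst (fst z)) (snd (fst z)) (snd z)) \<in> borel_measurable ((borel \<Otimes>\<^sub>M P) \<Otimes>\<^sub>M v)" by simp
  then have "(\<lambda>(y, z). esq (g (fst y) (snd y) z) * indicator {x. norm x < c} z)
      \<in> borel_measurable ((borel \<Otimes>\<^sub>M P) \<Otimes>\<^sub>M v)"
    using measurable_compose[OF measurable_snd i] unfolding case_prod_beta'
    by (intro borel_measurable_times_ennreal) auto
  from sigma_finite_measure.borel_measurable_nn_integral[OF levy_intensity_sigma_finite[OF v] this]
  show ?thesis unfolding jump_norm_sq_def by (simp add: case_prod_beta')
qed

text \<open>Drift and fractional term are estimated path by path, the two stochastic integrals only
  in mean. The assumptions \<open>sq\<close> and \<open>sq'\<close> guarantee that the pathwise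
  integrals exist, and will follow from linear growth. The result involves the integral of
  \<open>q\<close> up to t without a singular kernel, since Cauchy-Schwarz has already separated the
  kernel from the integrand.\<close>

lemma market_diff_le:
  fixes x x' s s' :: "real \<Rightarrow> 'w \<Rightarrow> real^'m" and B :: "real \<Rightarrow> 'w \<Rightarrow> real^'d"
  assumes cf: "complete_filtered_prob_space P F" and B: "brownian_motion P F B"
    and v: "levy_intensity v" and N: "poisson_random_measure P F v N"
    and \<alpha>: "1/2 < \<alpha>" and T: "0 \<le> T"
    and eqn: "market_equation P F T \<alpha> c B v N b \<sigma> f G x0 x s"
    and eqn': "market_equation P F T \<alpha> c B v N b' \<sigma>' f' G' x0 x' s'"
    and coeff: "adapted_coeff P F T b" "adapted_coeff P F T \<sigma>" "adapted_coeff P F T f" "adapted_jump_coeff P F T v G"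
    and coeff': "adapted_coeff P F T b'" "adapted_coeff P F T \<sigma>'" "adapted_coeff P F T f'" "adapted_jump_coeff P F T v G'"
    and xs: "(\<lambda>(t, \<omega>). x t \<omega>) \<in> borel_measurable (restrict_space borel {0..T} \<Otimes>\<^sub>M P)"
      "(\<lambda>(t, \<omega>). s t \<omega>) \<in> borel_measurable (restrict_space borel {0..T} \<Otimes>\<^sub>M P)"
    and xs': "(\<lambda>(t, \<omega>). x' t \<omega>) \<in> borel_measurable (restrict_space borel {0..T} \<Otimes>\<^sub>M P)"
      "(\<lambda>(t, \<omega>). s' t \<omega>) \<in> borel_measurable (restrict_space borel {0..T} \<Otimes>\<^sub>M P)"
    and sq: "AE \<omega> in P. (\<integral>\<^sup>+r\<in>{0..T}. esq (b r \<omega> (x r \<omega>) (s r \<omega>)) \<partial>lborel) < \<infinity>"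
      "AE \<omega> in P. (\<integral>\<^sup>+r\<in>{0..T}. esq (\<sigma> r \<omega> (x r \<omega>) (s r \<omega>)) \<partial>lborel) < \<infinity>"
    and sq': "AE \<omega> in P. (\<integral>\<^sup>+r\<in>{0..T}. esq (b' r \<omega> (x' r \<omega>) (s' r \<omega>)) \<partial>lborel) < \<infinity>"
      "AE \<omega> in P. (\<integral>\<^sup>+r\<in>{0..T}. esq (\<sigma>' r \<omega> (x' r \<omega>) (s' r \<omega>)) \<partial>lborel) < \<infinity>"
    and t: "0 \<le> t" "t \<le> T"
    and bound: "AE \<omega> in P. \<forall>r\<in>{0..t}.
      esq (b r \<omega> (x r \<omega>) (s r \<omega>) - b' r \<omega> (x' r \<omega>) (s' r \<omega>)) +
      esq (\<sigma> r \<omega> (x r \<omega>) (s r \<omega>) - \<sigma>' r \<omega> (x' r \<omega>) (s' r \<omega>)) +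
      esq (f r \<omega> (x r \<omega>) (s r \<omega>) - f' r \<omega> (x' r \<omega>) (s' r \<omega>)) +
      jump_norm_sq c v (\<lambda>z. G r \<omega> (x r \<omega>) (s r \<omega>) z - G' r \<omega> (x' r \<omega>) (s' r \<omega>) z) \<le> q r \<omega>"
  shows "(\<integral>\<^sup>+\<omega>. esq (x t \<omega> - x' t \<omega>) \<partial>P) \<le> market_const \<alpha> T * E_int P t q"
proof -
  interpret prob_space P by (rule complete_filtered_prob_spaceD(1)[OF cf])
  define k where "k t = max 0 (min T t)" for t
  have k: "k r = r" if "r \<in> {0..T}" for r using that by (auto simp: k_def)
  define hb where "hb r \<omega> = b (k r) \<omega> (x (k r) \<omega>) (s (k r) \<omega>)" for r \<omega>
  define hb' where "hb' r \<omega> = b' (k r) \<omega> (x' (k r) \<omega>) (s' (k r) \<omega>)" for r \<omega>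
  define hs where "hs r \<omega> = \<sigma> (k r) \<omega> (x (k r) \<omega>) (s (k r) \<omega>)" for r \<omega>
  define hs' where "hs' r \<omega> = \<sigma>' (k r) \<omega> (x' (k r) \<omega>) (s' (k r) \<omega>)" for r \<omega>
  define hf where "hf r \<omega> = f (k r) \<omega> (x (k r) \<omega>) (s (k r) \<omega>)" for r \<omega>
  define hf' where "hf' r \<omega> = f' (k r) \<omega> (x' (k r) \<omega>) (s' (k r) \<omega>)" for r \<omega>
  define hG where "hG r \<omega> = G (k r) \<omega> (x (k r) \<omega>) (s (k r) \<omega>)" for r \<omega>
  define hG' where "hG' r \<omega> = G' (k r) \<omega> (x' (k r) \<omega>) (s' (k r) \<omega>)" for r \<omega>
  have joint: "(\<lambda>(r, \<omega>). h (k r) \<omega> (x (k r) \<omega>) (s (k r) \<omega>)) \<in> borel_measurable (borel \<Otimes>\<^sub>M P)"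
    if "adapted_coeff P F T h" for h :: "real \<Rightarrow> 'w \<Rightarrow> real^'m \<Rightarrow> real^'m \<Rightarrow> 'v::euclidean_space"
    using joint_measurable_clamp[OF T coeff_joint_measurable[OF that T xs]] by (simp add: k_def)
  have joint': "(\<lambda>(r, \<omega>). h (k r) \<omega> (x' (k r) \<omega>) (s' (k r) \<omega>)) \<in> borel_measurable (borel \<Otimes>\<^sub>M P)"
    if "adapted_coeff P F T h" for h :: "real \<Rightarrow> 'w \<Rightarrow> real^'m \<Rightarrow> real^'m \<Rightarrow> 'v::euclidean_space"
    using joint_measurable_clamp[OF T coeff_joint_measurable[OF that T xs']] by (simp add: k_def)
  have mb: "(\<lambda>(r, \<omega>). hb r \<omega>) \<in> borel_measurable (borel \<Otimes>\<^sub>M P)"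
    and mb': "(\<lambda>(r, \<omega>). hb' r \<omega>) \<in> borel_measurable (borel \<Otimes>\<^sub>M P)"
    and ms: "(\<lambda>(r, \<omega>). hs r \<omega>) \<in> borel_measurable (borel \<Otimes>\<^sub>M P)"
    and ms': "(\<lambda>(r, \<omega>). hs' r \<omega>) \<in> borel_measurable (borel \<Otimes>\<^sub>M P)"
    and mf: "(\<lambda>(r, \<omega>). hf r \<omega>) \<in> borel_measurable (borel \<Otimes>\<^sub>M P)"
    and mf': "(\<lambda>(r, \<omega>). hf' r \<omega>) \<in> borel_measurable (borel \<Otimes>\<^sub>M P)"
    unfolding hb_def hb'_def hs_def hs'_def hf_def hf'_def by (intro joint joint' coeff coeff')+
  have mG: "(\<lambda>(r, \<omega>, z). hG r \<omega> z) \<in> borel_measurable (borel \<Otimes>\<^sub>M P \<Otimes>\<^sub>M v)"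
    using jump_coeff_joint_measurable[OF coeff(4) T xs] by (simp add: hG_def k_def)
  have mG': "(\<lambda>(r, \<omega>, z). hG' r \<omega> z) \<in> borel_measurable (borel \<Otimes>\<^sub>M P \<Otimes>\<^sub>M v)"
    using jump_coeff_joint_measurable[OF coeff'(4) T xs'] by (simp add: hG'_def k_def)
  obtain I J where I: "is_ito_integral P F T B (\<lambda>r \<omega>. f r \<omega> (left_value x r \<omega>) (left_value s r \<omega>)) I"
    and J: "is_jump_integral P F T c v N (\<lambda>r \<omega> z. G r \<omega> (left_value x r \<omega>) (left_value s r \<omega>) z) J"
    and X: "\<forall>t\<in>{0..T}. AE \<omega> in P. x t \<omega> = x0 \<omega>
        + (LBINT r:{0..t}. b r \<omega> (left_value x r \<omega>) (left_value s r \<omega>))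
        + \<alpha> *\<^sub>R (LBINT r:{0..t}. (t - r) powr (\<alpha> - 1) *\<^sub>R \<sigma> r \<omega> (left_value x r \<omega>) (left_value s r \<omega>))
        + I t \<omega> + J t \<omega>"
    using eqn unfolding market_equation_def by blast
  obtain I' J' where I': "is_ito_integral P F T B (\<lambda>r \<omega>. f' r \<omega> (left_value x' r \<omega>) (left_value s' r \<omega>)) I'"
    and J': "is_jump_integral P F T c v N (\<lambda>r \<omega> z. G' r \<omega> (left_value x' r \<omega>) (left_value s' r \<omega>) z) J'"
    and X': "\<forall>t\<in>{0..T}. AE \<omega> in P. x' t \<omega> = x0 \<omega>
        + (LBINT r:{0..t}. b' r \<omega> (left_value x' r \<omega>) (left_value s' r \<omega>))
        + \<alpha> *\<^sub>R (LBINT r:{0..t}. (t - r) powr (\<alpha> - 1) *\<^sub>R \<sigma>' r \<omega> (left_value x' r \<omega>) (left_value s' r \<omega>))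
        + I' t \<omega> + J' t \<omega>"
    using eqn' unfolding market_equation_def by blast
  have tT: "t \<in> {0..T}" using t by simp
  have It: "I t \<in> borel_measurable P" "I' t \<in> borel_measurable P" "J t \<in> borel_measurable P" "J' t \<in> borel_measurable P"
  proof -
    have "I t \<in> borel_measurable (F t)" "I' t \<in> borel_measurable (F t)"
      using I I' tT unfolding is_ito_integral_def by blast+
    moreover have "J t \<in> borel_measurable (F t)" "J' t \<in> borel_measurable (F t)"
      using J J' tT unfolding is_jump_integral_def by blast+
    ultimately show "I t \<in> borel_measurable P" "I' t \<in> borel_measurable P"
      "J t \<in> borel_measurable P" "J' t \<in> borel_measurable P"
      by (blast intro: measurable_from_subalg[OF complete_filtered_prob_spaceD(2)[OF cf t(1)]])+
  qed
  let ?qb = "\<lambda>r \<omega>. esq (hb r \<omega> - hb' r \<omega>)"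
  let ?qs = "\<lambda>r \<omega>. esq (hs r \<omega> - hs' r \<omega>)"
  let ?qf = "\<lambda>r \<omega>. esq (hf r \<omega> - hf' r \<omega>)"
  let ?qG = "\<lambda>r \<omega>. jump_norm_sq c v (\<lambda>z. hG r \<omega> z - hG' r \<omega> z)"
  have mq: "(\<lambda>(r, \<omega>). ?qb r \<omega>) \<in> borel_measurable (borel \<Otimes>\<^sub>M P)" "(\<lambda>(r, \<omega>). ?qs r \<omega>) \<in> borel_measurable (borel \<Otimes>\<^sub>M P)"
    "(\<lambda>(r, \<omega>). ?qf r \<omega>) \<in> borel_measurable (borel \<Otimes>\<^sub>M P)"
    using mb mb' ms ms' mf mf' unfolding case_prod_beta' by measurable
  have mqG: "(\<lambda>(r, \<omega>). ?qG r \<omega>) \<in> borel_measurable (borel \<Otimes>\<^sub>M P)"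
    by (rule measurable_jump_norm_sq[OF v]) (use mG mG' in \<open>simp add: case_prod_beta'\<close>)
  have EI: "(\<integral>\<^sup>+\<omega>. esq (I t \<omega> - I' t \<omega>) \<partial>P) \<le> 9 * E_int P t ?qf"
    unfolding E_int_def
    by (rule ito_integral_diff_le[OF cf B I I' t mf mf'])
      (use AE_left_value2[of "{0..T}"] k in \<open>auto simp: hf_def hf'_def cong: imp_cong\<close>)
  have EJ: "(\<integral>\<^sup>+\<omega>. esq (J t \<omega> - J' t \<omega>) \<partial>P) \<le> 9 * E_int P t ?qG"
    unfolding E_int_def jump_norm_sq_def
    by (rule jump_integral_diff_le[OF cf v N J J' t mG mG'])
      (use AE_left_value2[of "{0..T}"] k in \<open>auto simp: hG_def hG'_def cong: imp_cong\<close>)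
  let ?R = "\<lambda>\<omega>. 4 * (ennreal T * (\<integral>\<^sup>+r\<in>{0..t}. ?qb r \<omega> \<partial>lborel) +
      ennreal (\<alpha>\<^sup>2) * kernel_sq \<alpha> T * (\<integral>\<^sup>+r\<in>{0..t}. ?qs r \<omega> \<partial>lborel) +
      esq (I t \<omega> - I' t \<omega>) + esq (J t \<omega> - J' t \<omega>))"
  have "AE \<omega> in P. esq (x t \<omega> - x' t \<omega>) \<le> ?R \<omega>"
    using X[rule_format, OF tT] X'[rule_format, OF tT] sq sq' AE_space
  proof eventually_elim
    case (elim \<omega>)
    have path: "(\<lambda>r. h r \<omega>) \<in> borel_measurable borel"
      if "(\<lambda>(r, \<omega>). h r \<omega>) \<in> borel_measurable (borel \<Otimes>\<^sub>M P)" for h :: "real \<Rightarrow> 'w \<Rightarrow> 'v::euclidean_space"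
      using measurable_compose[of "\<lambda>r. (r, \<omega>)" borel, OF _ that] elim by simp
    have fin: "(\<integral>\<^sup>+r\<in>{0..t}. esq (h (k r)) \<partial>lborel) < \<infinity>"
      if "(\<integral>\<^sup>+r\<in>{0..T}. esq (h r) \<partial>lborel) < \<infinity>" for h :: "real \<Rightarrow> 'v::euclidean_space"
    proof (rule le_less_trans[OF nn_integral_mono that])
      fix r show "esq (h (k r)) * indicator {0..t} r \<le> esq (h r) * indicator {0..T} r"
        using t k by (auto split: split_indicator)
    qed
    have fb: "(\<integral>\<^sup>+r\<in>{0..t}. esq (hb r \<omega>) \<partial>lborel) < \<infinity>"
      and fs: "(\<integral>\<^sup>+r\<in>{0..t}. esq (hs r \<omega>) \<partial>lborel) < \<infinity>"
      and fb': "(\<integral>\<^sup>+r\<in>{0..t}. esq (hb' r \<omega>) \<partial>lborel) < \<infinity>"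
      and fs': "(\<integral>\<^sup>+r\<in>{0..t}. esq (hs' r \<omega>) \<partial>lborel) < \<infinity>"
      unfolding hb_def hs_def hb'_def hs'_def using elim
      by (auto intro!: fin[of "\<lambda>r. b r \<omega> (x r \<omega>) (s r \<omega>)"] fin[of "\<lambda>r. \<sigma> r \<omega> (x r \<omega>) (s r \<omega>)"]
        fin[of "\<lambda>r. b' r \<omega> (x' r \<omega>) (s' r \<omega>)"] fin[of "\<lambda>r. \<sigma>' r \<omega> (x' r \<omega>) (s' r \<omega>)"] simp del: infinity_ennreal_def)
    let ?w = "\<lambda>r. (t - r) powr (\<alpha> - 1)"
    have w1: "(\<integral>\<^sup>+r\<in>{0..t}. ennreal (1\<^sup>2) \<partial>lborel) = ennreal t" using t by simp
    have w2: "(\<integral>\<^sup>+r\<in>{0..t}. ennreal ((?w r)\<^sup>2) \<partial>lborel) < \<infinity>"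
      using kernel_sq_le[OF t(2), of \<alpha>] kernel_sq_finite[OF \<alpha> T] by (rule le_less_trans)
    let ?Db = "(LBINT r:{0..t}. 1 *\<^sub>R hb r \<omega>) - (LBINT r:{0..t}. 1 *\<^sub>R hb' r \<omega>)"
    let ?Ds = "(LBINT r:{0..t}. ?w r *\<^sub>R hs r \<omega>) - (LBINT r:{0..t}. ?w r *\<^sub>R hs' r \<omega>)"
    have Db: "esq ?Db \<le> ennreal T * (\<integral>\<^sup>+r\<in>{0..t}. ?qb r \<omega> \<partial>lborel)"
    proof -
      have "esq ?Db \<le> ennreal t * (\<integral>\<^sup>+r\<in>{0..t}. ?qb r \<omega> \<partial>lborel)"
        using set_integral_weighted_diff[OF path[OF mb] path[OF mb'], of "\<lambda>_. 1" t] fb fb'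
        unfolding w1 by simp
      also have "\<dots> \<le> ennreal T * (\<integral>\<^sup>+r\<in>{0..t}. ?qb r \<omega> \<partial>lborel)"
        using t by (intro mult_right_mono ennreal_leI) auto
      finally show ?thesis .
    qed
    have Ds: "esq (\<alpha> *\<^sub>R ?Ds) \<le> ennreal (\<alpha>\<^sup>2) * kernel_sq \<alpha> T * (\<integral>\<^sup>+r\<in>{0..t}. ?qs r \<omega> \<partial>lborel)"
    proof -
      have "esq ?Ds \<le> (\<integral>\<^sup>+r\<in>{0..t}. ennreal ((?w r)\<^sup>2) \<partial>lborel) * (\<integral>\<^sup>+r\<in>{0..t}. ?qs r \<omega> \<partial>lborel)"
        by (rule set_integral_weighted_diff[OF path[OF ms] path[OF ms'] _ fs fs' w2]) measurable
      also have "\<dots> \<le> kernel_sq \<alpha> T * (\<integral>\<^sup>+r\<in>{0..t}. ?qs r \<omega> \<partial>lborel)"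
        by (intro mult_right_mono kernel_sq_le t) auto
      finally have "ennreal (\<alpha>\<^sup>2) * esq ?Ds \<le> ennreal (\<alpha>\<^sup>2) * (kernel_sq \<alpha> T * (\<integral>\<^sup>+r\<in>{0..t}. ?qs r \<omega> \<partial>lborel))"
        by (rule mult_left_mono) simp
      then show ?thesis
        by (simp add: power_mult_distrib ennreal_mult mult.assoc)
    qed
    have "(LBINT r:{0..t}. b r \<omega> (x r \<omega>) (s r \<omega>)) = (LBINT r:{0..t}. 1 *\<^sub>R hb r \<omega>)"
      "(LBINT r:{0..t}. b' r \<omega> (x' r \<omega>) (s' r \<omega>)) = (LBINT r:{0..t}. 1 *\<^sub>R hb' r \<omega>)"
      "(LBINT r:{0..t}. ?w r *\<^sub>R \<sigma> r \<omega> (x r \<omega>) (s r \<omega>)) = (LBINT r:{0..t}. ?w r *\<^sub>R hs r \<omega>)"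
      "(LBINT r:{0..t}. ?w r *\<^sub>R \<sigma>' r \<omega> (x' r \<omega>) (s' r \<omega>)) = (LBINT r:{0..t}. ?w r *\<^sub>R hs' r \<omega>)"
      using k t by (auto intro!: set_lebesgue_integral_cong simp: hb_def hb'_def hs_def hs'_def)
    \<comment> \<open>The common initial value cancels here.\<close>
    then have "x t \<omega> - x' t \<omega> = ?Db + \<alpha> *\<^sub>R ?Ds + (I t \<omega> - I' t \<omega>) + (J t \<omega> - J' t \<omega>)"
      using elim(1,2)
        set_integral_left_value[of "{0..t}" "\<lambda>r. b r \<omega>" x \<omega> s]
        set_integral_left_value[of "{0..t}" "\<lambda>r. b' r \<omega>" x' \<omega> s']
        set_integral_left_value[of "{0..t}" "\<lambda>r p q. ?w r *\<^sub>R \<sigma> r \<omega> p q" x \<omega> s]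
        set_integral_left_value[of "{0..t}" "\<lambda>r p q. ?w r *\<^sub>R \<sigma>' r \<omega> p q" x' \<omega> s']
      by (simp add: algebra_simps)
    then have "esq (x t \<omega> - x' t \<omega>) \<le> 4 * (esq ?Db + esq (\<alpha> *\<^sub>R ?Ds) +
        esq (I t \<omega> - I' t \<omega>) + esq (J t \<omega> - J' t \<omega>))"
      by (simp only: ennreal_norm_add4_sq)
    also have "\<dots> \<le> ?R \<omega>"
      by (intro mult_left_mono add_mono Db Ds order_refl) simp
    finally show ?case .
  qed
  then have "(\<integral>\<^sup>+\<omega>. esq (x t \<omega> - x' t \<omega>) \<partial>P) \<le> (\<integral>\<^sup>+\<omega>. ?R \<omega> \<partial>P)"
    by (rule nn_integral_mono_AE)
  also have "\<dots> = 4 * (ennreal T * E_int P t ?qb + ennreal (\<alpha>\<^sup>2) * kernel_sq \<alpha> T * E_int P t ?qs +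
      (\<integral>\<^sup>+\<omega>. esq (I t \<omega> - I' t \<omega>) \<partial>P) + (\<integral>\<^sup>+\<omega>. esq (J t \<omega> - J' t \<omega>) \<partial>P))"
    using It measurable_time_integral(1)[OF mq(1), of t] measurable_time_integral(1)[OF mq(2), of t]
    unfolding E_int_def by (simp add: nn_integral_add nn_integral_cmult del: distrib_left_numeral)
  also have "\<dots> \<le> 4 * (ennreal T * E_int P t ?qb + ennreal (\<alpha>\<^sup>2) * kernel_sq \<alpha> T * E_int P t ?qs +
      9 * E_int P t ?qf + 9 * E_int P t ?qG)"
    by (intro mult_left_mono add_mono EI EJ order_refl) simp
  \<comment> \<open>All four weights are raised to their sum, because \<open>bound\<close> controls
    only the sum of the four coefficient differences.\<close>
  also have "\<dots> \<le> 4 * ((9 + ennreal T + ennreal (\<alpha>\<^sup>2) * kernel_sq \<alpha> T) * E_int P t ?qb +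
      (9 + ennreal T + ennreal (\<alpha>\<^sup>2) * kernel_sq \<alpha> T) * E_int P t ?qs +
      (9 + ennreal T + ennreal (\<alpha>\<^sup>2) * kernel_sq \<alpha> T) * E_int P t ?qf +
      (9 + ennreal T + ennreal (\<alpha>\<^sup>2) * kernel_sq \<alpha> T) * E_int P t ?qG)"
    by (intro mult_left_mono add_mono mult_right_mono) (auto simp: add_increasing add_increasing2)
  also have "\<dots> = market_const \<alpha> T * (E_int P t ?qb + E_int P t ?qs + E_int P t ?qf + E_int P t ?qG)"
    unfolding market_const_def by (simp only: mult.assoc distrib_left[symmetric])
  also have "E_int P t ?qb + E_int P t ?qs + E_int P t ?qf + E_int P t ?qG =
      E_int P t (\<lambda>r \<omega>. ?qb r \<omega> + ?qs r \<omega> + ?qf r \<omega> + ?qG r \<omega>)"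
    using mq mqG by (simp add: E_int_add case_prod_beta' borel_measurable_add)
  also have "\<dots> = E_int P t (\<lambda>r \<omega>.
      esq (b r \<omega> (x r \<omega>) (s r \<omega>) - b' r \<omega> (x' r \<omega>) (s' r \<omega>)) +
      esq (\<sigma> r \<omega> (x r \<omega>) (s r \<omega>) - \<sigma>' r \<omega> (x' r \<omega>) (s' r \<omega>)) +
      esq (f r \<omega> (x r \<omega>) (s r \<omega>) - f' r \<omega> (x' r \<omega>) (s' r \<omega>)) +
      jump_norm_sq c v (\<lambda>z. G r \<omega> (x r \<omega>) (s r \<omega>) z - G' r \<omega> (x' r \<omega>) (s' r \<omega>) z))"
    using t k by (intro E_int_cong) (simp add: hb_def hb'_def hs_def hs'_def hf_def hf'_def hG_def hG'_def)
  finally have "(\<integral>\<^sup>+\<omega>. esq (x t \<omega> - x' t \<omega>) \<partial>P) \<le> market_const \<alpha> T * \<dots>" .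
  also have "\<dots> \<le> market_const \<alpha> T * E_int P t q"
    by (rule mult_left_mono[OF E_int_mono_AE[OF bound]]) simp
  finally show ?thesis .
qed

section \<open>The variational inequality\<close>

lemma restricted_time_measure:
  shows "sets (restrict_space lborel {0..T::real}) = sets (restrict_space borel {0..T})"
    and "finite_measure (restrict_space lborel {0..T})"
proof -
  show "sets (restrict_space lborel {0..T::real}) = sets (restrict_space borel {0..T})"
    by (intro sets_restrict_space_cong) simp
  show "finite_measure (restrict_space lborel {0..T})"
    by (intro finite_measureI) (simp add: emeasure_restrict_space emeasure_lborel_Icc_eq)
qed

text \<open>The sample point is the first factor, so that Fubini produces the iterated integrals of
  \<open>L2ad\<close> and \<open>L2_inner\<close> in their given order.\<close>

definition time_prob :: "'w measure \<Rightarrow> real \<Rightarrow> ('w \<times> real) measure" where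
  "time_prob P T = P \<Otimes>\<^sub>M restrict_space lborel {0..T}"

context
  fixes P :: "'w measure" and F :: "real \<Rightarrow> 'w measure" and T :: real
  assumes cf: "complete_filtered_prob_space P F"
begin

interpretation prob_space P by (rule complete_filtered_prob_spaceD(1)[OF cf])
interpretation R: finite_measure "restrict_space lborel {0..T}" by (rule restricted_time_measure)
interpretation PR: pair_sigma_finite P "restrict_space lborel {0..T}" ..

lemma finite_measure_time_prob: "finite_measure (time_prob P T)"
  unfolding time_prob_def by (intro finite_measure_pair_measure R.finite_measure_axioms finite_measure_axioms)

lemma measurable_time_prob_swap:
  assumes "(\<lambda>(t, \<omega>). x t \<omega>) \<in> borel_measurable (restrict_space borel {0..T} \<Otimes>\<^sub>M P)"
  shows "(\<lambda>(\<omega>, t). x t \<omega>) \<in> borel_measurable (time_prob P T)"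
proof -
  have "(\<lambda>z. (snd z, fst z)) \<in> P \<Otimes>\<^sub>M restrict_space borel {0..T} \<rightarrow>\<^sub>M restrict_space borel {0..T} \<Otimes>\<^sub>M P"
    by measurable
  from measurable_compose[OF this assms]
  show ?thesis
    unfolding time_prob_def
      measurable_cong_sets[OF sets_pair_measure_cong[OF refl restricted_time_measure(1)] refl]
    by (simp add: case_prod_beta')
qed

lemma nn_integral_time_prob:
  assumes "(\<lambda>(\<omega>, t). q t \<omega>) \<in> borel_measurable (time_prob P T)"
  shows "(\<integral>\<^sup>+(\<omega>, t). q t \<omega> \<partial>time_prob P T) = E_int P T q"
  using R.nn_integral_fst[OF assms[unfolded time_prob_def]]
  by (simp add: time_prob_def E_int_def nn_integral_restrict_space)

lemma L2ad_measurable: "x \<in> L2ad P F T \<Longrightarrow> (\<lambda>(\<omega>, t). x t \<omega>) \<in> borel_measurable (time_prob P T)"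
  by (rule measurable_time_prob_swap) (simp add: L2ad_def)

lemma L2ad_sq:
  assumes x: "x \<in> L2ad P F T"
  shows "integrable (time_prob P T) (\<lambda>(\<omega>, t). (norm (x t \<omega>))\<^sup>2)"
    and "E_int P T (\<lambda>t \<omega>. esq (x t \<omega>)) = ennreal (\<integral>(\<omega>, t). (norm (x t \<omega>))\<^sup>2 \<partial>time_prob P T)"
proof -
  note m = L2ad_measurable[OF x]
  have m2: "(\<lambda>(\<omega>, t). (norm (x t \<omega>))\<^sup>2) \<in> borel_measurable (time_prob P T)"
    using m by (simp add: case_prod_beta')
  have m3: "(\<lambda>(\<omega>, t). esq (x t \<omega>)) \<in> borel_measurable (time_prob P T)"
    using m by (simp add: case_prod_beta')
  have eq: "(\<integral>\<^sup>+(\<omega>, t). esq (x t \<omega>) \<partial>time_prob P T) = E_int P T (\<lambda>t \<omega>. esq (x t \<omega>))"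
    using nn_integral_time_prob[OF m3] .
  have fin: "E_int P T (\<lambda>t \<omega>. esq (x t \<omega>)) < \<infinity>"
    using x by (auto simp: L2ad_def E_int_def)
  show i: "integrable (time_prob P T) (\<lambda>(\<omega>, t). (norm (x t \<omega>))\<^sup>2)"
    using m2 fin eq by (intro integrableI_nonneg) (auto simp: case_prod_beta')
  show "E_int P T (\<lambda>t \<omega>. esq (x t \<omega>)) = ennreal (\<integral>(\<omega>, t). (norm (x t \<omega>))\<^sup>2 \<partial>time_prob P T)"
    using nn_integral_eq_integral[OF i] eq by (simp add: case_prod_beta')
qed

text \<open>\<open>L2_inner\<close> is an iterated Bochner integral. The product of two square
  integrable processes is dominated by the sum of their squares, hence integrable on the product
  space, and Fubini applies.\<close>

lemma L2ad_inner:
  assumes x: "x \<in> L2ad P F T" and y: "y \<in> L2ad P F T"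
  shows "integrable (time_prob P T) (\<lambda>(\<omega>, t). x t \<omega> \<bullet> y t \<omega>)"
    and "L2_inner P T x y = (\<integral>(\<omega>, t). x t \<omega> \<bullet> y t \<omega> \<partial>time_prob P T)"
proof -
  have m: "(\<lambda>(\<omega>, t). x t \<omega> \<bullet> y t \<omega>) \<in> borel_measurable (time_prob P T)"
    using L2ad_measurable[OF x] L2ad_measurable[OF y] by (simp add: case_prod_beta')
  show i: "integrable (time_prob P T) (\<lambda>(\<omega>, t). x t \<omega> \<bullet> y t \<omega>)"
  proof (rule Bochner_Integration.integrable_bound[OF Bochner_Integration.integrable_add[OF L2ad_sq(1)[OF x] L2ad_sq(1)[OF y]] m], rule AE_I2)
    fix z
    have "2 * norm (x (snd z) (fst z)) * norm (y (snd z) (fst z)) \<le> (norm (x (snd z) (fst z)))\<^sup>2 + (norm (y (snd z) (fst z)))\<^sup>2"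
      by (rule sum_squares_bound)
    moreover have "\<bar>x (snd z) (fst z) \<bullet> y (snd z) (fst z)\<bar> \<le> norm (x (snd z) (fst z)) * norm (y (snd z) (fst z))"
      by (rule Cauchy_Schwarz_ineq2)
    moreover have "0 \<le> norm (x (snd z) (fst z)) * norm (y (snd z) (fst z))" by simp
    ultimately have "\<bar>x (snd z) (fst z) \<bullet> y (snd z) (fst z)\<bar> \<le> (norm (x (snd z) (fst z)))\<^sup>2 + (norm (y (snd z) (fst z)))\<^sup>2"
      by linarith
    then show "norm (case z of (\<omega>, t) \<Rightarrow> x t \<omega> \<bullet> y t \<omega>) \<le>
        norm ((case z of (\<omega>, t) \<Rightarrow> (norm (x t \<omega>))\<^sup>2) + (case z of (\<omega>, t) \<Rightarrow> (norm (y t \<omega>))\<^sup>2))"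
      by (simp add: case_prod_beta')
  qed
  have "L2_inner P T x y = (\<integral>\<omega>. (\<integral>t. x t \<omega> \<bullet> y t \<omega> \<partial>restrict_space lborel {0..T}) \<partial>P)"
    unfolding L2_inner_def set_lebesgue_integral_def by (simp add: integral_restrict_space)
  also have "\<dots> = (\<integral>(\<omega>, t). x t \<omega> \<bullet> y t \<omega> \<partial>time_prob P T)"
    using PR.integral_fst'[OF i[unfolded time_prob_def]] by (simp add: time_prob_def)
  finally show "L2_inner P T x y = (\<integral>(\<omega>, t). x t \<omega> \<bullet> y t \<omega> \<partial>time_prob P T)" .
qed

lemma L2ad_diff:
  assumes x: "x \<in> L2ad P F T" and y: "y \<in> L2ad P F T"
  shows "(\<lambda>t \<omega>. x t \<omega> - y t \<omega>) \<in> L2ad P F T"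
proof -
  note m = L2ad_measurable[OF x] L2ad_measurable[OF y]
  have mq: "(\<lambda>(\<omega>, t). esq (x t \<omega> - y t \<omega>)) \<in> borel_measurable (time_prob P T)"
    using m by (simp add: case_prod_beta')
  have "E_int P T (\<lambda>t \<omega>. esq (x t \<omega> - y t \<omega>)) =
      (\<integral>\<^sup>+(\<omega>, t). esq (x t \<omega> - y t \<omega>) \<partial>time_prob P T)"
    by (rule nn_integral_time_prob[OF mq, symmetric])
  also have "\<dots> \<le> (\<integral>\<^sup>+(\<omega>, t). ennreal (2 * ((norm (x t \<omega>))\<^sup>2 + (norm (y t \<omega>))\<^sup>2)) \<partial>time_prob P T)"
    unfolding case_prod_beta' by (intro nn_integral_mono ennreal_leI norm_diff_sq)
  also have "\<dots> < \<infinity>"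
  proof -
    have "integrable (time_prob P T) (\<lambda>(\<omega>, t). 2 * ((norm (x t \<omega>))\<^sup>2 + (norm (y t \<omega>))\<^sup>2))"
      using L2ad_sq(1)[OF x] L2ad_sq(1)[OF y] by (simp add: case_prod_beta')
    from nn_integral_eq_integral[OF this] show ?thesis by (simp add: case_prod_beta')
  qed
  finally have "E_int P T (\<lambda>t \<omega>. esq (x t \<omega> - y t \<omega>)) < \<infinity>" .
  moreover have "(\<lambda>\<omega>. x t \<omega> - y t \<omega>) \<in> borel_measurable (F t)" if "t \<in> {0..T}" for t
  proof -
    have "x t \<in> borel_measurable (F t)" "y t \<in> borel_measurable (F t)"
      using x y that by (simp_all add: L2ad_def)
    then show ?thesis by (rule borel_measurable_diff)
  qed
  moreover have "(\<lambda>(t, \<omega>). x t \<omega> - y t \<omega>) \<in> borel_measurable (restrict_space borel {0..T} \<Otimes>\<^sub>M P)"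
  proof -
    have "(\<lambda>z. x (fst z) (snd z)) \<in> borel_measurable (restrict_space borel {0..T} \<Otimes>\<^sub>M P)"
      "(\<lambda>z. y (fst z) (snd z)) \<in> borel_measurable (restrict_space borel {0..T} \<Otimes>\<^sub>M P)"
      using x y by (simp_all add: L2ad_def case_prod_beta')
    then show ?thesis unfolding case_prod_beta' by (rule borel_measurable_diff)
  qed
  ultimately show ?thesis
    by (simp add: L2ad_def E_int_def)
qed

lemma L2_dist_sq:
  assumes x: "x \<in> L2ad P F T" and y: "y \<in> L2ad P F T"
  shows "(L2_dist P T x y)\<^sup>2 = (\<integral>(\<omega>, t). (norm (x t \<omega> - y t \<omega>))\<^sup>2 \<partial>time_prob P T)"
    and "ennreal ((L2_dist P T x y)\<^sup>2) = E_int P T (\<lambda>t \<omega>. esq (x t \<omega> - y t \<omega>))"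
    and "0 \<le> L2_dist P T x y"
proof -
  note d = L2ad_diff[OF x y]
  have eq: "L2_inner P T (\<lambda>t \<omega>. x t \<omega> - y t \<omega>) (\<lambda>t \<omega>. x t \<omega> - y t \<omega>) =
      (\<integral>(\<omega>, t). (norm (x t \<omega> - y t \<omega>))\<^sup>2 \<partial>time_prob P T)"
    using L2ad_inner(2)[OF d d] by (simp add: power2_norm_eq_inner)
  have nn: "0 \<le> (\<integral>(\<omega>, t). (norm (x t \<omega> - y t \<omega>))\<^sup>2 \<partial>time_prob P T)"
    by (intro Bochner_Integration.integral_nonneg) (simp add: case_prod_beta')
  show "(L2_dist P T x y)\<^sup>2 = (\<integral>(\<omega>, t). (norm (x t \<omega> - y t \<omega>))\<^sup>2 \<partial>time_prob P T)"
    unfolding L2_dist_def L2_norm_def eq using nn by simp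
  then show "ennreal ((L2_dist P T x y)\<^sup>2) = E_int P T (\<lambda>t \<omega>. esq (x t \<omega> - y t \<omega>))"
    using L2ad_sq(2)[OF d] by simp
  show "0 \<le> L2_dist P T x y"
    unfolding L2_dist_def L2_norm_def eq using nn by simp
qed

text \<open>Setting a process to zero after \<open>\<tau>\<close> keeps it adapted. As the operators
  act pointwise, evaluating the hypotheses, which concern the whole of [0, T], at cut processes
  yields estimates over \<open>[0, \<tau>]\<close>.\<close>

definition cut :: "real \<Rightarrow> (real \<Rightarrow> 'w \<Rightarrow> 'v::euclidean_space) \<Rightarrow> real \<Rightarrow> 'w \<Rightarrow> 'v" where
  "cut \<tau> x t \<omega> = indicator {..\<tau>} t *\<^sub>R x t \<omega>"

lemma L2ad_cut:
  assumes x: "x \<in> L2ad P F T"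
  shows "cut \<tau> x \<in> L2ad P F T"
proof -
  have i: "(\<lambda>t. indicator {..\<tau>} t :: real) \<in> borel_measurable (restrict_space borel {0..T})"
    by (intro measurable_restrict_space1) simp
  have mx: "(\<lambda>z. x (fst z) (snd z)) \<in> borel_measurable (restrict_space borel {0..T} \<Otimes>\<^sub>M P)"
    using x by (simp add: L2ad_def case_prod_beta')
  have "(\<lambda>(t, \<omega>). cut \<tau> x t \<omega>) \<in> borel_measurable (restrict_space borel {0..T} \<Otimes>\<^sub>M P)"
    unfolding cut_def case_prod_beta'
    by (rule borel_measurable_scaleR[OF measurable_compose[OF measurable_fst i] mx])
  moreover have "cut \<tau> x t \<in> borel_measurable (F t)" if "t \<in> {0..T}" for t
  proof -
    have "x t \<in> borel_measurable (F t)" using x that by (simp add: L2ad_def)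
    then show ?thesis unfolding cut_def[abs_def] by (intro borel_measurable_scaleR borel_measurable_const)
  qed
  moreover have "E_int P T (\<lambda>t \<omega>. esq (cut \<tau> x t \<omega>)) < \<infinity>"
  proof (rule le_less_trans)
    show "E_int P T (\<lambda>t \<omega>. esq (cut \<tau> x t \<omega>)) \<le> E_int P T (\<lambda>t \<omega>. esq (x t \<omega>))"
      by (intro E_int_mono) (simp add: cut_def indicator_def)
    show "E_int P T (\<lambda>t \<omega>. esq (x t \<omega>)) < \<infinity>"
      using L2ad_sq(2)[OF x] by simp
  qed
  ultimately show ?thesis by (simp add: L2ad_def E_int_def)
qed

lemma E_int_cut:
  assumes "\<tau> \<le> T"
  shows "E_int P T (\<lambda>t \<omega>. esq (cut \<tau> x t \<omega>)) = E_int P \<tau> (\<lambda>t \<omega>. esq (x t \<omega>))"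
  unfolding E_int_def using assms
  by (intro nn_integral_cong) (auto simp: cut_def split: split_indicator)

text \<open>Fubini for null sets: almost every time section of the exceptional set is null, and
  being measurable it is then null in the product.\<close>

lemma AE_time_prob:
  assumes ae: "AE t in lborel. t \<in> {0..T} \<longrightarrow> (AE \<omega> in P. Q \<omega> t)"
    and m: "{z \<in> space (time_prob P T). Q (fst z) (snd z)} \<in> sets (time_prob P T)"
  shows "AE z in time_prob P T. Q (fst z) (snd z)"
proof -
  have "AE t in restrict_space lborel {0..T}. AE \<omega> in P. Q \<omega> t"
    using ae by (subst AE_restrict_space_iff) auto
  then have "AE \<omega> in P. AE t in restrict_space lborel {0..T}. Q \<omega> t"
    using PR.AE_commute[of Q] m by (simp add: time_prob_def)
  then show ?thesis
    unfolding time_prob_def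
    by (intro PR.AE_pair_measure) (use m in \<open>simp_all add: time_prob_def\<close>)
qed

text \<open>The exceptional set is covered by a null event times [0, T]. This applies to conditions
  quantified over all states, such as closeness of two operators, for which measurability is not at
  hand.\<close>

lemma AE_time_probI:
  assumes "AE \<omega> in P. \<forall>t\<in>{0..T}. Q \<omega> t"
  shows "AE z in time_prob P T. Q (fst z) (snd z)"
proof -
  obtain N where N: "N \<in> null_sets P" "\<And>\<omega>. \<omega> \<in> space P - N \<Longrightarrow> \<forall>t\<in>{0..T}. Q \<omega> t"
    using assms by (auto elim!: AE_E3)
  have "N \<times> space (restrict_space lborel {0..T}) \<in> null_sets (time_prob P T)"
    using N(1) R.emeasure_pair_measure_Times[of N P "space (restrict_space lborel {0..T})"]
      pair_measureI[of N P "space (restrict_space lborel {0..T})"]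
    unfolding time_prob_def null_sets_def by (simp del: space_restrict_space space_lborel space_restrict_space2)
  then show ?thesis
  proof (rule AE_I')
    show "{z \<in> space (time_prob P T). \<not> Q (fst z) (snd z)} \<subseteq> N \<times> space (restrict_space lborel {0..T})"
    proof
      fix z assume "z \<in> {z \<in> space (time_prob P T). \<not> Q (fst z) (snd z)}"
      then have z: "fst z \<in> space P" "snd z \<in> {0..T}" "\<not> Q (fst z) (snd z)"
        by (auto simp: time_prob_def space_pair_measure space_restrict_space)
      then have "fst z \<in> N" using N(2)[of "fst z"] by blast
      then show "z \<in> N \<times> space (restrict_space lborel {0..T})"
        using z(2) by (cases z) (simp add: space_restrict_space)
    qed
  qed
qed

definition cut_sq :: "real \<Rightarrow> (real \<Rightarrow> 'w \<Rightarrow> 'v::euclidean_space) \<Rightarrow> real" where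
  "cut_sq \<tau> x = (\<integral>(\<omega>, t). (norm (cut \<tau> x t \<omega>))\<^sup>2 \<partial>time_prob P T)"

lemma cut_sq_nonneg: "0 \<le> cut_sq \<tau> x"
  unfolding cut_sq_def by (intro Bochner_Integration.integral_nonneg) (simp add: case_prod_beta')

lemma integrable_cut_sq: "x \<in> L2ad P F T \<Longrightarrow> integrable (time_prob P T) (\<lambda>(\<omega>, t). (norm (cut \<tau> x t \<omega>))\<^sup>2)"
  by (rule L2ad_sq(1)[OF L2ad_cut])

lemma E_int_eq_cut_sq:
  "\<tau> \<le> T \<Longrightarrow> x \<in> L2ad P F T \<Longrightarrow> E_int P \<tau> (\<lambda>t \<omega>. esq (x t \<omega>)) = ennreal (cut_sq \<tau> x)"
  using L2ad_sq(2)[OF L2ad_cut, of x \<tau>] E_int_cut[of \<tau> x] by (simp add: cut_sq_def)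

lemma L2_dist_cut:
  "x \<in> L2ad P F T \<Longrightarrow> x' \<in> L2ad P F T \<Longrightarrow>
    (L2_dist P T (cut \<tau> x) (cut \<tau> x'))\<^sup>2 = cut_sq \<tau> (\<lambda>t \<omega>. x t \<omega> - x' t \<omega>)"
  using L2_dist_sq(1)[OF L2ad_cut L2ad_cut, of x x' \<tau> \<tau>]
  by (simp add: cut_sq_def cut_def scaleR_diff_right)

text \<open>With \<open>d = u' - w\<close>, monotonicity of \<open>Fk\<close> and its variational
  inequality bound \<open>Cb\<close> times the squared norm of d by the integral of
  \<open>- (Fk \<bullet> d)\<close>, with \<open>Fk\<close> taken at \<open>(y', w)\<close>. Passing
  from there to \<open>F0\<close> at \<open>(y, u)\<close> costs e (change of arguments, controlled
  by the Lipschitz bound of \<open>F0\<close>) and a term of size \<open>\<epsilon>\<close>; the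
  projection property \<open>proj\<close> disposes of the rest. In \<open>C\<close>, the factor 2
  comes from splitting \<open>u' - u\<close> into d and \<open>w - u\<close>, and 6 is twice the 3
  of the bound for d.\<close>

lemma variational_inequality_estimate:
  fixes y y' :: "real \<Rightarrow> 'w \<Rightarrow> 'y::euclidean_space" and u u' w :: "real \<Rightarrow> 'w \<Rightarrow> 'u::euclidean_space"
    and F0 Fk :: "real \<Rightarrow> 'w \<Rightarrow> 'y \<Rightarrow> 'u \<Rightarrow> 'u"
  assumes T: "0 \<le> T" "\<tau> \<le> T" and Cb: "0 < Cb" and LF: "0 \<le> LF" and \<epsilon>: "0 \<le> \<epsilon>"
    and y: "y \<in> L2ad P F T" and y': "y' \<in> L2ad P F T" and u: "u \<in> L2ad P F T"
    and u': "u' \<in> L2ad P F T" and w: "w \<in> L2ad P F T"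
    and op0: "\<And>y u. y \<in> L2ad P F T \<Longrightarrow> u \<in> L2ad P F T \<Longrightarrow> induced_op F0 y u \<in> L2ad P F T"
    and opk: "\<And>y u. y \<in> L2ad P F T \<Longrightarrow> u \<in> L2ad P F T \<Longrightarrow> induced_op Fk y u \<in> L2ad P F T"
    and lip: "\<And>y1 y2 u1 u2. y1 \<in> L2ad P F T \<Longrightarrow> y2 \<in> L2ad P F T \<Longrightarrow>
          u1 \<in> L2ad P F T \<Longrightarrow> u2 \<in> L2ad P F T \<Longrightarrow>
          L2_dist P T (induced_op F0 y1 u1) (induced_op F0 y2 u2) \<le> LF * (L2_dist P T y1 y2 + L2_dist P T u1 u2)"
    and mono: "\<And>yt u1 u2. yt \<in> L2ad P F T \<Longrightarrow> u1 \<in> L2ad P F T \<Longrightarrow> u2 \<in> L2ad P F T \<Longrightarrow>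
          L2_inner P T (\<lambda>t \<omega>. induced_op Fk yt u1 t \<omega> - induced_op Fk yt u2 t \<omega>) (\<lambda>t \<omega>. u1 t \<omega> - u2 t \<omega>)
            \<ge> Cb * (L2_dist P T u1 u2)\<^sup>2"
    and close: "AE \<omega> in P. \<forall>t\<in>{0..T}. \<forall>y u. norm (Fk t \<omega> y u - F0 t \<omega> y u) \<le> \<epsilon>"
    and vi: "AE (\<omega>, t) in time_prob P T. 0 \<le> Fk t \<omega> (y' t \<omega>) (u' t \<omega>) \<bullet> (w t \<omega> - u' t \<omega>)"
    and proj: "AE (\<omega>, t) in time_prob P T.
        - (F0 t \<omega> (y t \<omega>) (u t \<omega>) \<bullet> (u' t \<omega> - w t \<omega>)) \<le> (w t \<omega> - u t \<omega>) \<bullet> (u' t \<omega> - w t \<omega>)"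
  defines "C \<equiv> 2 + 6 * (1 + 2 * LF\<^sup>2) / Cb\<^sup>2"
  shows "E_int P \<tau> (\<lambda>t \<omega>. esq (u' t \<omega> - u t \<omega>)) \<le>
    ennreal C * (E_int P \<tau> (\<lambda>t \<omega>. esq (y' t \<omega> - y t \<omega>)) + ennreal (\<epsilon>\<^sup>2 * T)
      + E_int P T (\<lambda>t \<omega>. esq (w t \<omega> - u t \<omega>)))"
proof -
  let ?Q = "time_prob P T"
  let ?d = "\<lambda>t \<omega>. u' t \<omega> - w t \<omega>"
  let ?a = "\<lambda>t \<omega>. w t \<omega> - u t \<omega>"
  let ?z = "\<lambda>t \<omega>. y' t \<omega> - y t \<omega>"
  define e where "e t \<omega> = F0 t \<omega> (y t \<omega>) (u t \<omega>) - F0 t \<omega> (y' t \<omega>) (w t \<omega>)" for t \<omega>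
  have d: "?d \<in> L2ad P F T" and a: "?a \<in> L2ad P F T" and z: "?z \<in> L2ad P F T"
    by (rule L2ad_diff[OF u' w], rule L2ad_diff[OF w u], rule L2ad_diff[OF y' y])
  have eL2: "e \<in> L2ad P F T"
    using L2ad_diff[OF op0[OF y u] op0[OF y' w]] by (simp add: e_def[abs_def] induced_op_def)
  have Ne: "cut_sq \<tau> e \<le> 2 * LF\<^sup>2 * (cut_sq \<tau> ?z + cut_sq \<tau> ?a)"
  proof -
    let ?dy = "L2_dist P T (cut \<tau> y) (cut \<tau> y')" and ?du = "L2_dist P T (cut \<tau> u) (cut \<tau> w)"
    let ?G = "induced_op F0 (cut \<tau> y) (cut \<tau> u)" and ?G' = "induced_op F0 (cut \<tau> y') (cut \<tau> w)"
    have G: "?G \<in> L2ad P F T" "?G' \<in> L2ad P F T"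
      by (rule op0[OF L2ad_cut[OF y] L2ad_cut[OF u]], rule op0[OF L2ad_cut[OF y'] L2ad_cut[OF w]])
    \<comment> \<open>After \<open>\<tau>\<close> both operator values are taken at zero arguments,
      so their difference vanishes just as the cut does.\<close>
    have "cut \<tau> e = (\<lambda>t \<omega>. ?G t \<omega> - ?G' t \<omega>)"
      by (intro ext) (auto simp: cut_def e_def induced_op_def split: split_indicator)
    then have "cut_sq \<tau> e = (L2_dist P T ?G ?G')\<^sup>2"
      using L2_dist_sq(1)[OF G] by (simp add: cut_sq_def)
    also have "\<dots> \<le> (LF * (?dy + ?du))\<^sup>2"
      using lip[OF L2ad_cut[OF y] L2ad_cut[OF y'] L2ad_cut[OF u] L2ad_cut[OF w]] L2_dist_sq(3)[OF G]
      by (intro power_mono)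
    also have "\<dots> = LF\<^sup>2 * (?dy + ?du)\<^sup>2" by (simp add: power_mult_distrib)
    also have "\<dots> \<le> LF\<^sup>2 * (2 * (?dy\<^sup>2 + ?du\<^sup>2))"
      using norm_add_sq[of ?dy ?du] by (intro mult_left_mono) auto
    also have "?dy\<^sup>2 = cut_sq \<tau> ?z"
      unfolding L2_dist_cut[OF y y'] by (simp add: cut_sq_def cut_def norm_minus_commute)
    also have "?du\<^sup>2 = cut_sq \<tau> ?a"
      unfolding L2_dist_cut[OF u w] by (simp add: cut_sq_def cut_def norm_minus_commute)
    finally show ?thesis by (simp add: distrib_left mult_ac)
  qed
  let ?cu' = "cut \<tau> u'" and ?cw = "cut \<tau> w"
  \<comment> \<open>Only the shipments are cut, the prices \<open>y'\<close> are not: after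
    \<open>\<tau>\<close> both terms have the same arguments and cancel. Monotonicity can therefore
    be used although it is assumed for a common price process only.\<close>
  let ?H = "\<lambda>t \<omega>. induced_op Fk y' ?cu' t \<omega> - induced_op Fk y' ?cw t \<omega>"
  let ?K = "\<lambda>t \<omega>. ?cu' t \<omega> - ?cw t \<omega>"
  have H: "?H \<in> L2ad P F T" and K: "?K \<in> L2ad P F T"
    by (rule L2ad_diff[OF opk[OF y' L2ad_cut[OF u']] opk[OF y' L2ad_cut[OF w]]],
        rule L2ad_diff[OF L2ad_cut[OF u'] L2ad_cut[OF w]])
  let ?B = "\<lambda>(\<omega>, t). Cb / 2 * (norm (cut \<tau> ?d t \<omega>))\<^sup>2 +
      3 / (2 * Cb) * ((norm (cut \<tau> ?a t \<omega>))\<^sup>2 + (norm (cut \<tau> e t \<omega>))\<^sup>2 + \<epsilon>\<^sup>2)"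
  interpret Q: finite_measure ?Q by (rule finite_measure_time_prob)
  have measQ: "measure ?Q (space ?Q) = T"
  proof -
    have "emeasure ?Q (space ?Q) = emeasure P (space P) * emeasure (restrict_space lborel {0..T}) (space (restrict_space lborel {0..T}))"
      unfolding time_prob_def space_pair_measure by (rule R.emeasure_pair_measure_Times[OF sets.top sets.top])
    also have "\<dots> = ennreal T"
      using T by (simp add: emeasure_space_1 emeasure_restrict_space space_restrict_space)
    finally show ?thesis using T by (simp add: measure_def)
  qed
  \<comment> \<open>Three inner products with d have to be absorbed. The weight
    \<open>Cb / 6\<close> for each adds up to \<open>Cb / 2\<close>, half of what monotonicity
    provides.\<close>
  have young: "p \<bullet> q \<le> Cb / 6 * (norm q)\<^sup>2 + 3 / (2 * Cb) * (norm p)\<^sup>2" for p q :: 'u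
  proof -
    have "p \<bullet> q \<le> norm p * norm q" by (rule norm_cauchy_schwarz)
    moreover have "0 \<le> (Cb * norm q - 3 * norm p)\<^sup>2 / (6 * Cb)" using Cb by simp
    moreover have "(Cb * norm q - 3 * norm p)\<^sup>2 / (6 * Cb) =
        Cb / 6 * (norm q)\<^sup>2 + 3 / (2 * Cb) * (norm p)\<^sup>2 - norm p * norm q"
      using Cb by (simp add: power2_eq_square field_simps)
    ultimately show ?thesis by linarith
  qed
  have "Cb * cut_sq \<tau> ?d = Cb * (L2_dist P T ?cu' ?cw)\<^sup>2"
    using L2_dist_cut[OF u' w] by simp
  also have "\<dots> \<le> L2_inner P T ?H ?K"
    by (rule mono[OF y' L2ad_cut[OF u'] L2ad_cut[OF w]])
  also have "\<dots> = (\<integral>(\<omega>, t). ?H t \<omega> \<bullet> ?K t \<omega> \<partial>?Q)"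
    by (rule L2ad_inner(2)[OF H K])
  also have "\<dots> \<le> (\<integral>z. ?B z \<partial>?Q)"
  proof (rule integral_mono_AE[OF L2ad_inner(1)[OF H K]])
    show "integrable ?Q ?B"
      using integrable_cut_sq[OF d] integrable_cut_sq[OF a] integrable_cut_sq[OF eL2] by (simp add: case_prod_beta')
    show "AE z in ?Q. (case z of (\<omega>, t) \<Rightarrow> ?H t \<omega> \<bullet> ?K t \<omega>) \<le> ?B z"
      using vi proj AE_time_probI[OF close]
    proof eventually_elim
      case (elim z)
      obtain \<omega> t where zz: "z = (\<omega>, t)" by (cases z)
      show ?case
      proof (cases "t \<le> \<tau>")
        case False
        then show ?thesis using Cb by (simp add: zz cut_def)
      next
        case True
        define f where "f = F0 t \<omega> (y' t \<omega>) (w t \<omega>) - Fk t \<omega> (y' t \<omega>) (w t \<omega>)"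
        have f: "(norm f)\<^sup>2 \<le> \<epsilon>\<^sup>2"
          using elim(3) by (intro power_mono) (auto simp: f_def zz norm_minus_commute)
        have "?H t \<omega> \<bullet> ?K t \<omega> = Fk t \<omega> (y' t \<omega>) (u' t \<omega>) \<bullet> ?d t \<omega> - Fk t \<omega> (y' t \<omega>) (w t \<omega>) \<bullet> ?d t \<omega>"
          using True by (simp add: cut_def induced_op_def inner_diff_left)
        also have "\<dots> \<le> - (Fk t \<omega> (y' t \<omega>) (w t \<omega>) \<bullet> ?d t \<omega>)"
          using elim(1) by (simp add: zz inner_diff_right)
        also have "\<dots> = - (F0 t \<omega> (y t \<omega>) (u t \<omega>) \<bullet> ?d t \<omega>) + e t \<omega> \<bullet> ?d t \<omega> + f \<bullet> ?d t \<omega>"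
          by (simp add: e_def f_def inner_diff_left)
        also have "\<dots> \<le> ?a t \<omega> \<bullet> ?d t \<omega> + e t \<omega> \<bullet> ?d t \<omega> + f \<bullet> ?d t \<omega>"
          using elim(2) by (simp add: zz)
        also have "\<dots> \<le> (Cb / 6 * (norm (?d t \<omega>))\<^sup>2 + 3 / (2 * Cb) * (norm (?a t \<omega>))\<^sup>2) +
            (Cb / 6 * (norm (?d t \<omega>))\<^sup>2 + 3 / (2 * Cb) * (norm (e t \<omega>))\<^sup>2) +
            (Cb / 6 * (norm (?d t \<omega>))\<^sup>2 + 3 / (2 * Cb) * (norm f)\<^sup>2)"
          by (intro add_mono young)
        also have "\<dots> \<le> (Cb / 6 * (norm (?d t \<omega>))\<^sup>2 + 3 / (2 * Cb) * (norm (?a t \<omega>))\<^sup>2) +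
            (Cb / 6 * (norm (?d t \<omega>))\<^sup>2 + 3 / (2 * Cb) * (norm (e t \<omega>))\<^sup>2) +
            (Cb / 6 * (norm (?d t \<omega>))\<^sup>2 + 3 / (2 * Cb) * \<epsilon>\<^sup>2)"
          using Cb by (intro add_mono mult_left_mono f order_refl) auto
        also have "\<dots> = ?B (\<omega>, t)"
          using True Cb by (simp add: cut_def field_simps)
        finally show ?thesis by (simp add: zz)
      qed
    qed
  qed
  also have "\<dots> = Cb / 2 * cut_sq \<tau> ?d + 3 / (2 * Cb) * (cut_sq \<tau> ?a + cut_sq \<tau> e + \<epsilon>\<^sup>2 * T)"
    using integrable_cut_sq[OF d] integrable_cut_sq[OF a] integrable_cut_sq[OF eL2] measQ by (simp add: case_prod_beta' cut_sq_def mult.commute)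
  finally have half: "Cb * cut_sq \<tau> ?d \<le> Cb / 2 * cut_sq \<tau> ?d + 3 / (2 * Cb) * (cut_sq \<tau> ?a + cut_sq \<tau> e + \<epsilon>\<^sup>2 * T)" .
  have absorb: "p \<le> p / 2 + r \<Longrightarrow> p / 2 \<le> r" for p r :: real by simp
  have "Cb / 2 * cut_sq \<tau> ?d \<le> 3 / (2 * Cb) * (cut_sq \<tau> ?a + cut_sq \<tau> e + \<epsilon>\<^sup>2 * T)"
    using absorb[of "Cb * cut_sq \<tau> ?d"] half unfolding times_divide_eq_left by blast
  then have Nd: "cut_sq \<tau> ?d \<le> 3 / Cb\<^sup>2 * (cut_sq \<tau> ?a + cut_sq \<tau> e + \<epsilon>\<^sup>2 * T)"
    using Cb by (simp add: field_simps power2_eq_square)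
  let ?S = "cut_sq \<tau> ?z + \<epsilon>\<^sup>2 * T + cut_sq \<tau> ?a"
  have nn: "0 \<le> cut_sq \<tau> ?z" "0 \<le> cut_sq \<tau> ?a" by (rule cut_sq_nonneg)+
  have S: "0 \<le> ?S" using nn T by simp
  have "cut_sq \<tau> ?a + cut_sq \<tau> e + \<epsilon>\<^sup>2 * T \<le> (1 + 2 * LF\<^sup>2) * ?S"
  proof -
    have "0 \<le> cut_sq \<tau> ?z" "0 \<le> LF\<^sup>2 * (\<epsilon>\<^sup>2 * T)" using nn T by auto
    then show ?thesis using Ne by (simp add: algebra_simps)
  qed
  then have "3 / Cb\<^sup>2 * (cut_sq \<tau> ?a + cut_sq \<tau> e + \<epsilon>\<^sup>2 * T) \<le> 3 / Cb\<^sup>2 * ((1 + 2 * LF\<^sup>2) * ?S)"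
    by (rule mult_left_mono) simp
  with Nd have Nd': "cut_sq \<tau> ?d \<le> 3 / Cb\<^sup>2 * ((1 + 2 * LF\<^sup>2) * ?S)" by (rule order_trans)
  have "cut_sq \<tau> (\<lambda>t \<omega>. u' t \<omega> - u t \<omega>) \<le> 2 * (cut_sq \<tau> ?d + cut_sq \<tau> ?a)"
  proof -
    have "cut_sq \<tau> (\<lambda>t \<omega>. u' t \<omega> - u t \<omega>) \<le> (\<integral>(\<omega>, t). 2 * ((norm (cut \<tau> ?d t \<omega>))\<^sup>2 + (norm (cut \<tau> ?a t \<omega>))\<^sup>2) \<partial>?Q)"
      unfolding cut_sq_def
    proof (rule integral_mono[OF integrable_cut_sq[OF L2ad_diff[OF u' u]]])
      show "integrable ?Q (\<lambda>(\<omega>, t). 2 * ((norm (cut \<tau> ?d t \<omega>))\<^sup>2 + (norm (cut \<tau> ?a t \<omega>))\<^sup>2))"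
        using integrable_cut_sq[OF d] integrable_cut_sq[OF a] by (simp add: case_prod_beta')
      fix z
      show "(case z of (\<omega>, t) \<Rightarrow> (norm (cut \<tau> (\<lambda>t \<omega>. u' t \<omega> - u t \<omega>) t \<omega>))\<^sup>2) \<le>
          (case z of (\<omega>, t) \<Rightarrow> 2 * ((norm (cut \<tau> ?d t \<omega>))\<^sup>2 + (norm (cut \<tau> ?a t \<omega>))\<^sup>2))"
        using norm_add_sq[of "?d (snd z) (fst z)" "?a (snd z) (fst z)"]
        by (simp add: case_prod_beta' cut_def split: split_indicator)
    qed
    also have "\<dots> = 2 * (cut_sq \<tau> ?d + cut_sq \<tau> ?a)"
      using integrable_cut_sq[OF d] integrable_cut_sq[OF a] by (simp add: case_prod_beta' cut_sq_def)
    finally show ?thesis .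
  qed
  also have "\<dots> \<le> C * ?S"
  proof -
    have "C * ?S = 2 * ?S + 2 * (3 / Cb\<^sup>2 * ((1 + 2 * LF\<^sup>2) * ?S))"
      unfolding C_def using Cb by (simp add: field_simps)
    moreover have "0 \<le> cut_sq \<tau> ?z + \<epsilon>\<^sup>2 * T" using nn T by simp
    moreover have "c = 2 * (p + q) + 2 * x \<Longrightarrow> 0 \<le> p \<Longrightarrow> r \<le> x \<Longrightarrow> 2 * (r + q) \<le> c" for c p q r x :: real
      by simp
    ultimately show ?thesis using Nd' by blast
  qed
  finally have "ennreal (cut_sq \<tau> (\<lambda>t \<omega>. u' t \<omega> - u t \<omega>)) \<le> ennreal (C * ?S)" by (rule ennreal_leI)
  also have "\<dots> = ennreal C * (ennreal (cut_sq \<tau> ?z) + ennreal (\<epsilon>\<^sup>2 * T) + ennreal (cut_sq \<tau> ?a))"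
  proof -
    have "0 \<le> C" using Cb unfolding C_def by simp
    then show ?thesis using nn T S by (simp add: ennreal_mult)
  qed
  also have "\<dots> \<le> ennreal C * (E_int P \<tau> (\<lambda>t \<omega>. esq (?z t \<omega>)) + ennreal (\<epsilon>\<^sup>2 * T)
      + E_int P T (\<lambda>t \<omega>. esq (?a t \<omega>)))"
    unfolding E_int_eq_cut_sq[OF T(2) z, symmetric] E_int_eq_cut_sq[OF T(2) a, symmetric]
    by (intro mult_left_mono add_mono order_refl E_int_mono_time T(2)) simp
  finally show ?thesis unfolding E_int_eq_cut_sq[OF T(2) L2ad_diff[OF u' u], symmetric] .
qed

end

section \<open>Gronwall's inequality and perturbed coefficients\<close>

lemma exp_tail_integral:
  fixes \<kappa> r T :: real
  assumes "0 < \<kappa>" "r \<le> T"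
  shows "(\<integral>\<^sup>+t\<in>{r..T}. ennreal (exp (- \<kappa> * t)) \<partial>lborel) \<le> ennreal (exp (- \<kappa> * r) / \<kappa>)"
proof -
  have "(\<integral>\<^sup>+t\<in>{r..T}. ennreal (exp (- \<kappa> * t)) \<partial>lborel) = ennreal (- exp (- \<kappa> * T) / \<kappa> - (- exp (- \<kappa> * r) / \<kappa>))"
  proof (rule nn_integral_FTC_Icc[where F="\<lambda>t. - exp (- \<kappa> * t) / \<kappa>"])
    show "DERIV (\<lambda>t. - exp (- \<kappa> * t) / \<kappa>) t :> exp (- \<kappa> * t)" for t
      using assms(1) by (auto intro!: derivative_eq_intros)
  qed (use assms in auto)
  also have "\<dots> \<le> ennreal (exp (- \<kappa> * r) / \<kappa>)"
    using assms(1) by (intro ennreal_leI) (simp add: field_simps)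
  finally show ?thesis .
qed

text \<open>Integrating against the weight \<open>exp (- \<kappa> t)\<close> with \<open>\<kappa> = 2 a\<close> makes the integral term on the right
  at most half of the left-hand side.\<close>

lemma gronwall_integral:
  fixes e :: "real \<Rightarrow> ennreal"
  assumes e [measurable]: "e \<in> borel_measurable borel" and a: "0 < a" and T: "0 \<le> T"
    and le: "\<And>t. t \<in> {0..T} \<Longrightarrow> e t \<le> ennreal a * (\<eta> + (\<integral>\<^sup>+r\<in>{0..t}. e r \<partial>lborel))"
    and fin: "(\<integral>\<^sup>+r\<in>{0..T}. e r \<partial>lborel) < \<infinity>"
  shows "(\<integral>\<^sup>+r\<in>{0..T}. e r \<partial>lborel) \<le> ennreal (2 * a * T * exp (2 * a * T)) * \<eta>"
proof -
  define \<kappa> where "\<kappa> = 2 * a"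
  have \<kappa>: "0 < \<kappa>" using a by (simp add: \<kappa>_def)
  define W where "W = (\<integral>\<^sup>+t\<in>{0..T}. (ennreal (exp (- \<kappa> * t)) * e t) \<partial>lborel)"
  have "W \<le> (\<integral>\<^sup>+t\<in>{0..T}. e t \<partial>lborel)"
    unfolding W_def
  proof (rule nn_integral_mono)
    fix t
    have "ennreal (exp (- \<kappa> * t)) \<le> 1" if "0 \<le> t" using \<kappa> that by simp
    then show "ennreal (exp (- \<kappa> * t)) * e t * indicator {0..T} t \<le> e t * indicator {0..T} t"
      using mult_right_mono[of "ennreal (exp (- \<kappa> * t))" 1 "e t"] by (auto split: split_indicator)
  qed
  \<comment> \<open>In \<open>ennreal\<close> the term \<open>W / 2\<close> can be absorbed only if
    W is finite; this is where the assumption \<open>fin\<close> is spent.\<close>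
  then have Wfin: "W < \<infinity>" using fin by (rule le_less_trans)
  have "W \<le> (\<integral>\<^sup>+t. (ennreal a * \<eta>) * indicator {0..T} t +
      ennreal a * (\<integral>\<^sup>+r. e r * indicator {0..T} r * (ennreal (exp (- \<kappa> * t)) * indicator {r..T} t) \<partial>lborel) \<partial>lborel)"
    unfolding W_def
  proof (rule nn_integral_mono)
    fix t
    show "ennreal (exp (- \<kappa> * t)) * e t * indicator {0..T} t \<le> (ennreal a * \<eta>) * indicator {0..T} t +
      ennreal a * (\<integral>\<^sup>+r. e r * indicator {0..T} r * (ennreal (exp (- \<kappa> * t)) * indicator {r..T} t) \<partial>lborel)"
    proof (cases "t \<in> {0..T}")
      case True
      have "ennreal (exp (- \<kappa> * t)) * e t \<le> ennreal (exp (- \<kappa> * t)) * (ennreal a * (\<eta> + (\<integral>\<^sup>+r\<in>{0..t}. e r \<partial>lborel)))"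
        using le[OF True] by (rule mult_left_mono) simp
      also have "\<dots> = ennreal (exp (- \<kappa> * t)) * (ennreal a * \<eta>) + ennreal a * (ennreal (exp (- \<kappa> * t)) * (\<integral>\<^sup>+r\<in>{0..t}. e r \<partial>lborel))"
        by (simp add: algebra_simps)
      also have "ennreal (exp (- \<kappa> * t)) * (\<integral>\<^sup>+r\<in>{0..t}. e r \<partial>lborel) =
          (\<integral>\<^sup>+r. ennreal (exp (- \<kappa> * t)) * (e r * indicator {0..t} r) \<partial>lborel)"
        by (rule nn_integral_cmult[symmetric]) measurable
      also have "\<dots> = (\<integral>\<^sup>+r. e r * indicator {0..T} r * (ennreal (exp (- \<kappa> * t)) * indicator {r..T} t) \<partial>lborel)"
        using True by (intro nn_integral_cong) (auto split: split_indicator simp: mult.commute)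
      also have "ennreal (exp (- \<kappa> * t)) * (ennreal a * \<eta>) \<le> ennreal a * \<eta>"
        using True \<kappa> mult_right_mono[of "ennreal (exp (- \<kappa> * t))" 1 "ennreal a * \<eta>"] by simp
      finally show ?thesis using True by (simp add: add_right_mono)
    qed simp
  qed
  also have "\<dots> = ennreal a * \<eta> * ennreal T + ennreal a *
      (\<integral>\<^sup>+t. (\<integral>\<^sup>+r. e r * indicator {0..T} r * (ennreal (exp (- \<kappa> * t)) * indicator {r..T} t) \<partial>lborel) \<partial>lborel)"
  proof -
    have [measurable]: "(\<lambda>z. indicator {snd z..T} (fst z) :: ennreal) \<in> borel_measurable (borel \<Otimes>\<^sub>M borel)"
    proof -
      have "(\<lambda>z. indicator {snd z..T} (fst z) :: ennreal) = indicator {z. snd z \<le> fst z \<and> fst z \<le> T}"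
        by (auto split: split_indicator)
      then show ?thesis by simp
    qed
    have "(\<lambda>(t, r). e r * indicator {0..T} r * (ennreal (exp (- \<kappa> * t)) * indicator {r..T} t)) \<in> borel_measurable (borel \<Otimes>\<^sub>M lborel)"
      unfolding measurable_cong_sets[OF sets_pair_measure_cong[OF refl sets_lborel] refl] case_prod_beta' by measurable
    from sigma_finite_measure.borel_measurable_nn_integral[OF sigma_finite_lborel this]
    show ?thesis
      using T by (simp add: nn_integral_add nn_integral_cmult)
  qed
  \<comment> \<open>Exchanging the integrals over the triangle \<open>r \<le> t\<close> leaves an
    exponential tail, which gains the factor \<open>1 / \<kappa>\<close>.\<close>
  also have "(\<integral>\<^sup>+t. (\<integral>\<^sup>+r. e r * indicator {0..T} r * (ennreal (exp (- \<kappa> * t)) * indicator {r..T} t) \<partial>lborel) \<partial>lborel) =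
      (\<integral>\<^sup>+r. (\<integral>\<^sup>+t. e r * indicator {0..T} r * (ennreal (exp (- \<kappa> * t)) * indicator {r..T} t) \<partial>lborel) \<partial>lborel)"
  proof -
    have [measurable]: "(\<lambda>z. indicator {snd z..T} (fst z) :: ennreal) \<in> borel_measurable (lborel \<Otimes>\<^sub>M lborel)"
    proof -
      have "(\<lambda>z. indicator {snd z..T} (fst z) :: ennreal) = indicator {z. snd z \<le> fst z \<and> fst z \<le> T}"
        by (auto split: split_indicator)
      then show ?thesis
        unfolding measurable_cong_sets[OF sets_pair_measure_cong[OF sets_lborel sets_lborel] refl] by simp
    qed
    show ?thesis
      by (rule lborel_pair.Fubini'[symmetric]) (simp add: case_prod_beta')
  qed
  also have "\<dots> = (\<integral>\<^sup>+r. e r * indicator {0..T} r * (\<integral>\<^sup>+t\<in>{r..T}. ennreal (exp (- \<kappa> * t)) \<partial>lborel) \<partial>lborel)"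
    by (intro nn_integral_cong nn_integral_cmult) measurable
  also have "\<dots> \<le> (\<integral>\<^sup>+r. ennreal (1 / \<kappa>) * (ennreal (exp (- \<kappa> * r)) * e r * indicator {0..T} r) \<partial>lborel)"
  proof (rule nn_integral_mono)
    fix r
    show "e r * indicator {0..T} r * (\<integral>\<^sup>+t\<in>{r..T}. ennreal (exp (- \<kappa> * t)) \<partial>lborel) \<le>
        ennreal (1 / \<kappa>) * (ennreal (exp (- \<kappa> * r)) * e r * indicator {0..T} r)"
    proof (cases "r \<in> {0..T}")
      case True
      have "e r * (\<integral>\<^sup>+t\<in>{r..T}. ennreal (exp (- \<kappa> * t)) \<partial>lborel) \<le> e r * ennreal (exp (- \<kappa> * r) / \<kappa>)"
        using exp_tail_integral[OF \<kappa>, of r T] True by (intro mult_left_mono) auto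
      also have "ennreal (exp (- \<kappa> * r) / \<kappa>) = ennreal (1 / \<kappa>) * ennreal (exp (- \<kappa> * r))"
        using \<kappa> by (simp flip: ennreal_mult)
      finally show ?thesis using True by (simp add: mult_ac)
    qed simp
  qed
  also have "\<dots> = ennreal (1 / \<kappa>) * W"
    unfolding W_def by (rule nn_integral_cmult) measurable
  finally have "W \<le> ennreal a * \<eta> * ennreal T + ennreal a * (ennreal (1 / \<kappa>) * W)"
    by (simp add: add_left_mono mult_left_mono)
  also have "ennreal a * (ennreal (1 / \<kappa>) * W) = ennreal (1 / 2) * W"
    using a by (simp add: \<kappa>_def mult.assoc[symmetric] ennreal_mult[symmetric])
  finally have half: "W \<le> ennreal a * \<eta> * ennreal T + ennreal (1 / 2) * W" .
  have W: "W \<le> 2 * (ennreal a * \<eta> * ennreal T)"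
  proof (cases "ennreal a * \<eta> * ennreal T < \<infinity>")
    case True
    obtain w x where w: "W = ennreal w" "0 \<le> w" and x: "ennreal a * \<eta> * ennreal T = ennreal x" "0 \<le> x"
      using Wfin True by (metis ennreal_cases infinity_ennreal_def less_irrefl)
    have "ennreal w \<le> ennreal x + ennreal (1 / 2) * ennreal w"
      using half by (simp only: w(1) x(1))
    also have "\<dots> = ennreal (x + 1 / 2 * w)"
      by (simp only: ennreal_mult''[OF w(2)] ennreal_plus[OF x(2) mult_nonneg_nonneg[OF _ w(2), of "1 / 2"]])
    finally have "w \<le> x + 1 / 2 * w"
      using w(2) x(2) by (subst (asm) ennreal_le_iff) auto
    then have "ennreal w \<le> ennreal (2 * x)" by (intro ennreal_leI) simp
    then show ?thesis unfolding w(1) x(1) using x(2) by (simp add: ennreal_mult)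
  next
    case False
    then have "ennreal a * \<eta> * ennreal T = \<top>" by (simp only: infinity_ennreal_def less_top[symmetric] not_not)
    then have "2 * (ennreal a * \<eta> * ennreal T) = \<top>" by (simp only: ennreal_mult_top) simp
    then show ?thesis by simp
  qed
  have "(\<integral>\<^sup>+r\<in>{0..T}. e r \<partial>lborel) \<le> (\<integral>\<^sup>+r. ennreal (exp (\<kappa> * T)) * (ennreal (exp (- \<kappa> * r)) * e r * indicator {0..T} r) \<partial>lborel)"
  proof (rule nn_integral_mono)
    fix r
    have "1 \<le> ennreal (exp (\<kappa> * T)) * ennreal (exp (- \<kappa> * r))" if "r \<le> T"
    proof -
      have "0 \<le> \<kappa> * (T - r)" using \<kappa> that by simp
      then have "1 \<le> exp (\<kappa> * T) * exp (- \<kappa> * r)" by (simp add: exp_add[symmetric] algebra_simps)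
      then show ?thesis by (simp flip: ennreal_mult)
    qed
    then show "e r * indicator {0..T} r \<le> ennreal (exp (\<kappa> * T)) * (ennreal (exp (- \<kappa> * r)) * e r * indicator {0..T} r)"
      using mult_right_mono[of 1 "ennreal (exp (\<kappa> * T)) * ennreal (exp (- \<kappa> * r))" "e r"]
      by (auto split: split_indicator simp: mult.assoc)
  qed
  also have "\<dots> = ennreal (exp (\<kappa> * T)) * W"
    unfolding W_def by (rule nn_integral_cmult) measurable
  also have "\<dots> \<le> ennreal (exp (\<kappa> * T)) * (2 * (ennreal a * \<eta> * ennreal T))"
    by (rule mult_left_mono[OF W]) simp
  also have "\<dots> = ennreal (2 * a * T * exp (2 * a * T)) * \<eta>"
    using a T by (simp add: \<kappa>_def ennreal_mult mult_ac)
  finally show ?thesis .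
qed

section \<open>Comparison of the coefficients at two parameters\<close>

lemma norm_block_sq:
  "(norm (block h1 h2 t \<omega> y u - block h1' h2' t \<omega> y' u'))\<^sup>2 =
    (norm (h1 t \<omega> (fst y) (fst u) - h1' t \<omega> (fst y') (fst u')))\<^sup>2 +
    (norm (h2 t \<omega> (snd y) (fst (snd u)) - h2' t \<omega> (snd y') (fst (snd u'))))\<^sup>2"
  by (simp add: block_def norm_Pair)

lemma norm_block_sq0:
  "(norm (block h1 h2 t \<omega> y u))\<^sup>2 = (norm (h1 t \<omega> (fst y) (fst u)))\<^sup>2 + (norm (h2 t \<omega> (snd y) (fst (snd u))))\<^sup>2"
  by (simp add: block_def norm_Pair)

lemma jump_norm_sq_triangle:
  assumes g: "g \<in> borel_measurable v" and h: "h \<in> borel_measurable v" and k: "k \<in> borel_measurable v"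
    and v: "levy_intensity v"
  shows "jump_norm_sq c v (\<lambda>z. g z - k z) \<le> 2 * (jump_norm_sq c v (\<lambda>z. g z - h z) + jump_norm_sq c v (\<lambda>z. h z - k z))"
proof -
  have sets: "sets v = sets (restrict_space borel (- {0}))" using v by (simp add: levy_intensity_def)
  have i [measurable]: "(\<lambda>x. indicator {x. norm x < c} x :: ennreal) \<in> borel_measurable v"
    unfolding measurable_cong_sets[OF sets refl]
    by (intro measurable_restrict_space1 borel_measurable_indicator) simp
  note [measurable] = g h k
  have "jump_norm_sq c v (\<lambda>z. g z - k z) \<le> (\<integral>\<^sup>+z. 2 * (esq (g z - h z) * indicator {x. norm x < c} z +
      esq (h z - k z) * indicator {x. norm x < c} z) \<partial>v)"
    unfolding jump_norm_sq_def
  proof (rule nn_integral_mono)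
    fix z
    have "esq (g z - k z) \<le> ennreal (2 * ((norm (g z - h z))\<^sup>2 + (norm (h z - k z))\<^sup>2))"
      using norm_add_sq[of "g z - h z" "h z - k z"] by (intro ennreal_leI) simp
    also have "\<dots> = 2 * (esq (g z - h z) + esq (h z - k z))"
      by (subst ennreal_mult) (auto simp del: distrib_left_numeral)
    finally show "esq (g z - k z) * indicator {x. norm x < c} z \<le>
        2 * (esq (g z - h z) * indicator {x. norm x < c} z +
          esq (h z - k z) * indicator {x. norm x < c} z)"
      by (auto split: split_indicator simp del: distrib_left_numeral)
  qed
  also have "\<dots> = 2 * (jump_norm_sq c v (\<lambda>z. g z - h z) + jump_norm_sq c v (\<lambda>z. h z - k z))"
    unfolding jump_norm_sq_def by (simp add: nn_integral_cmult nn_integral_add del: distrib_left_numeral)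
  finally show ?thesis .
qed

lemma jump_coeff_measurable:
  assumes "adapted_jump_coeff P F T v g" "t \<in> {0..T}" "\<omega> \<in> space P"
  shows "g t \<omega> x s \<in> borel_measurable v"
proof -
  have m: "(\<lambda>(t, \<omega>, x, s, z). g t \<omega> x s z)
      \<in> borel_measurable (restrict_space borel {0..T} \<Otimes>\<^sub>M P \<Otimes>\<^sub>M borel \<Otimes>\<^sub>M borel \<Otimes>\<^sub>M v)"
    using assms(1) by (auto simp: adapted_jump_coeff_def)
  have "(\<lambda>z. (t, \<omega>, x, s, z)) \<in> v \<rightarrow>\<^sub>M restrict_space borel {0..T} \<Otimes>\<^sub>M P \<Otimes>\<^sub>M borel \<Otimes>\<^sub>M borel \<Otimes>\<^sub>M v"
    using assms(2,3) by (intro measurable_Pair measurable_const) (auto simp: space_restrict_space)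
  from measurable_compose[OF this m] show ?thesis by simp
qed

lemma jump_sq_diff:
  "jump_sq c v1 v2 (jump_diff (block G1 G2 t \<omega> y u) (block G1' G2' t \<omega> y' u')) =
    jump_norm_sq c v1 (\<lambda>z. G1 t \<omega> (fst y) (fst u) z - G1' t \<omega> (fst y') (fst u') z) +
    jump_norm_sq c v2 (\<lambda>z. G2 t \<omega> (snd y) (fst (snd u)) z - G2' t \<omega> (snd y') (fst (snd u')) z)"
  by (simp add: jump_sq_def jump_diff_def block_def jump_norm_sq_def)

text \<open>Growth reduces the claim to the paths of y and u, whose squares have finite time
  integrals almost surely because their expectations are finite. This makes the drift and the
  fractional term of a solution genuine integrals.\<close>

lemma linear_growth_integral_finite:
  assumes cf: "complete_filtered_prob_space P F" and T: "0 \<le> T" and g: "linear_growth P T h K" and K: "0 < K"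
    and y: "y \<in> L2ad P F T" and u: "u \<in> L2ad P F T"
  shows "AE \<omega> in P. (\<integral>\<^sup>+r\<in>{0..T}. esq (h r \<omega> (y r \<omega>) (u r \<omega>)) \<partial>lborel) < \<infinity>"
proof -
  have path: "(\<lambda>\<omega>. \<integral>\<^sup>+r\<in>{0..T}. esq (x r \<omega>) \<partial>lborel) \<in> borel_measurable P"
      "\<omega> \<in> space P \<Longrightarrow> (\<lambda>r. esq (x r \<omega>) * indicator {0..T} r) \<in> borel_measurable lborel"
    if "x \<in> L2ad P F T" for x :: "real \<Rightarrow> 'a \<Rightarrow> 'v::euclidean_space" and \<omega>
  proof -
    define q where "q r \<omega> = esq (x (max 0 (min T r)) \<omega>)" for r \<omega>
    have "(\<lambda>(r, \<omega>). x (max 0 (min T r)) \<omega>) \<in> borel_measurable (borel \<Otimes>\<^sub>M P)"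
      using that by (intro joint_measurable_clamp[OF T]) (simp add: L2ad_def)
    then have q: "(\<lambda>(r, \<omega>). q r \<omega>) \<in> borel_measurable (borel \<Otimes>\<^sub>M P)"
      unfolding q_def case_prod_beta' by measurable
    have eq: "esq (x r \<omega>) * indicator {0..T} r = q r \<omega> * indicator {0..T} r" for r \<omega>
      by (auto simp: q_def split: split_indicator)
    show "(\<lambda>\<omega>. \<integral>\<^sup>+r\<in>{0..T}. esq (x r \<omega>) \<partial>lborel) \<in> borel_measurable P"
      unfolding eq by (rule measurable_time_integral(1)[OF q])
    show "\<omega> \<in> space P \<Longrightarrow> (\<lambda>r. esq (x r \<omega>) * indicator {0..T} r) \<in> borel_measurable lborel"
      unfolding eq using measurable_time_integral(2)[OF q] by measurable
  qed
  have fin: "AE \<omega> in P. (\<integral>\<^sup>+r\<in>{0..T}. esq (x r \<omega>) \<partial>lborel) \<noteq> \<infinity>"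
    if "x \<in> L2ad P F T" for x :: "real \<Rightarrow> 'a \<Rightarrow> 'v::euclidean_space"
    using path(1)[OF that] that by (intro nn_integral_noteq_infinite) (auto simp: L2ad_def)
  show ?thesis
    using fin[OF y] fin[OF u] g[unfolded linear_growth_def] AE_space
  proof eventually_elim
    case (elim \<omega>)
    note [measurable] = path(2)[OF y elim(4)] path(2)[OF u elim(4)]
    have "(\<integral>\<^sup>+r\<in>{0..T}. esq (h r \<omega> (y r \<omega>) (u r \<omega>)) \<partial>lborel) \<le>
        (\<integral>\<^sup>+r. ennreal K * (indicator {0..T} r + esq (y r \<omega>) * indicator {0..T} r +
          esq (u r \<omega>) * indicator {0..T} r) \<partial>lborel)"
    proof (rule nn_integral_mono)
      fix r
      have "ennreal (K * (1 + (norm (y r \<omega>))\<^sup>2 + (norm (u r \<omega>))\<^sup>2)) =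
          ennreal K * (1 + esq (y r \<omega>) + esq (u r \<omega>))"
        using K by (simp add: ennreal_mult)
      then have "esq (h r \<omega> (y r \<omega>) (u r \<omega>)) \<le>
          ennreal K * (1 + esq (y r \<omega>) + esq (u r \<omega>))" if "r \<in> {0..T}"
        using elim(3) that by (metis ennreal_leI)
      then show "esq (h r \<omega> (y r \<omega>) (u r \<omega>)) * indicator {0..T} r \<le>
          ennreal K * (indicator {0..T} r + esq (y r \<omega>) * indicator {0..T} r +
          esq (u r \<omega>) * indicator {0..T} r)"
        by (auto split: split_indicator)
    qed
    also have "\<dots> = ennreal K * ((\<integral>\<^sup>+r. indicator {0..T} r \<partial>lborel) +
        (\<integral>\<^sup>+r\<in>{0..T}. esq (y r \<omega>) \<partial>lborel) + (\<integral>\<^sup>+r\<in>{0..T}. esq (u r \<omega>) \<partial>lborel))"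
      by (simp add: nn_integral_cmult nn_integral_add)
    also have "\<dots> < \<infinity>"
      using elim(1,2) by (simp add: ennreal_mult_less_top less_top emeasure_lborel_Icc_eq)
    finally show ?case .
  qed
qed

text \<open>The intermediate value is \<open>h\<close> at the perturbed state: replacing
  \<open>h'\<close> by \<open>h\<close> there costs \<open>\<epsilon>\<close>, and moving the state
  uses the Lipschitz constant of \<open>h\<close>. Inserting \<open>h'\<close> at the limiting state
  instead would bring in the constant of \<open>h'\<close>, for which no uniform bound along the
  sequence is available.\<close>

lemma coeff_perturbation:
  assumes lip: "lipschitz_coeff P T h L"
    and close: "AE \<omega> in P. \<forall>t\<in>{0..T}. \<forall>y u. norm (h' t \<omega> y u - h t \<omega> y u) < \<epsilon>"
  shows "AE \<omega> in P. \<forall>t\<in>{0..T}. \<forall>y u y' u'. esq (h' t \<omega> y' u' - h t \<omega> y u) \<le>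
    ennreal (2 * \<epsilon>\<^sup>2 + 2 * L * ((norm (y' - y))\<^sup>2 + (norm (u' - u))\<^sup>2))"
  using lip[unfolded lipschitz_coeff_def] close
proof eventually_elim
  case (elim \<omega>)
  show ?case
  proof (intro ballI allI ennreal_leI)
    fix t y u y' u' assume t: "t \<in> {0..T}"
    have "(norm (h' t \<omega> y' u' - h t \<omega> y u))\<^sup>2 \<le>
        2 * ((norm (h' t \<omega> y' u' - h t \<omega> y' u'))\<^sup>2 + (norm (h t \<omega> y' u' - h t \<omega> y u))\<^sup>2)"
      using norm_add_sq[of "h' t \<omega> y' u' - h t \<omega> y' u'" "h t \<omega> y' u' - h t \<omega> y u"] by simp
    also have "\<dots> \<le> 2 * (\<epsilon>\<^sup>2 + L * ((norm (y' - y))\<^sup>2 + (norm (u' - u))\<^sup>2))"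
    proof (intro mult_left_mono add_mono)
      have "norm (h' t \<omega> y' u' - h t \<omega> y' u') < \<epsilon>" using elim(2) t by blast
      then show "(norm (h' t \<omega> y' u' - h t \<omega> y' u'))\<^sup>2 \<le> \<epsilon>\<^sup>2" by (intro power_mono) auto
      show "(norm (h t \<omega> y' u' - h t \<omega> y u))\<^sup>2 \<le> L * ((norm (y' - y))\<^sup>2 + (norm (u' - u))\<^sup>2)"
        using elim(1) t by blast
    qed simp
    also have "\<dots> = 2 * \<epsilon>\<^sup>2 + 2 * L * ((norm (y' - y))\<^sup>2 + (norm (u' - u))\<^sup>2)"
      by (simp add: algebra_simps)
    finally show "(norm (h' t \<omega> y' u' - h t \<omega> y u))\<^sup>2 \<le> 2 * \<epsilon>\<^sup>2 + 2 * L * ((norm (y' - y))\<^sup>2 + (norm (u' - u))\<^sup>2)" .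
  qed
qed

text \<open>The same interposition in the mark integrals. Closeness and Lipschitz bounds are given
  for the sum over the two markets, and each nonnegative summand inherits them.\<close>

lemma jump_coeff_perturbation:
  fixes G1 G1' :: "real \<Rightarrow> 'w \<Rightarrow> real^'m \<Rightarrow> real^'m \<Rightarrow> 'e::euclidean_space \<Rightarrow> 'v::euclidean_space"
    and G2 G2' :: "real \<Rightarrow> 'w \<Rightarrow> real^'n \<Rightarrow> real^'n \<Rightarrow> 'f::euclidean_space \<Rightarrow> 'z::euclidean_space"
    and y y' :: "real \<Rightarrow> 'w \<Rightarrow> (real^'m) \<times> (real^'n)"
    and u u' :: "real \<Rightarrow> 'w \<Rightarrow> (real^'m) \<times> (real^'n) \<times> (real^'n^'m)"
  assumes v: "levy_intensity v1" "levy_intensity v2" and L: "0 \<le> L"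
    and coeff: "adapted_jump_coeff P F T v1 G1" "adapted_jump_coeff P F T v2 G2"
      "adapted_jump_coeff P F T v1 G1'" "adapted_jump_coeff P F T v2 G2'"
    and lip: "jump_lipschitz P T c v1 v2 (block G1 G2 :: real \<Rightarrow> 'w \<Rightarrow> (real^'m) \<times> (real^'n) \<Rightarrow> (real^'m) \<times> (real^'n) \<times> (real^'n^'m) \<Rightarrow> _) L"
    and close: "AE \<omega> in P. \<forall>t\<in>{0..T}. \<forall>y (u :: (real^'m) \<times> (real^'n) \<times> (real^'n^'m)).
        jump_sq c v1 v2 (jump_diff (block G1' G2' t \<omega> y u) (block G1 G2 t \<omega> y u)) < ennreal (\<epsilon>\<^sup>2)"
  shows "AE \<omega> in P. \<forall>t\<in>{0..T}.
    jump_norm_sq c v1 (\<lambda>z. G1' t \<omega> (fst (y' t \<omega>)) (fst (u' t \<omega>)) z - G1 t \<omega> (fst (y t \<omega>)) (fst (u t \<omega>)) z) \<le>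
      ennreal (2 * \<epsilon>\<^sup>2 + 2 * L * ((norm (y' t \<omega> - y t \<omega>))\<^sup>2 + (norm (u' t \<omega> - u t \<omega>))\<^sup>2)) \<and>
    jump_norm_sq c v2 (\<lambda>z. G2' t \<omega> (snd (y' t \<omega>)) (fst (snd (u' t \<omega>))) z - G2 t \<omega> (snd (y t \<omega>)) (fst (snd (u t \<omega>))) z) \<le>
      ennreal (2 * \<epsilon>\<^sup>2 + 2 * L * ((norm (y' t \<omega> - y t \<omega>))\<^sup>2 + (norm (u' t \<omega> - u t \<omega>))\<^sup>2))"
  using lip[unfolded jump_lipschitz_def] close AE_space
proof eventually_elim
  case (elim \<omega>)
  show ?case
  proof (rule ballI)
    fix t assume t: "t \<in> {0..T}"
    let ?y = "y t \<omega>" and ?y' = "y' t \<omega>" and ?u = "u t \<omega>" and ?u' = "u' t \<omega>"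
    let ?l = "L * ((norm (?y' - ?y))\<^sup>2 + (norm (?u' - ?u))\<^sup>2)"
    have 1: "jump_norm_sq c v1 (\<lambda>z. G1' t \<omega> (fst ?y') (fst ?u') z - G1 t \<omega> (fst ?y') (fst ?u') z) +
        jump_norm_sq c v2 (\<lambda>z. G2' t \<omega> (snd ?y') (fst (snd ?u')) z - G2 t \<omega> (snd ?y') (fst (snd ?u')) z) \<le> ennreal (\<epsilon>\<^sup>2)"
      using elim(2)[rule_format, OF t, of ?y' ?u'] unfolding jump_sq_diff by (rule less_imp_le)
    have 2: "jump_norm_sq c v1 (\<lambda>z. G1 t \<omega> (fst ?y') (fst ?u') z - G1 t \<omega> (fst ?y) (fst ?u) z) +
        jump_norm_sq c v2 (\<lambda>z. G2 t \<omega> (snd ?y') (fst (snd ?u')) z - G2 t \<omega> (snd ?y) (fst (snd ?u)) z) \<le> ennreal ?l"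
      using elim(1)[rule_format, OF t, of ?y' ?u' ?y ?u] unfolding jump_sq_diff .
    have le1: "a \<le> C" and le2: "b \<le> C" if "a + b \<le> C" for a b C :: ennreal
      by (rule order_trans[OF _ that], simp)+
    have tot: "x \<le> ennreal (2 * \<epsilon>\<^sup>2 + 2 * ?l)" if x: "x \<le> 2 * (p + q)" and p: "p \<le> ennreal (\<epsilon>\<^sup>2)" and q: "q \<le> ennreal ?l"
      for x p q :: ennreal
    proof -
      have "x \<le> 2 * (ennreal (\<epsilon>\<^sup>2) + ennreal ?l)"
        using x by (rule order_trans) (intro mult_left_mono add_mono p q, simp)
      also have "\<dots> = ennreal (2 * (\<epsilon>\<^sup>2 + ?l))"
        using L by (subst ennreal_mult) (auto simp del: distrib_left_numeral)
      finally show ?thesis by (simp add: distrib_left)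
    qed
    show "jump_norm_sq c v1 (\<lambda>z. G1' t \<omega> (fst ?y') (fst ?u') z - G1 t \<omega> (fst ?y) (fst ?u) z) \<le>
          ennreal (2 * \<epsilon>\<^sup>2 + 2 * L * ((norm (?y' - ?y))\<^sup>2 + (norm (?u' - ?u))\<^sup>2)) \<and>
        jump_norm_sq c v2 (\<lambda>z. G2' t \<omega> (snd ?y') (fst (snd ?u')) z - G2 t \<omega> (snd ?y) (fst (snd ?u)) z) \<le>
          ennreal (2 * \<epsilon>\<^sup>2 + 2 * L * ((norm (?y' - ?y))\<^sup>2 + (norm (?u' - ?u))\<^sup>2))"
      using tot[OF jump_norm_sq_triangle[OF jump_coeff_measurable[OF coeff(3) t elim(3)]
            jump_coeff_measurable[OF coeff(1) t elim(3)] jump_coeff_measurable[OF coeff(1) t elim(3)] v(1)] le1[OF 1] le1[OF 2]]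
        tot[OF jump_norm_sq_triangle[OF jump_coeff_measurable[OF coeff(4) t elim(3)]
            jump_coeff_measurable[OF coeff(2) t elim(3)] jump_coeff_measurable[OF coeff(2) t elim(3)] v(2)] le2[OF 1] le2[OF 2]]
      by (simp add: mult.assoc)
  qed
qed

lemma L2ad_compose_measurable:
  assumes "x \<in> L2ad P F T" and f: "f \<in> borel_measurable borel"
  shows "(\<lambda>(t, \<omega>). f (x t \<omega>)) \<in> borel_measurable (restrict_space borel {0..T} \<Otimes>\<^sub>M P)"
proof -
  have "(\<lambda>(t, \<omega>). x t \<omega>) \<in> borel_measurable (restrict_space borel {0..T} \<Otimes>\<^sub>M P)"
    using assms(1) by (simp add: L2ad_def)
  from measurable_compose[OF this f] show ?thesis by (simp add: case_prod_beta')
qed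

lemma measurable_projections:
  "(fst :: 'a::euclidean_space \<times> 'b::euclidean_space \<Rightarrow> 'a) \<in> borel_measurable borel"
  "(snd :: 'a \<times> 'b \<Rightarrow> 'b) \<in> borel_measurable borel"
  by (intro borel_measurable_continuous_onI continuous_intros)+

lemma L2ad_sq_joint_clamp:
  assumes "x \<in> L2ad P F T" "0 \<le> T"
  shows "(\<lambda>(r, \<omega>). esq (x (max 0 (min T r)) \<omega>)) \<in> borel_measurable (borel \<Otimes>\<^sub>M P)"
proof -
  have "(\<lambda>(r, \<omega>). x (max 0 (min T r)) \<omega>) \<in> borel_measurable (borel \<Otimes>\<^sub>M P)"
    using assms(1) by (intro joint_measurable_clamp[OF assms(2)]) (simp add: L2ad_def)
  then show ?thesis unfolding case_prod_beta' by measurable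
qed

text \<open>Splitting the integral requires integrands measurable for all times; frozen versions of
  the processes are used in between and agree with them on \<open>[0, t]\<close>.\<close>

lemma E_int_affine:
  assumes cf: "complete_filtered_prob_space P F" and x: "x \<in> L2ad P F T" and z: "z \<in> L2ad P F T"
    and t: "0 \<le> t" "t \<le> T" and ab: "0 \<le> a" "0 \<le> b"
  shows "E_int P t (\<lambda>r \<omega>. ennreal (a + b * ((norm (x r \<omega>))\<^sup>2 + (norm (z r \<omega>))\<^sup>2))) =
    ennreal (a * t) + ennreal b * (E_int P t (\<lambda>r \<omega>. esq (x r \<omega>)) + E_int P t (\<lambda>r \<omega>. esq (z r \<omega>)))"
proof -
  interpret prob_space P by (rule complete_filtered_prob_spaceD(1)[OF cf])
  let ?k = "\<lambda>r. max 0 (min T r)"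
  let ?x = "\<lambda>r \<omega>. esq (x (?k r) \<omega>)" and ?z = "\<lambda>r \<omega>. esq (z (?k r) \<omega>)"
  have T: "0 \<le> T" using t by simp
  note mx = L2ad_sq_joint_clamp[OF x T] and mz = L2ad_sq_joint_clamp[OF z T]
  have mc: "(\<lambda>(r, \<omega>). ennreal a) \<in> borel_measurable (borel \<Otimes>\<^sub>M P)" by simp
  have k: "?k r = r" if "r \<in> {0..t}" for r using that t by auto
  have mxz: "(\<lambda>(r, \<omega>). ?x r \<omega> + ?z r \<omega>) \<in> borel_measurable (borel \<Otimes>\<^sub>M P)"
    using mx mz unfolding case_prod_beta' by measurable
  have mb: "(\<lambda>(r, \<omega>). ennreal b * (?x r \<omega> + ?z r \<omega>)) \<in> borel_measurable (borel \<Otimes>\<^sub>M P)"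
    using mxz unfolding case_prod_beta' by measurable
  have "E_int P t (\<lambda>r \<omega>. ennreal (a + b * ((norm (x r \<omega>))\<^sup>2 + (norm (z r \<omega>))\<^sup>2))) =
      E_int P t (\<lambda>r \<omega>. ennreal a + ennreal b * (?x r \<omega> + ?z r \<omega>))"
    using ab by (intro E_int_cong) (simp only: k, simp add: ennreal_mult)
  also have "\<dots> = E_int P t (\<lambda>r \<omega>. ennreal a) + ennreal b * (E_int P t ?x + E_int P t ?z)"
    unfolding E_int_add[OF mc mb] E_int_cmult[OF mxz] E_int_add[OF mx mz] ..
  also have "E_int P t (\<lambda>r \<omega>. ennreal a) = ennreal (a * t)"
    unfolding E_int_def using t ab by (simp add: nn_integral_cmult_indicator emeasure_space_1 ennreal_mult)
  also have "E_int P t ?x = E_int P t (\<lambda>r \<omega>. esq (x r \<omega>))"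
    by (intro E_int_cong) (simp only: k)
  also have "E_int P t ?z = E_int P t (\<lambda>r \<omega>. esq (z r \<omega>))"
    by (intro E_int_cong) (simp only: k)
  finally show ?thesis .
qed

text \<open>Each of the four coefficients contributes \<open>2 * \<epsilon>\<^sup>2\<close> and
  twice its Lipschitz constant, whence \<open>8 * \<epsilon>\<^sup>2\<close> and
  \<open>2 * (Lb + L\<sigma> + Lf + LG)\<close>. Each market is bounded by the joint expression,
  whence the 2 in front of \<open>market_const\<close>. Only Lipschitz constants of the limiting
  coefficients occur. The abbreviations \<open>blk1\<close>, \<open>blkf\<close>,
  \<open>blkG\<close> fix the type of \<open>block\<close>, which does not determine its shipment
  component by itself.\<close>

lemma state_estimate:
  fixes P :: "'w measure" and B1 :: "real \<Rightarrow> 'w \<Rightarrow> real^'d1" and B2 :: "real \<Rightarrow> 'w \<Rightarrow> real^'d2"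
    and v1 :: "(real^'m) measure" and v2 :: "(real^'n) measure"
    and y y' :: "real \<Rightarrow> 'w \<Rightarrow> (real^'m) \<times> (real^'n)"
    and u u' :: "real \<Rightarrow> 'w \<Rightarrow> (real^'m) \<times> (real^'n) \<times> (real^'n^'m)"
  defines "blk1 \<equiv> block :: _ \<Rightarrow> _ \<Rightarrow> real \<Rightarrow> 'w \<Rightarrow> (real^'m) \<times> (real^'n) \<Rightarrow> (real^'m) \<times> (real^'n) \<times> (real^'n^'m) \<Rightarrow> (real^'m) \<times> (real^'n)"
    and "blkf \<equiv> block :: _ \<Rightarrow> _ \<Rightarrow> real \<Rightarrow> 'w \<Rightarrow> (real^'m) \<times> (real^'n) \<Rightarrow> (real^'m) \<times> (real^'n) \<times> (real^'n^'m) \<Rightarrow> (real^'d1^'m) \<times> (real^'d2^'n)"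
    and "blkG \<equiv> block :: _ \<Rightarrow> _ \<Rightarrow> real \<Rightarrow> 'w \<Rightarrow> (real^'m) \<times> (real^'n) \<Rightarrow> (real^'m) \<times> (real^'n) \<times> (real^'n^'m) \<Rightarrow> (real^'m \<Rightarrow> real^'m) \<times> (real^'n \<Rightarrow> real^'n)"
  assumes cf: "complete_filtered_prob_space P F" and params: "0 < T" "1/2 < \<alpha>"
    and B: "brownian_motion P F B1" "brownian_motion P F B2"
    and v: "levy_intensity v1" "levy_intensity v2"
    and N: "poisson_random_measure P F v1 N1" "poisson_random_measure P F v2 N2"
    and coeff: "adapted_coeff P F T b1" "adapted_coeff P F T b2" "adapted_coeff P F T \<sigma>1" "adapted_coeff P F T \<sigma>2"
      "adapted_coeff P F T f1" "adapted_coeff P F T f2" "adapted_jump_coeff P F T v1 G1" "adapted_jump_coeff P F T v2 G2"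
    and coeff': "adapted_coeff P F T b1'" "adapted_coeff P F T b2'" "adapted_coeff P F T \<sigma>1'" "adapted_coeff P F T \<sigma>2'"
      "adapted_coeff P F T f1'" "adapted_coeff P F T f2'" "adapted_jump_coeff P F T v1 G1'" "adapted_jump_coeff P F T v2 G2'"
    and growth: "linear_growth P T (blk1 b1 b2) Kb" "linear_growth P T (blk1 \<sigma>1 \<sigma>2) K\<sigma>" "0 < Kb" "0 < K\<sigma>"
    and growth': "linear_growth P T (blk1 b1' b2') Kb'" "linear_growth P T (blk1 \<sigma>1' \<sigma>2') K\<sigma>'" "0 < Kb'" "0 < K\<sigma>'"
    and lip: "lipschitz_coeff P T (blk1 b1 b2) Lb" "lipschitz_coeff P T (blk1 \<sigma>1 \<sigma>2) L\<sigma>"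
      "lipschitz_coeff P T (blkf f1 f2) Lf" "jump_lipschitz P T c v1 v2 (blkG G1 G2) LG"
    and Lpos: "0 < Lb" "0 < L\<sigma>" "0 < Lf" "0 < LG"
    and close: "AE \<omega> in P. \<forall>t\<in>{0..T}. \<forall>y u. norm (blk1 b1' b2' t \<omega> y u - blk1 b1 b2 t \<omega> y u) < \<epsilon>"
      "AE \<omega> in P. \<forall>t\<in>{0..T}. \<forall>y u. norm (blk1 \<sigma>1' \<sigma>2' t \<omega> y u - blk1 \<sigma>1 \<sigma>2 t \<omega> y u) < \<epsilon>"
      "AE \<omega> in P. \<forall>t\<in>{0..T}. \<forall>y u. norm (blkf f1' f2' t \<omega> y u - blkf f1 f2 t \<omega> y u) < \<epsilon>"
      "AE \<omega> in P. \<forall>t\<in>{0..T}. \<forall>y u. jump_sq c v1 v2 (jump_diff (blkG G1' G2' t \<omega> y u) (blkG G1 G2 t \<omega> y u)) < ennreal (\<epsilon>\<^sup>2)"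
    and sol: "SPEP_solution P F T \<alpha> c B1 B2 v1 v2 N1 N2 b1 b2 \<sigma>1 \<sigma>2 f1 f2 G1 G2 Fm K y0 y u"
    and sol': "SPEP_solution P F T \<alpha> c B1 B2 v1 v2 N1 N2 b1' b2' \<sigma>1' \<sigma>2' f1' f2' G1' G2' Fm' K' y0 y' u'"
    and t: "0 \<le> t" "t \<le> T"
  shows "(\<integral>\<^sup>+\<omega>. esq (y' t \<omega> - y t \<omega>) \<partial>P) \<le> 2 * market_const \<alpha> T *
    (ennreal (8 * \<epsilon>\<^sup>2 * t) + ennreal (2 * (Lb + L\<sigma> + Lf + LG)) *
      (E_int P t (\<lambda>r \<omega>. esq (y' r \<omega> - y r \<omega>)) + E_int P t (\<lambda>r \<omega>. esq (u' r \<omega> - u r \<omega>))))"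
proof -
  interpret prob_space P by (rule complete_filtered_prob_spaceD(1)[OF cf])
  have T: "0 \<le> T" using params by simp
  have y: "y \<in> L2ad P F T" "y' \<in> L2ad P F T" and u: "u \<in> L2ad P F T" "u' \<in> L2ad P F T"
    using sol sol' by (auto simp: SPEP_solution_def U_set_def)
  define q where "q r \<omega> = ennreal (8 * \<epsilon>\<^sup>2 + 2 * (Lb + L\<sigma> + Lf + LG) *
      ((norm (y' r \<omega> - y r \<omega>))\<^sup>2 + (norm (u' r \<omega> - u r \<omega>))\<^sup>2))" for r \<omega>
  note cp = coeff_perturbation[OF lip(1) close(1)] coeff_perturbation[OF lip(2) close(2)]
    coeff_perturbation[OF lip(3) close(3)]
    jump_coeff_perturbation[OF v less_imp_le[OF Lpos(4)] coeff(7,8) coeff'(7,8) lip(4)[unfolded blkG_def] close(4)[unfolded blkG_def],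
      of y' u' y u]
  have part: "ennreal a + ennreal b + ennreal d + g \<le> q r \<omega>"
    if "ennreal a \<le> ennreal (2 * \<epsilon>\<^sup>2 + 2 * Lb * ((norm (y' r \<omega> - y r \<omega>))\<^sup>2 + (norm (u' r \<omega> - u r \<omega>))\<^sup>2))"
      "ennreal b \<le> ennreal (2 * \<epsilon>\<^sup>2 + 2 * L\<sigma> * ((norm (y' r \<omega> - y r \<omega>))\<^sup>2 + (norm (u' r \<omega> - u r \<omega>))\<^sup>2))"
      "ennreal d \<le> ennreal (2 * \<epsilon>\<^sup>2 + 2 * Lf * ((norm (y' r \<omega> - y r \<omega>))\<^sup>2 + (norm (u' r \<omega> - u r \<omega>))\<^sup>2))"
      "g \<le> ennreal (2 * \<epsilon>\<^sup>2 + 2 * LG * ((norm (y' r \<omega> - y r \<omega>))\<^sup>2 + (norm (u' r \<omega> - u r \<omega>))\<^sup>2))" for a b d g r \<omega>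
  proof -
    let ?n = "(norm (y' r \<omega> - y r \<omega>))\<^sup>2 + (norm (u' r \<omega> - u r \<omega>))\<^sup>2"
    have "ennreal a + ennreal b + ennreal d + g \<le>
        ennreal (2 * \<epsilon>\<^sup>2 + 2 * Lb * ?n) + ennreal (2 * \<epsilon>\<^sup>2 + 2 * L\<sigma> * ?n) + ennreal (2 * \<epsilon>\<^sup>2 + 2 * Lf * ?n) + ennreal (2 * \<epsilon>\<^sup>2 + 2 * LG * ?n)"
      by (intro add_mono that)
    also have "\<dots> = ennreal ((2 * \<epsilon>\<^sup>2 + 2 * Lb * ?n) + (2 * \<epsilon>\<^sup>2 + 2 * L\<sigma> * ?n) + (2 * \<epsilon>\<^sup>2 + 2 * Lf * ?n) + (2 * \<epsilon>\<^sup>2 + 2 * LG * ?n))"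
    proof -
      have "0 \<le> 2 * \<epsilon>\<^sup>2 + 2 * l * ?n" if "0 < l" for l using that by simp
      from this[OF Lpos(1)] this[OF Lpos(2)] this[OF Lpos(3)] this[OF Lpos(4)]
      show ?thesis by (simp only: ennreal_plus[symmetric] add_nonneg_nonneg)
    qed
    also have "\<dots> = q r \<omega>" unfolding q_def by (intro arg_cong[of _ _ ennreal]) (simp only: algebra_simps)
    finally show ?thesis .
  qed
  have comp: "ennreal a \<le> C" "ennreal b \<le> C" if "ennreal (a + b) \<le> C" "0 \<le> a" "0 \<le> b" for a b :: real and C
    using that(2,3) by (auto intro!: order_trans[OF ennreal_leI that(1)])
  have fst_snd: "(\<lambda>p. fst (snd p)) \<in> borel_measurable (borel :: ((real^'m) \<times> (real^'n) \<times> (real^'n^'m)) measure)"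
    by (rule measurable_compose[OF measurable_projections(2) measurable_projections(1)])
  note proj = L2ad_compose_measurable[OF y(1) measurable_projections(1)] L2ad_compose_measurable[OF y(2) measurable_projections(1)]
    L2ad_compose_measurable[OF y(1) measurable_projections(2)] L2ad_compose_measurable[OF y(2) measurable_projections(2)]
    L2ad_compose_measurable[OF u(1) measurable_projections(1)] L2ad_compose_measurable[OF u(2) measurable_projections(1)]
    L2ad_compose_measurable[OF u(1) fst_snd] L2ad_compose_measurable[OF u(2) fst_snd]
  have market1: "(\<integral>\<^sup>+\<omega>. esq (fst (y' t \<omega>) - fst (y t \<omega>)) \<partial>P) \<le> market_const \<alpha> T * E_int P t q"
  proof -
    have fin: "AE \<omega> in P. (\<integral>\<^sup>+r\<in>{0..T}. esq (h1 r \<omega> (fst (x r \<omega>)) (fst (s r \<omega>))) \<partial>lborel) < \<infinity>"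
      if "linear_growth P T (blk1 h1 h2) k" "0 < k" "x \<in> L2ad P F T" "s \<in> L2ad P F T" for h1 h2 k
        and x :: "real \<Rightarrow> 'w \<Rightarrow> (real^'m) \<times> (real^'n)" and s :: "real \<Rightarrow> 'w \<Rightarrow> (real^'m) \<times> (real^'n) \<times> (real^'n^'m)"
      using linear_growth_integral_finite[OF cf T that]
    proof eventually_elim
      case (elim \<omega>)
      show ?case
        by (rule le_less_trans[OF nn_integral_mono elim])
          (auto split: split_indicator intro!: ennreal_leI simp: blk1_def norm_block_sq0)
    qed
    have bound: "AE \<omega> in P. \<forall>r\<in>{0..t}.
        esq (b1' r \<omega> (fst (y' r \<omega>)) (fst (u' r \<omega>)) - b1 r \<omega> (fst (y r \<omega>)) (fst (u r \<omega>))) +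
        esq (\<sigma>1' r \<omega> (fst (y' r \<omega>)) (fst (u' r \<omega>)) - \<sigma>1 r \<omega> (fst (y r \<omega>)) (fst (u r \<omega>))) +
        esq (f1' r \<omega> (fst (y' r \<omega>)) (fst (u' r \<omega>)) - f1 r \<omega> (fst (y r \<omega>)) (fst (u r \<omega>))) +
        jump_norm_sq c v1 (\<lambda>z. G1' r \<omega> (fst (y' r \<omega>)) (fst (u' r \<omega>)) z - G1 r \<omega> (fst (y r \<omega>)) (fst (u r \<omega>)) z) \<le> q r \<omega>"
      using cp
    proof eventually_elim
      case (elim \<omega>)
      show ?case
      proof (rule ballI)
        fix r assume "r \<in> {0..t}"
        then have r: "r \<in> {0..T}" using t by auto
        note e = elim(1-3)[rule_format, OF r, of "y' r \<omega>" "u' r \<omega>" "y r \<omega>" "u r \<omega>", unfolded blk1_def blkf_def norm_block_sq]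
        note j = elim(4)[rule_format, OF r, THEN conjunct1]
        show "esq (b1' r \<omega> (fst (y' r \<omega>)) (fst (u' r \<omega>)) - b1 r \<omega> (fst (y r \<omega>)) (fst (u r \<omega>))) +
            esq (\<sigma>1' r \<omega> (fst (y' r \<omega>)) (fst (u' r \<omega>)) - \<sigma>1 r \<omega> (fst (y r \<omega>)) (fst (u r \<omega>))) +
            esq (f1' r \<omega> (fst (y' r \<omega>)) (fst (u' r \<omega>)) - f1 r \<omega> (fst (y r \<omega>)) (fst (u r \<omega>))) +
            jump_norm_sq c v1 (\<lambda>z. G1' r \<omega> (fst (y' r \<omega>)) (fst (u' r \<omega>)) z - G1 r \<omega> (fst (y r \<omega>)) (fst (u r \<omega>)) z) \<le> q r \<omega>"
          by (rule part[OF comp(1)[OF e(1)] comp(1)[OF e(2)] comp(1)[OF e(3)] j]) simp_all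
      qed
    qed
    have eqns: "market_equation P F T \<alpha> c B1 v1 N1 b1' \<sigma>1' f1' G1' (\<lambda>\<omega>. fst (y0 \<omega>)) (\<lambda>t \<omega>. fst (y' t \<omega>)) (\<lambda>t \<omega>. fst (u' t \<omega>))"
        "market_equation P F T \<alpha> c B1 v1 N1 b1 \<sigma>1 f1 G1 (\<lambda>\<omega>. fst (y0 \<omega>)) (\<lambda>t \<omega>. fst (y t \<omega>)) (\<lambda>t \<omega>. fst (u t \<omega>))"
      using sol sol' by (auto simp: SPEP_solution_def)
    show ?thesis
    proof (rule market_diff_le[OF cf B(1) v(1) N(1) params(2) T eqns coeff'(1,3,5,7) coeff(1,3,5,7),
          OF _ _ _ _ _ _ _ _ t bound])
    qed (auto intro!: proj
        fin[OF growth(1,3) y(1) u(1)] fin[OF growth(2,4) y(1) u(1)] fin[OF growth'(1,3) y(2) u(2)] fin[OF growth'(2,4) y(2) u(2)]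
        simp del: infinity_ennreal_def)
  qed
  have market2: "(\<integral>\<^sup>+\<omega>. esq (snd (y' t \<omega>) - snd (y t \<omega>)) \<partial>P) \<le> market_const \<alpha> T * E_int P t q"
  proof -
    have fin: "AE \<omega> in P. (\<integral>\<^sup>+r\<in>{0..T}. esq (h2 r \<omega> (snd (x r \<omega>)) (fst (snd (s r \<omega>)))) \<partial>lborel) < \<infinity>"
      if "linear_growth P T (blk1 h1 h2) k" "0 < k" "x \<in> L2ad P F T" "s \<in> L2ad P F T" for h1 h2 k
        and x :: "real \<Rightarrow> 'w \<Rightarrow> (real^'m) \<times> (real^'n)" and s :: "real \<Rightarrow> 'w \<Rightarrow> (real^'m) \<times> (real^'n) \<times> (real^'n^'m)"
      using linear_growth_integral_finite[OF cf T that]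
    proof eventually_elim
      case (elim \<omega>)
      show ?case
        by (rule le_less_trans[OF nn_integral_mono elim])
          (auto split: split_indicator intro!: ennreal_leI simp: blk1_def norm_block_sq0)
    qed
    have bound: "AE \<omega> in P. \<forall>r\<in>{0..t}.
        esq (b2' r \<omega> (snd (y' r \<omega>)) (fst (snd (u' r \<omega>))) - b2 r \<omega> (snd (y r \<omega>)) (fst (snd (u r \<omega>)))) +
        esq (\<sigma>2' r \<omega> (snd (y' r \<omega>)) (fst (snd (u' r \<omega>))) - \<sigma>2 r \<omega> (snd (y r \<omega>)) (fst (snd (u r \<omega>)))) +
        esq (f2' r \<omega> (snd (y' r \<omega>)) (fst (snd (u' r \<omega>))) - f2 r \<omega> (snd (y r \<omega>)) (fst (snd (u r \<omega>)))) +
        jump_norm_sq c v2 (\<lambda>z. G2' r \<omega> (snd (y' r \<omega>)) (fst (snd (u' r \<omega>))) z - G2 r \<omega> (snd (y r \<omega>)) (fst (snd (u r \<omega>))) z) \<le> q r \<omega>"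
      using cp
    proof eventually_elim
      case (elim \<omega>)
      show ?case
      proof (rule ballI)
        fix r assume "r \<in> {0..t}"
        then have r: "r \<in> {0..T}" using t by auto
        note e = elim(1-3)[rule_format, OF r, of "y' r \<omega>" "u' r \<omega>" "y r \<omega>" "u r \<omega>", unfolded blk1_def blkf_def norm_block_sq]
        note j = elim(4)[rule_format, OF r, THEN conjunct2]
        show "esq (b2' r \<omega> (snd (y' r \<omega>)) (fst (snd (u' r \<omega>))) - b2 r \<omega> (snd (y r \<omega>)) (fst (snd (u r \<omega>)))) +
            esq (\<sigma>2' r \<omega> (snd (y' r \<omega>)) (fst (snd (u' r \<omega>))) - \<sigma>2 r \<omega> (snd (y r \<omega>)) (fst (snd (u r \<omega>)))) +
            esq (f2' r \<omega> (snd (y' r \<omega>)) (fst (snd (u' r \<omega>))) - f2 r \<omega> (snd (y r \<omega>)) (fst (snd (u r \<omega>)))) +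
            jump_norm_sq c v2 (\<lambda>z. G2' r \<omega> (snd (y' r \<omega>)) (fst (snd (u' r \<omega>))) z - G2 r \<omega> (snd (y r \<omega>)) (fst (snd (u r \<omega>))) z) \<le> q r \<omega>"
          by (rule part[OF comp(2)[OF e(1)] comp(2)[OF e(2)] comp(2)[OF e(3)] j]) simp_all
      qed
    qed
    have eqns: "market_equation P F T \<alpha> c B2 v2 N2 b2' \<sigma>2' f2' G2' (\<lambda>\<omega>. snd (y0 \<omega>)) (\<lambda>t \<omega>. snd (y' t \<omega>)) (\<lambda>t \<omega>. fst (snd (u' t \<omega>)))"
        "market_equation P F T \<alpha> c B2 v2 N2 b2 \<sigma>2 f2 G2 (\<lambda>\<omega>. snd (y0 \<omega>)) (\<lambda>t \<omega>. snd (y t \<omega>)) (\<lambda>t \<omega>. fst (snd (u t \<omega>)))"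
      using sol sol' by (auto simp: SPEP_solution_def)
    show ?thesis
    proof (rule market_diff_le[OF cf B(2) v(2) N(2) params(2) T eqns coeff'(2,4,6,8) coeff(2,4,6,8),
          OF _ _ _ _ _ _ _ _ t bound])
    qed (auto intro!: proj
        fin[OF growth(1,3) y(1) u(1)] fin[OF growth(2,4) y(1) u(1)] fin[OF growth'(1,3) y(2) u(2)] fin[OF growth'(2,4) y(2) u(2)]
        simp del: infinity_ennreal_def)
  qed
  have yt: "y t \<in> borel_measurable P" "y' t \<in> borel_measurable P"
  proof -
    have "y t \<in> borel_measurable (F t)" "y' t \<in> borel_measurable (F t)" using y t by (auto simp: L2ad_def)
    then show "y t \<in> borel_measurable P" "y' t \<in> borel_measurable P"
      by (auto intro: measurable_from_subalg[OF complete_filtered_prob_spaceD(2)[OF cf t(1)]])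
  qed
  have [measurable]: "(\<lambda>\<omega>. fst (y' t \<omega>) - fst (y t \<omega>)) \<in> borel_measurable P" "(\<lambda>\<omega>. snd (y' t \<omega>) - snd (y t \<omega>)) \<in> borel_measurable P"
    using measurable_compose[OF yt(1) measurable_projections(1)] measurable_compose[OF yt(1) measurable_projections(2)]
      measurable_compose[OF yt(2) measurable_projections(1)] measurable_compose[OF yt(2) measurable_projections(2)] by auto
  have "(norm (y' t \<omega> - y t \<omega>))\<^sup>2 = (norm (fst (y' t \<omega>) - fst (y t \<omega>)))\<^sup>2 + (norm (snd (y' t \<omega>) - snd (y t \<omega>)))\<^sup>2" for \<omega>
    by (simp add: norm_prod_def)
  then have "(\<integral>\<^sup>+\<omega>. esq (y' t \<omega> - y t \<omega>) \<partial>P) =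
      (\<integral>\<^sup>+\<omega>. esq (fst (y' t \<omega>) - fst (y t \<omega>)) \<partial>P) + (\<integral>\<^sup>+\<omega>. esq (snd (y' t \<omega>) - snd (y t \<omega>)) \<partial>P)"
    by (simp add: nn_integral_add)
  also have "\<dots> \<le> market_const \<alpha> T * E_int P t q + market_const \<alpha> T * E_int P t q"
    by (rule add_mono[OF market1 market2])
  also have "\<dots> = 2 * market_const \<alpha> T * E_int P t q"
    by (simp add: mult_2 distrib_right)
  also have "E_int P t q = ennreal (8 * \<epsilon>\<^sup>2 * t) + ennreal (2 * (Lb + L\<sigma> + Lf + LG)) *
      (E_int P t (\<lambda>r \<omega>. esq (y' r \<omega> - y r \<omega>)) + E_int P t (\<lambda>r \<omega>. esq (u' r \<omega> - u r \<omega>)))"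
    unfolding q_def using Lpos
    by (intro E_int_affine[OF cf L2ad_diff[OF cf y(2,1)] L2ad_diff[OF cf u(2,1)] t]) auto
  finally show ?thesis .
qed

section \<open>Convergence\<close>

text \<open>The projection is continuous, which preserves measurability and adaptedness, and does
  not increase norms because 0 lies in the set, which preserves square integrability.\<close>

lemma L2ad_closest_point:
  assumes S: "closed S" "convex S" "0 \<in> S" and x: "x \<in> L2ad P F T"
  shows "(\<lambda>t \<omega>. closest_point S (x t \<omega>)) \<in> L2ad P F T"
proof -
  have cp: "closest_point S \<in> borel_measurable borel"
    using S by (intro borel_measurable_continuous_onI continuous_on_closest_point) auto
  have "(\<lambda>(t, \<omega>). closest_point S (x t \<omega>)) \<in> borel_measurable (restrict_space borel {0..T} \<Otimes>\<^sub>M P)"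
    by (rule L2ad_compose_measurable[OF x cp])
  moreover have "(\<lambda>\<omega>. closest_point S (x t \<omega>)) \<in> borel_measurable (F t)" if "t \<in> {0..T}" for t
    using x that by (intro measurable_compose[OF _ cp]) (auto simp: L2ad_def)
  moreover have "E_int P T (\<lambda>t \<omega>. esq (closest_point S (x t \<omega>))) \<le> E_int P T (\<lambda>t \<omega>. esq (x t \<omega>))"
    by (intro E_int_mono ennreal_leI power_mono norm_closest_point_le S) auto
  moreover have "E_int P T (\<lambda>t \<omega>. esq (x t \<omega>)) < \<infinity>"
    using x by (auto simp: L2ad_def E_int_def)
  ultimately show ?thesis
    by (auto simp: L2ad_def E_int_def intro: le_less_trans)
qed

text \<open>In the definition of a solution the exceptional set may depend on w, while the test
  vectors used later vary with time and sample point. A countable dense subset of \<open>K\<close>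
  gives one common exceptional set, and closedness in w extends the inequality to all of
  \<open>K\<close>.\<close>

lemma variational_inequality_AE:
  fixes f u :: "real \<Rightarrow> 'w \<Rightarrow> 'v::euclidean_space"
  assumes cf: "complete_filtered_prob_space P F" and f: "f \<in> L2ad P F T" and u: "u \<in> L2ad P F T"
    and vi: "\<forall>w\<in>K. AE t in lborel. t \<in> {0..T} \<longrightarrow> (AE \<omega> in P. 0 \<le> f t \<omega> \<bullet> (w - u t \<omega>))"
  shows "AE z in time_prob P T. \<forall>w\<in>K. 0 \<le> f (snd z) (fst z) \<bullet> (w - u (snd z) (fst z))"
proof -
  obtain D where D: "countable D" "D \<subseteq> K" "K \<subseteq> closure D"
    using separable[of K] by blast
  have [measurable]: "(\<lambda>z. f (snd z) (fst z)) \<in> borel_measurable (time_prob P T)"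
      "(\<lambda>z. u (snd z) (fst z)) \<in> borel_measurable (time_prob P T)"
    using L2ad_measurable[OF cf f] L2ad_measurable[OF cf u] by (simp_all add: case_prod_beta')
  have "AE z in time_prob P T. \<forall>w\<in>D. 0 \<le> f (snd z) (fst z) \<bullet> (w - u (snd z) (fst z))"
    unfolding AE_ball_countable[OF D(1)]
  proof
    fix w assume "w \<in> D"
    then have "AE t in lborel. t \<in> {0..T} \<longrightarrow> (AE \<omega> in P. 0 \<le> f t \<omega> \<bullet> (w - u t \<omega>))"
      using vi D(2) by blast
    then show "AE z in time_prob P T. 0 \<le> f (snd z) (fst z) \<bullet> (w - u (snd z) (fst z))"
      by (rule AE_time_prob[OF cf]) measurable
  qed
  then show ?thesis
  proof eventually_elim
    case (elim z)
    have "closed {w. 0 \<le> f (snd z) (fst z) \<bullet> (w - u (snd z) (fst z))}"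
      by (intro closed_Collect_le continuous_intros)
    then have "closure D \<subseteq> {w. 0 \<le> f (snd z) (fst z) \<bullet> (w - u (snd z) (fst z))}"
      using elim by (intro closure_minimal) auto
    then show ?case using D(3) by blast
  qed
qed

lemma U_set_AE:
  assumes cf: "complete_filtered_prob_space P F" and u: "u \<in> U_set P F T K" and K: "closed K"
  shows "AE z in time_prob P T. u (snd z) (fst z) \<in> K"
proof -
  have uL: "u \<in> L2ad P F T" and ae: "AE t in lborel. t \<in> {0..T} \<longrightarrow> (AE \<omega> in P. u t \<omega> \<in> K)"
    using u by (auto simp: U_set_def)
  have "(\<lambda>z. u (snd z) (fst z)) \<in> borel_measurable (time_prob P T)"
    using L2ad_measurable[OF cf uL] by (simp add: case_prod_beta')
  from measurable_sets[OF this borel_closed[OF K]]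
  have "{z \<in> space (time_prob P T). u (snd z) (fst z) \<in> K} \<in> sets (time_prob P T)"
    by (simp add: vimage_def Int_def conj_commute)
  with ae show ?thesis by (rule AE_time_prob[OF cf])
qed

text \<open>A solution of the variational inequality is a fixed point of the projected step: in the
  expansion of the squared norm of \<open>g + (z - u)\<close> the mixed term is nonnegative, so no z
  in K is closer to \<open>u - g\<close> than u.\<close>

lemma closest_point_variational:
  fixes u g :: "'a::euclidean_space"
  assumes K: "closed K" "convex K" and u: "u \<in> K" and vi: "\<forall>w\<in>K. 0 \<le> g \<bullet> (w - u)"
  shows "closest_point K (u - g) = u"
proof (rule closest_point_unique[OF K(2,1) u, symmetric], rule ballI)
  fix z assume z: "z \<in> K"
  have "(norm g)\<^sup>2 \<le> (norm g)\<^sup>2 + 2 * (g \<bullet> (z - u)) + (norm (z - u))\<^sup>2"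
    using vi z by simp
  also have "\<dots> = (norm (g + (z - u)))\<^sup>2"
    by (simp add: power2_norm_eq_inner inner_add_left inner_add_right inner_commute)
  finally have "norm g \<le> norm (g + (z - u))" by simp
  then show "dist (u - g) u \<le> dist (u - g) z"
    by (simp add: dist_norm norm_minus_commute algebra_simps)
qed

lemma projections_converge:
  fixes u g :: "real \<Rightarrow> 'w \<Rightarrow> 'v::euclidean_space"
  assumes cf: "complete_filtered_prob_space P F" and u: "u \<in> L2ad P F T" and g: "g \<in> L2ad P F T"
    and C: "\<And>j. closed (C j)" "\<And>j. convex (C j)" "\<And>j. 0 \<in> C j"
    and C0: "closed C0" "convex C0" "0 \<in> C0" and mosco: "mosco_converges C C0"
    and uK: "AE z in time_prob P T. u (snd z) (fst z) \<in> C0"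
    and vi: "AE z in time_prob P T. \<forall>w\<in>C0. 0 \<le> g (snd z) (fst z) \<bullet> (w - u (snd z) (fst z))"
  shows "(\<lambda>j. (L2_dist P T (\<lambda>t \<omega>. closest_point (C j) (u t \<omega> - g t \<omega>)) u)\<^sup>2) \<longlonglongrightarrow> 0"
proof -
  let ?x = "\<lambda>t \<omega>. u t \<omega> - g t \<omega>"
  let ?v = "\<lambda>j t \<omega>. closest_point (C j) (?x t \<omega>)"
  have x: "?x \<in> L2ad P F T" by (rule L2ad_diff[OF cf u g])
  have v: "?v j \<in> L2ad P F T" for j by (rule L2ad_closest_point[OF C x])
  let ?s = "\<lambda>j z. (norm (?v j (snd z) (fst z) - u (snd z) (fst z)))\<^sup>2"
  let ?w = "\<lambda>z. 2 * ((norm (?x (snd z) (fst z)))\<^sup>2 + (norm (u (snd z) (fst z)))\<^sup>2)"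
  have mu: "(\<lambda>z. u (snd z) (fst z)) \<in> borel_measurable (time_prob P T)"
    and mv: "(\<lambda>z. ?v j (snd z) (fst z)) \<in> borel_measurable (time_prob P T)" for j
    using L2ad_measurable[OF cf u] L2ad_measurable[OF cf v[of j]] by (simp_all add: case_prod_beta')
  have "(\<lambda>j. \<integral>z. ?s j z \<partial>time_prob P T) \<longlonglongrightarrow> (\<integral>z. 0 \<partial>time_prob P T)"
  proof (rule integral_dominated_convergence[where w="?w"])
    show "?s j \<in> borel_measurable (time_prob P T)" for j using mu mv[of j] by measurable
    show "integrable (time_prob P T) ?w"
      using L2ad_sq(1)[OF cf x] L2ad_sq(1)[OF cf u] by (simp add: case_prod_beta')
    show "AE z in time_prob P T. (\<lambda>j. ?s j z) \<longlonglongrightarrow> 0"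
      using uK vi
    proof eventually_elim
      case (elim z)
      have "(\<lambda>j. ?v j (snd z) (fst z)) \<longlonglongrightarrow> closest_point C0 (?x (snd z) (fst z))"
        by (rule closest_point_tendsto_mosco[OF C C0 mosco])
      also have "closest_point C0 (?x (snd z) (fst z)) = u (snd z) (fst z)"
        by (rule closest_point_variational[OF C0(1,2) elim])
      finally have "(\<lambda>j. ?v j (snd z) (fst z) - u (snd z) (fst z)) \<longlonglongrightarrow> 0"
        by (simp add: LIM_zero)
      from tendsto_power[OF tendsto_norm[OF this], of 2] show ?case by simp
    qed
    show "AE z in time_prob P T. norm (?s j z) \<le> ?w z" for j
    proof (rule AE_I2)
      fix z
      have "?s j z \<le> 2 * ((norm (?v j (snd z) (fst z)))\<^sup>2 + (norm (u (snd z) (fst z)))\<^sup>2)"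
        by (rule norm_diff_sq)
      also have "\<dots> \<le> ?w z"
        by (intro mult_left_mono add_mono power_mono norm_closest_point_le C order_refl) auto
      finally show "norm (?s j z) \<le> ?w z" by simp
    qed
  qed simp
  then show ?thesis
    using L2_dist_sq(1)[OF cf v u] by (simp add: case_prod_beta')
qed

text \<open>Gronwall's inequality needs a function of time alone. Freezing the process outside
  [0, T] makes its mean square Borel measurable on the line, and Fubini identifies the time
  integral.\<close>

lemma time_integral_of_mean:
  assumes cf: "complete_filtered_prob_space P F" and x: "x \<in> L2ad P F T" and T: "0 \<le> T"
  defines "e \<equiv> \<lambda>r. \<integral>\<^sup>+\<omega>. esq (x (max 0 (min T r)) \<omega>) \<partial>P"
  shows "e \<in> borel_measurable borel"
    and "t \<le> T \<Longrightarrow> E_int P t (\<lambda>r \<omega>. esq (x r \<omega>)) = (\<integral>\<^sup>+r\<in>{0..t}. e r \<partial>lborel)"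
proof -
  interpret prob_space P by (rule complete_filtered_prob_spaceD(1)[OF cf])
  interpret PL: pair_sigma_finite P "lborel :: real measure" ..
  let ?k = "\<lambda>r. max 0 (min T r)"
  let ?q = "\<lambda>r \<omega>. esq (x (?k r) \<omega>)"
  have q: "(\<lambda>(r, \<omega>). ?q r \<omega>) \<in> borel_measurable (borel \<Otimes>\<^sub>M P)" by (rule L2ad_sq_joint_clamp[OF x T])
  then show "e \<in> borel_measurable borel"
    unfolding e_def by (rule borel_measurable_nn_integral)
  show "E_int P t (\<lambda>r \<omega>. esq (x r \<omega>)) = (\<integral>\<^sup>+r\<in>{0..t}. e r \<partial>lborel)" if t: "t \<le> T"
  proof -
    have k: "?k r = r" if "r \<in> {0..t}" for r using that t by auto
    have q': "(\<lambda>(\<omega>, r). ?q r \<omega> * indicator {0..t} r) \<in> borel_measurable (P \<Otimes>\<^sub>M lborel)"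
    proof -
      have [measurable]: "(\<lambda>z. ?q (snd z) (fst z)) \<in> borel_measurable (P \<Otimes>\<^sub>M borel)"
        using measurable_compose[of "\<lambda>z. (snd z, fst z)" "P \<Otimes>\<^sub>M borel", OF _ q] by simp
      show ?thesis
        unfolding measurable_cong_sets[OF sets_pair_measure_cong[OF refl sets_lborel] refl] case_prod_beta' by measurable
    qed
    have "E_int P t (\<lambda>r \<omega>. esq (x r \<omega>)) = E_int P t ?q"
      by (intro E_int_cong) (simp only: k)
    also have "\<dots> = (\<integral>\<^sup>+r. (\<integral>\<^sup>+\<omega>. ?q r \<omega> * indicator {0..t} r \<partial>P) \<partial>lborel)"
      unfolding E_int_def using PL.Fubini'[OF q'] by simp
    also have "\<dots> = (\<integral>\<^sup>+r\<in>{0..t}. e r \<partial>lborel)"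
      unfolding e_def by (intro nn_integral_cong) (auto split: split_indicator)
    finally show ?thesis .
  qed
qed

text \<open>Inserting the bound for \<open>U\<close> into the price estimate leaves an inequality in
  the price difference alone, with inhomogeneity \<open>ennreal s + \<delta>\<close>; in the
  application s is \<open>\<epsilon>\<^sup>2\<close>. The constant a collects crude bounds, and the
  added 1 makes it positive as \<open>gronwall_integral\<close> demands.\<close>

lemma gronwall_L2ad:
  fixes x :: "real \<Rightarrow> 'w \<Rightarrow> 'v::euclidean_space"
  assumes cf: "complete_filtered_prob_space P F" and T: "0 \<le> T" and x: "x \<in> L2ad P F T"
    and M: "M < \<infinity>" and L: "0 \<le> L" and C: "0 \<le> C" and s: "0 \<le> s"
    and le: "\<And>t. t \<in> {0..T} \<Longrightarrow> (\<integral>\<^sup>+\<omega>. esq (x t \<omega>) \<partial>P) \<le>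
      M * (ennreal (8 * s * t) + ennreal L * (E_int P t (\<lambda>r \<omega>. esq (x r \<omega>)) + U t))"
    and U: "\<And>t. t \<in> {0..T} \<Longrightarrow>
      U t \<le> ennreal C * (E_int P t (\<lambda>r \<omega>. esq (x r \<omega>)) + ennreal (s * T) + \<delta>)"
  defines "a \<equiv> enn2real M * (8 * T + L * (1 + C * (1 + T))) + 1"
  shows "E_int P T (\<lambda>r \<omega>. esq (x r \<omega>)) \<le> ennreal (2 * a * T * exp (2 * a * T)) * (ennreal s + \<delta>)"
proof -
  define e where "e r = (\<integral>\<^sup>+\<omega>. esq (x (max 0 (min T r)) \<omega>) \<partial>P)" for r
  note e = time_integral_of_mean[OF cf x T, folded e_def]
  have a: "0 < a"
    unfolding a_def using T L C by (intro add_nonneg_pos mult_nonneg_nonneg add_nonneg_nonneg) auto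
  have "(\<integral>\<^sup>+r\<in>{0..T}. e r \<partial>lborel) \<le> ennreal (2 * a * T * exp (2 * a * T)) * (ennreal s + \<delta>)"
  proof (rule gronwall_integral[OF e(1) a T])
    show "(\<integral>\<^sup>+r\<in>{0..T}. e r \<partial>lborel) < \<infinity>"
      using e(2)[OF order_refl] x by (auto simp: L2ad_def E_int_def)
    fix t assume t: "t \<in> {0..T}"
    let ?Y = "E_int P t (\<lambda>r \<omega>. esq (x r \<omega>))"
    let ?S = "ennreal s + \<delta> + ?Y"
    have Y: "?Y = (\<integral>\<^sup>+r\<in>{0..t}. e r \<partial>lborel)" using e(2)[of t] t by simp
    have h1: "ennreal (8 * s * t) \<le> ennreal (8 * T) * ?S"
    proof -
      have "ennreal (8 * s * t) \<le> ennreal (8 * T * s)"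
        using t mult_left_mono[of t T s] s by (intro ennreal_leI) (simp add: mult_ac)
      also have "\<dots> = ennreal (8 * T) * ennreal s" using T s by (simp add: ennreal_mult)
      also have "\<dots> \<le> ennreal (8 * T) * ?S" by (intro mult_left_mono) (auto simp: add.assoc)
      finally show ?thesis .
    qed
    have h2: "U t \<le> ennreal (C * (1 + T)) * ?S"
    proof -
      have "?Y + ennreal (s * T) + \<delta> \<le> ennreal (1 + T) * ?S"
      proof -
        \<comment> \<open>The added nonnegative terms are exactly those missing from the expanded
          product of \<open>1 + T\<close> and \<open>?S\<close>.\<close>
        have "?Y + ennreal (s * T) + \<delta> \<le> ?Y + ennreal T * ennreal s + \<delta> + (ennreal s + ennreal T * (\<delta> + ?Y))"
          using s T by (simp add: ennreal_mult mult.commute add_increasing2)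
        also have "\<dots> = ennreal (1 + T) * ?S"
          using T by (simp add: algebra_simps)
        finally show ?thesis .
      qed
      then have "ennreal C * (?Y + ennreal (s * T) + \<delta>) \<le> ennreal C * (ennreal (1 + T) * ?S)"
        by (rule mult_left_mono) simp
      also have "\<dots> = ennreal (C * (1 + T)) * ?S"
        using C T by (simp add: ennreal_mult mult.assoc)
      finally show ?thesis using U[OF t] by (rule order_trans[rotated])
    qed
    have M': "M = ennreal (enn2real M)" using M by simp
    have "e t = (\<integral>\<^sup>+\<omega>. esq (x t \<omega>) \<partial>P)"
    proof -
      have "max 0 (min T t) = t" using t by auto
      then show ?thesis unfolding e_def by simp
    qed
    also have "\<dots> \<le> M * (ennreal (8 * s * t) + ennreal L * (?Y + U t))"
      by (rule le[OF t])
    also have "\<dots> \<le> M * (ennreal (8 * T) * ?S + ennreal L * (1 * ?S + ennreal (C * (1 + T)) * ?S))"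
      by (intro mult_left_mono add_mono h1 h2) (auto intro: add_increasing)
    also have "\<dots> = M * (ennreal (8 * T) + ennreal L * (1 + ennreal (C * (1 + T)))) * ?S"
      by (simp only: algebra_simps)
    also have "M * (ennreal (8 * T) + ennreal L * (1 + ennreal (C * (1 + T)))) =
        ennreal (enn2real M * (8 * T + L * (1 + C * (1 + T))))"
    proof -
      have "1 + ennreal (C * (1 + T)) = ennreal (1 + C * (1 + T))" using C T by simp
      moreover have "0 \<le> 8 * T + L * (1 + C * (1 + T))" using C T L by simp
      moreover have "ennreal (8 * T) + ennreal L * ennreal (1 + C * (1 + T)) = ennreal (8 * T + L * (1 + C * (1 + T)))"
        using C T L by (subst ennreal_plus) (auto simp: ennreal_mult simp del: ennreal_plus)
      ultimately show ?thesis
        by (subst M') (simp only: ennreal_mult enn2real_nonneg)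
    qed
    also have "\<dots> * ?S \<le> ennreal a * ?S"
      unfolding a_def by (intro mult_right_mono ennreal_leI) auto
    finally show "e t \<le> ennreal a * (ennreal s + \<delta> + (\<integral>\<^sup>+r\<in>{0..t}. e r \<partial>lborel))"
      unfolding Y .
  qed
  then show ?thesis using e(2)[OF order_refl] by simp
qed

text \<open>For large k the bound holds for all j at once, with \<open>\<epsilon>\<close> governed
  by k and \<open>d j\<close> governed by j. This uniformity is what yields a limit along the
  product filter and not merely an iterated one.\<close>

lemma double_limit_zero:
  fixes f :: "nat \<Rightarrow> nat \<Rightarrow> real"
  assumes D: "0 \<le> D" and nn: "\<And>k j. 0 \<le> f k j" and d: "d \<longlonglongrightarrow> 0"
    and bound: "\<And>\<epsilon>. 0 < \<epsilon> \<Longrightarrow> \<forall>\<^sub>F k in sequentially. \<forall>j. (f k j)\<^sup>2 \<le> D * (\<epsilon>\<^sup>2 + d j)"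
  shows "((\<lambda>(k, j). f k j) \<longlongrightarrow> 0) (sequentially \<times>\<^sub>F sequentially)"
proof (rule tendstoI)
  fix r :: real assume r: "0 < r"
  \<comment> \<open>With this choice \<open>D * (\<epsilon>\<^sup>2 + \<epsilon>\<^sup>2)\<close> is
    \<open>r\<^sup>2\<close> times \<open>D / (2 * (D + 1))\<close>, which is below
    \<open>r\<^sup>2\<close>; \<open>D + 1\<close> keeps the denominator positive when D is
    zero.\<close>
  define \<epsilon> where "\<epsilon> = sqrt (r\<^sup>2 / (4 * (D + 1)))"
  have \<epsilon>: "0 < \<epsilon>" "\<epsilon>\<^sup>2 = r\<^sup>2 / (4 * (D + 1))" using r D by (auto simp: \<epsilon>_def)
  have "\<forall>\<^sub>F j in sequentially. \<bar>d j\<bar> < \<epsilon>\<^sup>2"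
    using tendstoD[OF d, of "\<epsilon>\<^sup>2"] \<epsilon>(1) by simp
  from eventually_prodI[OF bound[OF \<epsilon>(1)] this]
  show "\<forall>\<^sub>F z in sequentially \<times>\<^sub>F sequentially. dist (case z of (k, j) \<Rightarrow> f k j) 0 < r"
  proof eventually_elim
    case (elim z)
    obtain k j where z: "z = (k, j)" by (cases z)
    have "(f k j)\<^sup>2 \<le> D * (\<epsilon>\<^sup>2 + d j)" using elim by (auto simp: z)
    also have "\<dots> \<le> D * (\<epsilon>\<^sup>2 + \<epsilon>\<^sup>2)" using elim D by (intro mult_left_mono) (auto simp: z)
    also have "\<dots> < r\<^sup>2"
    proof -
      have "D * (\<epsilon>\<^sup>2 + \<epsilon>\<^sup>2) = r\<^sup>2 * (D / (2 * (D + 1)))" 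
      proof -
        have "p * (x / (4 * c) + x / (4 * c)) = x * (p / (2 * c))" for p x c :: real by simp
        then show ?thesis unfolding \<epsilon>(2) .
      qed
      also have "\<dots> < r\<^sup>2 * 1" using D r by (intro mult_strict_left_mono) (auto simp: field_simps)
      finally show ?thesis by simp
    qed
    finally have "f k j < r" using r by (rule power_less_imp_less_base[OF _ less_imp_le])
    then show ?case using nn[of k j] by (simp add: z dist_real_def)
  qed
qed

text \<open>The product filter expresses that k and j tend to infinity independently of each other.
  Convergence in the Hilbert space is stated through \<open>L2_dist\<close>, since processes are not
  identified when they agree almost everywhere.\<close>

theorem theorem5p1:
  fixes P :: "'w measure" and F :: "real \<Rightarrow> 'w measure" and T \<alpha> c :: real
    and B1 :: "real \<Rightarrow> 'w \<Rightarrow> real^'d1" and B2 :: "real \<Rightarrow> 'w \<Rightarrow> real^'d2"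
    and v1 :: "(real^'m) measure" and v2 :: "(real^'n) measure"
    and N1 :: "'w \<Rightarrow> (real \<times> (real^'m)) measure" and N2 :: "'w \<Rightarrow> (real \<times> (real^'n)) measure"
    and b1 \<sigma>1 :: "'l::complete_space \<Rightarrow> real \<Rightarrow> 'w \<Rightarrow> real^'m \<Rightarrow> real^'m \<Rightarrow> real^'m"
    and b2 \<sigma>2 :: "'l \<Rightarrow> real \<Rightarrow> 'w \<Rightarrow> real^'n \<Rightarrow> real^'n \<Rightarrow> real^'n"
    and f1 :: "'l \<Rightarrow> real \<Rightarrow> 'w \<Rightarrow> real^'m \<Rightarrow> real^'m \<Rightarrow> real^'d1^'m"
    and f2 :: "'l \<Rightarrow> real \<Rightarrow> 'w \<Rightarrow> real^'n \<Rightarrow> real^'n \<Rightarrow> real^'d2^'n"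
    and G1 :: "'l \<Rightarrow> real \<Rightarrow> 'w \<Rightarrow> real^'m \<Rightarrow> real^'m \<Rightarrow> real^'m \<Rightarrow> real^'m"
    and G2 :: "'l \<Rightarrow> real \<Rightarrow> 'w \<Rightarrow> real^'n \<Rightarrow> real^'n \<Rightarrow> real^'n \<Rightarrow> real^'n"
    and Fm :: "'l \<Rightarrow> real \<Rightarrow> 'w \<Rightarrow> (real^'m) \<times> (real^'n) \<Rightarrow> (real^'m) \<times> (real^'n) \<times> (real^'n^'m)
                \<Rightarrow> (real^'m) \<times> (real^'n) \<times> (real^'n^'m)"
    and K :: "'l \<Rightarrow> ((real^'m) \<times> (real^'n) \<times> (real^'n^'m)) set"
    and y0 :: "'w \<Rightarrow> (real^'m) \<times> (real^'n)"
    and Cbar LF :: real and Kb K\<sigma> Kf KG Lb L\<sigma> Lf LG :: "'l \<Rightarrow> real"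
    and lam mu :: 'l and lams mus :: "nat \<Rightarrow> 'l"
    and y :: "real \<Rightarrow> 'w \<Rightarrow> (real^'m) \<times> (real^'n)"
    and u :: "real \<Rightarrow> 'w \<Rightarrow> (real^'m) \<times> (real^'n) \<times> (real^'n^'m)"
    and ys :: "nat \<Rightarrow> nat \<Rightarrow> real \<Rightarrow> 'w \<Rightarrow> (real^'m) \<times> (real^'n)"
    and us :: "nat \<Rightarrow> nat \<Rightarrow> real \<Rightarrow> 'w \<Rightarrow> (real^'m) \<times> (real^'n) \<times> (real^'n^'m)"
  assumes prob: "complete_filtered_prob_space P F"
    and params: "0 < T" "1/2 < \<alpha>" "\<alpha> < 1" "0 \<le> c"
    and brownian: "brownian_motion P F B1" "brownian_motion P F B2"
    and intensity: "levy_intensity v1" "levy_intensity v2"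
    and poisson: "poisson_random_measure P F v1 N1" "poisson_random_measure P F v2 N2"
    and indep: "independent_noises P B1 B2 v1 N1 v2 N2"
    and y0: "y0 \<in> borel_measurable P" "integrable P (\<lambda>\<omega>. (norm (y0 \<omega>))\<^sup>2)"
    and K: "\<And>l. closed (K l)" "\<And>l. convex (K l)" "\<And>l. 0 \<in> K l"
    and coeff: "\<And>l. adapted_coeff P F T (b1 l)" "\<And>l. adapted_coeff P F T (b2 l)"
      "\<And>l. adapted_coeff P F T (\<sigma>1 l)" "\<And>l. adapted_coeff P F T (\<sigma>2 l)"
      "\<And>l. adapted_coeff P F T (f1 l)" "\<And>l. adapted_coeff P F T (f2 l)"
      "\<And>l. adapted_jump_coeff P F T v1 (G1 l)" "\<And>l. adapted_jump_coeff P F T v2 (G2 l)"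
    and \<sigma>_cont: "\<And>l. time_continuous P T (\<sigma>1 l)" "\<And>l. time_continuous P T (\<sigma>2 l)"
    and Fm_op: "\<And>l yt ut. yt \<in> L2ad P F T \<Longrightarrow> ut \<in> L2ad P F T \<Longrightarrow>
          induced_op (Fm l) yt ut \<in> L2ad P F T"
    and constants: "0 < Cbar" "0 < LF" "Cbar < LF"
      "\<And>l. 0 < Kb l \<and> 0 < K\<sigma> l \<and> 0 < Kf l \<and> 0 < KG l"
      "\<And>l. 0 < Lb l \<and> 0 < L\<sigma> l \<and> 0 < Lf l \<and> 0 < LG l"
    and growth: "\<And>l. linear_growth P T (block (b1 l) (b2 l)) (Kb l)"
      "\<And>l. linear_growth P T (block (\<sigma>1 l) (\<sigma>2 l)) (K\<sigma> l)"
      "\<And>l. linear_growth P T (block (f1 l) (f2 l)) (Kf l)"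
      "\<And>l. jump_linear_growth P T c v1 v2 (block (G1 l) (G2 l)) (KG l)"
    and lipschitz: "\<And>l. lipschitz_coeff P T (block (b1 l) (b2 l)) (Lb l)"
      "\<And>l. lipschitz_coeff P T (block (\<sigma>1 l) (\<sigma>2 l)) (L\<sigma> l)"
      "\<And>l. lipschitz_coeff P T (block (f1 l) (f2 l)) (Lf l)"
      "\<And>l. jump_lipschitz P T c v1 v2 (block (G1 l) (G2 l)) (LG l)"
    and Fm_lipschitz: "\<And>l y1 y2 u1 u2. y1 \<in> L2ad P F T \<Longrightarrow> y2 \<in> L2ad P F T \<Longrightarrow>
          u1 \<in> L2ad P F T \<Longrightarrow> u2 \<in> L2ad P F T \<Longrightarrow>
          L2_dist P T (induced_op (Fm l) y1 u1) (induced_op (Fm l) y2 u2)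
            \<le> LF * (L2_dist P T y1 y2 + L2_dist P T u1 u2)"
    and Fm_monotone: "\<And>l yt u1 u2. yt \<in> L2ad P F T \<Longrightarrow>
          u1 \<in> L2ad P F T \<Longrightarrow> u2 \<in> L2ad P F T \<Longrightarrow>
          L2_inner P T
            (\<lambda>t \<omega>. induced_op (Fm l) yt u1 t \<omega> - induced_op (Fm l) yt u2 t \<omega>)
            (\<lambda>t \<omega>. u1 t \<omega> - u2 t \<omega>)
            \<ge> Cbar * (L2_dist P T u1 u2)\<^sup>2"
    and unif_cont: "uniformly_continuous_param P T (\<lambda>l. block (b1 l) (b2 l))"
      "uniformly_continuous_param P T (\<lambda>l. block (\<sigma>1 l) (\<sigma>2 l))"
      "uniformly_continuous_param P T (\<lambda>l. block (f1 l) (f2 l))"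
      "jump_uniformly_continuous_param P T c v1 v2 (\<lambda>l. block (G1 l) (G2 l))"
      "uniformly_continuous_param P T Fm"
    and lams: "lams \<longlonglongrightarrow> lam" and mus: "mus \<longlonglongrightarrow> mu"
    and mosco: "mosco_converges (\<lambda>j. K (mus j)) (K mu)"
    and sol: "SPEP_unique_solution P F T \<alpha> c B1 B2 v1 v2 N1 N2
          (b1 lam) (b2 lam) (\<sigma>1 lam) (\<sigma>2 lam) (f1 lam) (f2 lam) (G1 lam) (G2 lam)
          (Fm lam) (K mu) y0 y u"
    and sols: "\<And>k j. SPEP_unique_solution P F T \<alpha> c B1 B2 v1 v2 N1 N2
          (b1 (lams k)) (b2 (lams k)) (\<sigma>1 (lams k)) (\<sigma>2 (lams k))
          (f1 (lams k)) (f2 (lams k)) (G1 (lams k)) (G2 (lams k))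
          (Fm (lams k)) (K (mus j)) y0 (ys k j) (us k j)"
  shows "((\<lambda>(k, j). L2_dist P T (ys k j) y) \<longlongrightarrow> 0) (sequentially \<times>\<^sub>F sequentially) \<and>
         ((\<lambda>(k, j). L2_dist P T (us k j) u) \<longlongrightarrow> 0) (sequentially \<times>\<^sub>F sequentially)"
proof -
  note cf = prob
  have T: "0 \<le> T" using params(1) by simp
  have sol0: "SPEP_solution P F T \<alpha> c B1 B2 v1 v2 N1 N2
      (b1 lam) (b2 lam) (\<sigma>1 lam) (\<sigma>2 lam) (f1 lam) (f2 lam) (G1 lam) (G2 lam) (Fm lam) (K mu) y0 y u"
    using sol by (simp add: SPEP_unique_solution_def)
  have sol': "SPEP_solution P F T \<alpha> c B1 B2 v1 v2 N1 N2
      (b1 (lams k)) (b2 (lams k)) (\<sigma>1 (lams k)) (\<sigma>2 (lams k)) (f1 (lams k)) (f2 (lams k)) (G1 (lams k)) (G2 (lams k))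
      (Fm (lams k)) (K (mus j)) y0 (ys k j) (us k j)" for k j
    using sols[of k j] by (simp add: SPEP_unique_solution_def)
  have yL: "y \<in> L2ad P F T" and uU: "u \<in> U_set P F T (K mu)"
    and vi: "\<forall>w\<in>K mu. AE t in lborel. t \<in> {0..T} \<longrightarrow> (AE \<omega> in P. 0 \<le> induced_op (Fm lam) y u t \<omega> \<bullet> (w - u t \<omega>))"
    using sol0 by (auto simp: SPEP_solution_def induced_op_def)
  have ysL: "ys k j \<in> L2ad P F T" and usU: "us k j \<in> U_set P F T (K (mus j))"
    and vis: "\<forall>w\<in>K (mus j). AE t in lborel. t \<in> {0..T} \<longrightarrow>
        (AE \<omega> in P. 0 \<le> induced_op (Fm (lams k)) (ys k j) (us k j) t \<omega> \<bullet> (w - us k j t \<omega>))" for k j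
    using sol'[of k j] by (auto simp: SPEP_solution_def induced_op_def)
  have uL: "u \<in> L2ad P F T" and usL: "us k j \<in> L2ad P F T" for k j
    using uU usU[of k j] by (auto simp: U_set_def)
  define g where "g = induced_op (Fm lam) y u"
  have g: "g \<in> L2ad P F T" unfolding g_def by (rule Fm_op[OF yL uL])
  define v where "v j t \<omega> = closest_point (K (mus j)) (u t \<omega> - g t \<omega>)" for j t \<omega>
  have vL: "v j \<in> L2ad P F T" for j
    unfolding v_def[abs_def] by (rule L2ad_closest_point[OF K L2ad_diff[OF cf uL g]])
  define d where "d j = (L2_dist P T (v j) u)\<^sup>2" for j
  have d: "d \<longlonglongrightarrow> 0"
    using projections_converge[OF cf uL g K K mosco U_set_AE[OF cf uU K(1)]
        variational_inequality_AE[OF cf g uL vi[folded g_def]]]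
    unfolding d_def v_def .
  \<comment> \<open>The projection is taken at every time and sample point, so membership holds
    everywhere and v may be inserted into the inequality that holds for all test vectors off one
    null set.\<close>
  have vK: "v j t \<omega> \<in> K (mus j)" for j t \<omega>
    unfolding v_def using K by (intro closest_point_in_set) auto
  \<comment> \<open>All these constants are formed from the data at the limiting parameter and the
    common \<open>LF\<close> and \<open>Cbar\<close>; neither k nor j enters them.\<close>
  define C where "C = 2 + 6 * (1 + 2 * LF\<^sup>2) / Cbar\<^sup>2"
  define L where "L = 2 * (Lb lam + L\<sigma> lam + Lf lam + LG lam)"
  define M where "M = 2 * market_const \<alpha> T"
  define a where "a = enn2real M * (8 * T + L * (1 + C * (1 + T))) + 1"
  define D where "D = 2 * a * T * exp (2 * a * T)"
  have C: "0 \<le> C" using constants(1) by (simp add: C_def)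
  have L: "0 \<le> L" using constants(5)[of lam] by (simp add: L_def)
  have M: "M < \<infinity>"
    using market_const_finite[OF params(2) T] by (simp add: M_def ennreal_mult_less_top)
  have "0 < a" unfolding a_def using T L C by (intro add_nonneg_pos mult_nonneg_nonneg add_nonneg_nonneg) auto
  then have D: "0 \<le> D" using T by (simp add: D_def)
  \<comment> \<open>A bound for fixed k and j: the parameter of the coefficients enters through
    \<open>\<epsilon>\<close> only, the constraint set through \<open>d j\<close> only. The prices
    come first, by Gronwall; the shipments then follow from the variational inequality on the whole
    interval.\<close>
  have main: "(L2_dist P T (ys k j) y)\<^sup>2 \<le> D * (\<epsilon>\<^sup>2 + d j) \<and>
      (L2_dist P T (us k j) u)\<^sup>2 \<le> (C * (D + T + 1)) * (\<epsilon>\<^sup>2 + d j)"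
    if \<epsilon>: "0 < \<epsilon>"
      and close: "AE \<omega> in P. \<forall>t\<in>{0..T}. \<forall>y (u :: (real^'m) \<times> (real^'n) \<times> (real^'n^'m)).
          norm (block (b1 (lams k)) (b2 (lams k)) t \<omega> y u - block (b1 lam) (b2 lam) t \<omega> y u) < \<epsilon>"
        "AE \<omega> in P. \<forall>t\<in>{0..T}. \<forall>y (u :: (real^'m) \<times> (real^'n) \<times> (real^'n^'m)).
          norm (block (\<sigma>1 (lams k)) (\<sigma>2 (lams k)) t \<omega> y u - block (\<sigma>1 lam) (\<sigma>2 lam) t \<omega> y u) < \<epsilon>"
        "AE \<omega> in P. \<forall>t\<in>{0..T}. \<forall>y (u :: (real^'m) \<times> (real^'n) \<times> (real^'n^'m)).
          norm (block (f1 (lams k)) (f2 (lams k)) t \<omega> y u - block (f1 lam) (f2 lam) t \<omega> y u) < \<epsilon>"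
        "AE \<omega> in P. \<forall>t\<in>{0..T}. \<forall>y (u :: (real^'m) \<times> (real^'n) \<times> (real^'n^'m)).
          jump_sq c v1 v2 (jump_diff (block (G1 (lams k)) (G2 (lams k)) t \<omega> y u) (block (G1 lam) (G2 lam) t \<omega> y u)) < ennreal (\<epsilon>\<^sup>2)"
        "AE \<omega> in P. \<forall>t\<in>{0..T}. \<forall>y u. norm (Fm (lams k) t \<omega> y u - Fm lam t \<omega> y u) < \<epsilon>"
    for k j \<epsilon>
  proof -
    let ?Y = "\<lambda>t. E_int P t (\<lambda>r \<omega>. esq (ys k j r \<omega> - y r \<omega>))"
    let ?U = "\<lambda>t. E_int P t (\<lambda>r \<omega>. esq (us k j r \<omega> - u r \<omega>))"
    let ?\<delta> = "E_int P T (\<lambda>r \<omega>. esq (v j r \<omega> - u r \<omega>))"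
    have U: "?U t \<le> ennreal C * (?Y t + ennreal (\<epsilon>\<^sup>2 * T) + ?\<delta>)" if t: "t \<in> {0..T}" for t
      unfolding C_def
    proof (rule variational_inequality_estimate[OF cf T _ constants(1) _ _ yL ysL uL usL vL Fm_op Fm_op Fm_lipschitz Fm_monotone])
      show "AE \<omega> in P. \<forall>t\<in>{0..T}. \<forall>y u. norm (Fm (lams k) t \<omega> y u - Fm lam t \<omega> y u) \<le> \<epsilon>"
        using close(5) by eventually_elim (blast intro: less_imp_le)
      show "AE (\<omega>, t) in time_prob P T. 0 \<le> Fm (lams k) t \<omega> (ys k j t \<omega>) (us k j t \<omega>) \<bullet> (v j t \<omega> - us k j t \<omega>)"
        using variational_inequality_AE[OF cf Fm_op[OF ysL usL] usL vis[where k=k and j=j]]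
        by eventually_elim (simp add: case_prod_beta' induced_op_def vK)
      show "AE (\<omega>, t) in time_prob P T.
          - (Fm lam t \<omega> (y t \<omega>) (u t \<omega>) \<bullet> (us k j t \<omega> - v j t \<omega>)) \<le> (v j t \<omega> - u t \<omega>) \<bullet> (us k j t \<omega> - v j t \<omega>)"
        using U_set_AE[OF cf usU[of k j] K(1)]
      proof eventually_elim
        case (elim z)
        \<comment> \<open>The obtuse angle property of the projection, tested with the perturbed
          shipments, which lie in the same set almost everywhere.\<close>
        have "(u (snd z) (fst z) - g (snd z) (fst z) - v j (snd z) (fst z)) \<bullet> (us k j (snd z) (fst z) - v j (snd z) (fst z)) \<le> 0"
          unfolding v_def by (rule closest_point_dot[OF K(2,1) elim])
        then show ?case
          by (simp add: case_prod_beta' g_def induced_op_def inner_diff_left)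
      qed
    qed (use t constants(2) \<epsilon> in auto)
    have \<delta>: "?\<delta> = ennreal (d j)"
      using L2_dist_sq(2)[OF cf vL uL] by (simp add: d_def)
    have Y: "?Y T \<le> ennreal D * (ennreal (\<epsilon>\<^sup>2) + ennreal (d j))"
      unfolding D_def a_def
    proof (rule gronwall_L2ad[OF cf T L2ad_diff[OF cf ysL yL] M L C])
      show "?U t \<le> ennreal C * (?Y t + ennreal (\<epsilon>\<^sup>2 * T) + ennreal (d j))" if "t \<in> {0..T}" for t
        using U[OF that] unfolding \<delta> .
      show "(\<integral>\<^sup>+\<omega>. esq (ys k j t \<omega> - y t \<omega>) \<partial>P) \<le> M * (ennreal (8 * \<epsilon>\<^sup>2 * t) + ennreal L * (?Y t + ?U t))"
        if t: "t \<in> {0..T}" for t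
        unfolding M_def L_def
      proof (rule state_estimate[OF cf params(1,2) brownian intensity poisson coeff coeff growth(1,2) _ _ growth(1,2) _ _ lipschitz _ _ _ _ close(1-4) sol0 sol'])
      qed (use constants(4,5) t in auto)
    qed simp
    have S: "ennreal (\<epsilon>\<^sup>2) + ennreal (d j) = ennreal (\<epsilon>\<^sup>2 + d j)" and dnn: "0 \<le> d j"
      by (simp_all add: d_def)
    have "ennreal ((L2_dist P T (ys k j) y)\<^sup>2) \<le> ennreal (D * (\<epsilon>\<^sup>2 + d j))"
      using Y D dnn unfolding L2_dist_sq(2)[OF cf ysL yL] S by (simp add: ennreal_mult)
    then have 1: "(L2_dist P T (ys k j) y)\<^sup>2 \<le> D * (\<epsilon>\<^sup>2 + d j)"
      using D dnn by (subst (asm) ennreal_le_iff) auto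
    have "ennreal ((L2_dist P T (us k j) u)\<^sup>2) \<le> ennreal C * (?Y T + ennreal (\<epsilon>\<^sup>2 * T) + ?\<delta>)"
      using U[of T] T unfolding L2_dist_sq(2)[OF cf usL uL] by simp
    also have "\<dots> \<le> ennreal C * (ennreal (D * (\<epsilon>\<^sup>2 + d j)) + ennreal (\<epsilon>\<^sup>2 * T) + ennreal (d j))"
      using Y D dnn unfolding \<delta> S by (intro mult_left_mono add_mono order_refl) (auto simp: ennreal_mult)
    also have "\<dots> = ennreal (C * (D * (\<epsilon>\<^sup>2 + d j) + \<epsilon>\<^sup>2 * T + d j))"
      using C D T dnn by (simp add: ennreal_mult)
    finally have "(L2_dist P T (us k j) u)\<^sup>2 \<le> C * (D * (\<epsilon>\<^sup>2 + d j) + \<epsilon>\<^sup>2 * T + d j)"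
      using C D T dnn by (subst (asm) ennreal_le_iff) auto
    \<comment> \<open>The single factor \<open>D + T + 1\<close> brings the bound into the shape
      required by \<open>double_limit_zero\<close>.\<close>
    also have "\<dots> \<le> C * ((D + T + 1) * (\<epsilon>\<^sup>2 + d j))"
    proof (rule mult_left_mono[OF _ C])
      have "0 \<le> T * d j" using T dnn by simp
      then show "D * (\<epsilon>\<^sup>2 + d j) + \<epsilon>\<^sup>2 * T + d j \<le> (D + T + 1) * (\<epsilon>\<^sup>2 + d j)"
        by (simp add: algebra_simps)
    qed
    finally show ?thesis using 1 by (simp add: mult.assoc)
  qed
  have ev: "\<forall>\<^sub>F k in sequentially. \<forall>j. (L2_dist P T (ys k j) y)\<^sup>2 \<le> D * (\<epsilon>\<^sup>2 + d j) \<and>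
      (L2_dist P T (us k j) u)\<^sup>2 \<le> (C * (D + T + 1)) * (\<epsilon>\<^sup>2 + d j)" if \<epsilon>: "0 < \<epsilon>" for \<epsilon>
  proof -
    \<comment> \<open>The coefficients do not depend on the constraint parameter, so uniform
      continuity along \<open>lams\<close> gives all five closeness conditions from some k on,
      simultaneously for every j.\<close>
    have near: "\<forall>\<^sub>F k in sequentially. Q (lams k) lam"
      if ex: "\<exists>\<delta>>0. \<forall>l1 l2. dist l1 l2 < \<delta> \<longrightarrow> Q l1 l2" for Q :: "'l \<Rightarrow> 'l \<Rightarrow> bool"
    proof -
      obtain \<delta> where "0 < \<delta>" "\<forall>l1 l2. dist l1 l2 < \<delta> \<longrightarrow> Q l1 l2" using ex by blast
      with tendstoD[OF lams, of \<delta>] show ?thesis by (auto elim: eventually_mono)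
    qed
    show ?thesis
      using near[OF unif_cont(1)[unfolded uniformly_continuous_param_def, rule_format, OF \<epsilon>]]
        near[OF unif_cont(2)[unfolded uniformly_continuous_param_def, rule_format, OF \<epsilon>]]
        near[OF unif_cont(3)[unfolded uniformly_continuous_param_def, rule_format, OF \<epsilon>]]
        near[OF unif_cont(4)[unfolded jump_uniformly_continuous_param_def, rule_format, OF \<epsilon>]]
        near[OF unif_cont(5)[unfolded uniformly_continuous_param_def, rule_format, OF \<epsilon>]]
    proof eventually_elim
      case (elim k)
      show ?case by (rule allI, rule main[OF \<epsilon> elim])
    qed
  qed
  show ?thesis
  proof
    show "((\<lambda>(k, j). L2_dist P T (ys k j) y) \<longlongrightarrow> 0) (sequentially \<times>\<^sub>F sequentially)"
    proof (rule double_limit_zero[OF D L2_dist_sq(3)[OF cf ysL yL] d])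
      show "\<forall>\<^sub>F k in sequentially. \<forall>j. (L2_dist P T (ys k j) y)\<^sup>2 \<le> D * (\<epsilon>\<^sup>2 + d j)" if "0 < \<epsilon>" for \<epsilon>
        using ev[OF that] by eventually_elim blast
    qed
    show "((\<lambda>(k, j). L2_dist P T (us k j) u) \<longlongrightarrow> 0) (sequentially \<times>\<^sub>F sequentially)"
    proof (rule double_limit_zero[OF _ L2_dist_sq(3)[OF cf usL uL] d])
      show "0 \<le> C * (D + T + 1)" using C D T by simp
      show "\<forall>\<^sub>F k in sequentially. \<forall>j. (L2_dist P T (us k j) u)\<^sup>2 \<le> (C * (D + T + 1)) * (\<epsilon>\<^sup>2 + d j)"
        if "0 < \<epsilon>" for \<epsilon>
        using ev[OF that] by eventually_elim blast
    qed
  qed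
qed

end
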